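(* Let $\eta_1,\dots,\eta_n\in L^2(K)$. Then $(\eta_1,\dots,\eta_n)$ is a super-wavelet of length $n$ if and only if the following hold: (i) $\sum_{j\in\mathbb Z}|\widehat{\eta}_i(\mathfrak p^j\xi)|^2=1$ for a.e. $\xi\in K$, $i=1,\dots,n$; (ii) $\sum_{j=0}^{\infty}\widehat{\eta}_i(\mathfrak p^{-j}\xi)\,\overline{\widehat{\eta}_i(\mathfrak p^{-j}(\xi+u(s)))}=0$ for a.e. $\xi\in K$, $s\in\mathbb N_0\setminus q\mathbb N_0$, $i=1,\dots,n$; and (iii) $\sum_{k\in\mathbb N_0}\sum_{i=1}^n\widehat{\eta}_i(\mathfrak p^{-j}(\xi+u(k)))\,\overline{\widehat{\eta}_i(\xi+u(k))}=\delta_{j,0}$ for a.e. $\xi\in K$, $j\in\mathbb N_0$.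
   Context: Local field setup. $K$ is a local field of positive characteristic, i.e. a locally compact, non-discrete, totally disconnected field of characteristic $p>0$, with absolute value $|\cdot|$. $\mathcal O=\{x\in K:|x|\le 1\}$ is the ring of integers, $\mathfrak P=\{x\in K:|x|<1\}$ its maximal ideal, $\mathfrak p$ a fixed prime element ($\mathfrak P=\mathfrak p\mathcal O$), $\mathcal O^*=\mathcal O\setminus\mathfrak P$, and $\mathcal O/\mathfrak P\cong GF(q)$ with $q=p^c$; $|\mathfrak p|=q^{-1}$. $dx$ is the Haar measure on $(K,+)$ with $|\mathcal O|=1$, where $|E|$ denotes the Haar measure of a measurable set $E$. $\mathbb N_0=\mathbb N\cup\{0\}$. The elements $u(n)$, $n\in\mathbb N_0$: fix $\{1=\epsilon_0,\epsilon_1,\dots,\epsilon_{c-1}\}\subset\mathcal O^*$ whose images in $\mathcal O/\mathfrak P$ form a basis of $GF(q)$ over $GF(p)$. For $0\le n<q$ write $n=\sum_{k=0}^{c-1}a_kp^k$, $0\le a_k<p$, and set $u(n)=\big(\sum_{k=0}^{c-1}a_k\epsilon_k\big)\mathfrak p^{-1}$. For general $n=\sum_{k=0}^s b_kq^k$, $0\le b_k<q$, set $u(n)=\sum_{k=0}^s u(b_k)\mathfrak p^{-k}$. The set $\{u(n)\}_{n\in\mathbb N_0}$ is a complete list of distinct coset representatives of $\mathcal O$ in $(K,+)$. Character and Fourier transform: $\chi$ is a fixed character of $(K,+)$, trivial on $\mathcal O$ and nontrivial on $\mathfrak P^{-1}=\mathfrak p^{-1}\mathcal O$; $\chi_y(x)=\chi(yx)$;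 the setup is such that $\chi_{u(k)}(u(l))=1$ for all $k,l\in\mathbb N_0$. $\widehat f(\xi)=\int_K f(x)\overline{\chi_\xi(x)}\,dx$ for $f\in L^1(K)$, extended to $L^2(K)$. Operators on $L^2(K)$: $D^jf(x)=q^{j/2}f(\mathfrak p^{-j}x)$ for $j\in\mathbb Z$, and $T^kf(x)=f(x-u(k))$ for $k\in\mathbb N_0$. Definitions. $\eta\in L^2(K)$ is a Parseval frame wavelet if $\|f\|^2=\sum_{(j,k)\in\mathbb Z\times\mathbb N_0}|\langle f,D^jT^k\eta\rangle|^2$ for every $f\in L^2(K)$. An $n$-tuple $(\eta_1,\dots,\eta_n)$ of Parseval frame wavelets for $L^2(K)$ is a super-wavelet of length $n$ if $\{D^jT^k\eta_1\oplus\cdots\oplus D^jT^k\eta_n: j\in\mathbb Z,\ k\in\mathbb N_0\}$ is an orthonormal basis for the $n$-fold direct sum Hilbert space $L^2(K)\oplus\cdots\oplus L^2(K)$. $\delta_{j,0}$ is the Kronecker delta. *)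

theory Defs
  imports "HOL-Analysis.Analysis" "HOL-Computational_Algebra.Computational_Algebra"
begin

text \<open>
  That \<open>absval\<close> is nonnegative and vanishes exactly at 0, and that it induces the topology,
  comes from the metric through \<open>dist_absval\<close>. The library's \<open>norm\<close> is not used since its type
  is constrained to real vector spaces.
\<close>

class nonarch_field = field + metric_space +
  fixes absval :: "'a \<Rightarrow> real"
  assumes dist_absval: "dist x y = absval (x - y)"
    and absval_mult: "absval (x * y) = absval x * absval y"
    and absval_ultrametric: "absval (x + y) \<le> max (absval x) (absval y)"

definition local_field_pos_char :: "'k::nonarch_field itself \<Rightarrow> bool"
  where "local_field_pos_char K \<longleftrightarrow>
    locally compact (UNIV :: 'k set) \<and>
    \<not> (\<forall>S :: 'k set. open S) \<and>
    (\<forall>C :: 'k set. connected C \<longrightarrow> (\<forall>x\<in>C. \<forall>y\<in>C. x = y)) \<and>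
    CHAR('k) > 0"

definition integer_ring :: "'k::nonarch_field set"
  where "integer_ring = {x. absval x \<le> 1}"

definition max_ideal :: "'k::nonarch_field set"
  where "max_ideal = {x. absval x < 1}"

definition residue_field :: "'k::nonarch_field set set"
  where "residue_field =
    integer_ring // {(x, y). x \<in> integer_ring \<and> y \<in> integer_ring \<and> x - y \<in> max_ideal}"

text \<open>
  In \<open>residue_basis\<close>, \<open>GF(p)\<close> is the image of the integers in the residue field,
  so an integer coefficient is zero there iff \<open>p\<close> divides it.
\<close>

definition residue_basis :: "nat \<Rightarrow> nat \<Rightarrow> (nat \<Rightarrow> 'k::nonarch_field) \<Rightarrow> bool"
  where "residue_basis p c \<epsilon> \<longleftrightarrow>
    (\<forall>x\<in>integer_ring. \<exists>a :: nat \<Rightarrow> int. x - (\<Sum>k<c. of_int (a k) * \<epsilon> k) \<in> max_ideal) \<and>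
    (\<forall>a :: nat \<Rightarrow> int. (\<Sum>k<c. of_int (a k) * \<epsilon> k) \<in> max_ideal \<longrightarrow> (\<forall>k<c. int p dvd a k))"

definition u_digit ::
    "nat \<Rightarrow> nat \<Rightarrow> 'k::nonarch_field \<Rightarrow> (nat \<Rightarrow> 'k) \<Rightarrow> nat \<Rightarrow> 'k"
  where "u_digit p c \<pp> \<epsilon> n = (\<Sum>k<c. of_nat ((n div p ^ k) mod p) * \<epsilon> k) * inverse \<pp>"

text \<open>
  The \<open>k\<close>-th digit of \<open>n\<close> in base \<open>q = p ^ c\<close> vanishes for \<open>k > n\<close>, and \<open>u_digit\<close> vanishes at 0,
  so the sum may be cut off at \<open>n\<close>.
\<close>

definition u :: "nat \<Rightarrow> nat \<Rightarrow> 'k::nonarch_field \<Rightarrow> (nat \<Rightarrow> 'k) \<Rightarrow> nat \<Rightarrow> 'k"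
  where "u p c \<pp> \<epsilon> n =
    (\<Sum>k\<le>n. u_digit p c \<pp> \<epsilon> ((n div (p ^ c) ^ k) mod p ^ c) * \<pp> powi (- int k))"

definition haar_measure :: "'k::nonarch_field measure \<Rightarrow> bool"
  where "haar_measure \<mu> \<longleftrightarrow>
    sets \<mu> = sets borel \<and>
    (\<forall>a. \<forall>E\<in>sets \<mu>. emeasure \<mu> ((+) a ` E) = emeasure \<mu> E) \<and>
    emeasure \<mu> integer_ring = 1"

definition additive_character :: "('k::nonarch_field \<Rightarrow> complex) \<Rightarrow> bool"
  where "additive_character chi \<longleftrightarrow>
    continuous_on UNIV chi \<and> (\<forall>x. cmod (chi x) = 1) \<and> (\<forall>x y. chi (x + y) = chi x * chi y)"

locale local_field_setup =
  fixes p c q :: nat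
    and \<pp> :: "'k::nonarch_field"
    and \<epsilon> :: "nat \<Rightarrow> 'k"
    and chi :: "'k \<Rightarrow> complex"
    and \<mu> :: "'k measure"
  assumes local_field: "local_field_pos_char TYPE('k)"
    and char_p: "CHAR('k) = p"
    and c_pos: "c \<ge> 1"
    and q_eq: "q = p ^ c"
    and card_residue: "card (residue_field :: 'k set set) = q"
    and prime_element: "(max_ideal :: 'k set) = (*) \<pp> ` integer_ring"
    and norm_prime_element: "absval \<pp> = 1 / real q"
    and eps_0: "\<epsilon> 0 = 1"
    and eps_unit: "k < c \<Longrightarrow> \<epsilon> k \<in> integer_ring - max_ideal"
    and eps_basis: "residue_basis p c \<epsilon>"
    and haar: "haar_measure \<mu>"
    and character: "additive_character chi"
    and character_trivial: "x \<in> integer_ring \<Longrightarrow> chi x = 1"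
    and character_nontrivial: "\<exists>x \<in> (*) (inverse \<pp>) ` integer_ring. chi x \<noteq> 1"
    and character_u: "chi (u p c \<pp> \<epsilon> k * u p c \<pp> \<epsilon> l) = 1"

text \<open>Elements of \<open>L\<^sup>2\<close> are represented by functions; equality in \<open>L\<^sup>2\<close> is equality a.e.\<close>

definition L2 :: "'k measure \<Rightarrow> ('k \<Rightarrow> complex) set"
  where "L2 \<mu> = {f. f \<in> borel_measurable \<mu> \<and> integrable \<mu> (\<lambda>x. (cmod (f x))\<^sup>2)}"

definition L2_inner :: "'k measure \<Rightarrow> ('k \<Rightarrow> complex) \<Rightarrow> ('k \<Rightarrow> complex) \<Rightarrow> complex"
  where "L2_inner \<mu> f g = (\<integral>x. f x * cnj (g x) \<partial>\<mu>)"

definition L2_norm :: "'k measure \<Rightarrow> ('k \<Rightarrow> complex) \<Rightarrow> real"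
  where "L2_norm \<mu> f = sqrt (\<integral>x. (cmod (f x))\<^sup>2 \<partial>\<mu>)"

definition fourier_L1 ::
    "('k::nonarch_field \<Rightarrow> complex) \<Rightarrow> 'k measure \<Rightarrow> ('k \<Rightarrow> complex) \<Rightarrow> 'k \<Rightarrow> complex"
  where "fourier_L1 chi \<mu> f \<xi> = (\<integral>x. f x * cnj (chi (\<xi> * x)) \<partial>\<mu>)"

text \<open>
  \<open>fourier\<close> is the continuous extension to \<open>L\<^sup>2\<close> of the transform on \<open>L\<^sup>1 \<inter> L\<^sup>2\<close>. The value is
  determined only up to a null set, and \<open>SOME\<close> selects a representative.
\<close>

definition fourier ::
    "('k::nonarch_field \<Rightarrow> complex) \<Rightarrow> 'k measure \<Rightarrow> ('k \<Rightarrow> complex) \<Rightarrow> 'k \<Rightarrow> complex"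
  where "fourier chi \<mu> f = (SOME g. g \<in> L2 \<mu> \<and>
    (\<forall>F :: nat \<Rightarrow> 'k \<Rightarrow> complex.
      (\<forall>m. integrable \<mu> (F m) \<and> F m \<in> L2 \<mu>) \<longrightarrow>
      (\<lambda>m. L2_norm \<mu> (\<lambda>x. F m x - f x)) \<longlonglongrightarrow> 0 \<longrightarrow>
      (\<forall>m. fourier_L1 chi \<mu> (F m) \<in> L2 \<mu>) \<and>
      (\<lambda>m. L2_norm \<mu> (\<lambda>\<xi>. fourier_L1 chi \<mu> (F m) \<xi> - g \<xi>)) \<longlonglongrightarrow> 0))"

definition dilation ::
    "nat \<Rightarrow> 'k::nonarch_field \<Rightarrow> int \<Rightarrow> ('k \<Rightarrow> complex) \<Rightarrow> 'k \<Rightarrow> complex"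
  where "dilation q \<pp> j f x = of_real (real q powr (of_int j / 2)) * f (\<pp> powi (- j) * x)"

definition translation ::
    "(nat \<Rightarrow> 'k::nonarch_field) \<Rightarrow> nat \<Rightarrow> ('k \<Rightarrow> complex) \<Rightarrow> 'k \<Rightarrow> complex"
  where "translation v k f x = f (x - v k)"

definition parseval_frame_wavelet ::
    "nat \<Rightarrow> 'k::nonarch_field \<Rightarrow> (nat \<Rightarrow> 'k) \<Rightarrow> 'k measure \<Rightarrow> ('k \<Rightarrow> complex) \<Rightarrow> bool"
  where "parseval_frame_wavelet q \<pp> v \<mu> \<eta> \<longleftrightarrow> \<eta> \<in> L2 \<mu> \<and>
    (\<forall>f\<in>L2 \<mu>. ((\<lambda>(j, k). (cmod (L2_inner \<mu> f (dilation q \<pp> j (translation v k \<eta>))))\<^sup>2)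
       has_sum (L2_norm \<mu> f)\<^sup>2) (UNIV :: (int \<times> nat) set))"

text \<open>
  An element of the \<open>n\<close>-fold direct sum is a family of functions of which only the components
  with index in \<open>{1..n}\<close> matter.
\<close>

definition L2_sum :: "'k measure \<Rightarrow> nat \<Rightarrow> (nat \<Rightarrow> 'k \<Rightarrow> complex) set"
  where "L2_sum \<mu> n = {F. \<forall>i\<in>{1..n}. F i \<in> L2 \<mu>}"

definition L2_sum_inner ::
    "'k measure \<Rightarrow> nat \<Rightarrow> (nat \<Rightarrow> 'k \<Rightarrow> complex) \<Rightarrow> (nat \<Rightarrow> 'k \<Rightarrow> complex) \<Rightarrow> complex"
  where "L2_sum_inner \<mu> n F G = (\<Sum>i=1..n. L2_inner \<mu> (F i) (G i))"

definition L2_sum_norm :: "'k measure \<Rightarrow> nat \<Rightarrow> (nat \<Rightarrow> 'k \<Rightarrow> complex) \<Rightarrow> real"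
  where "L2_sum_norm \<mu> n F = sqrt (\<Sum>i=1..n. (L2_norm \<mu> (F i))\<^sup>2)"

definition orthonormal_basis ::
    "'k measure \<Rightarrow> nat \<Rightarrow> 'b set \<Rightarrow> ('b \<Rightarrow> nat \<Rightarrow> 'k \<Rightarrow> complex) \<Rightarrow> bool"
  where "orthonormal_basis \<mu> n I E \<longleftrightarrow>
    (\<forall>a\<in>I. E a \<in> L2_sum \<mu> n) \<and>
    (\<forall>a\<in>I. \<forall>b\<in>I. L2_sum_inner \<mu> n (E a) (E b) = (if a = b then 1 else 0)) \<and>
    (\<forall>F\<in>L2_sum \<mu> n. \<forall>r>0. \<exists>A z. finite A \<and> A \<subseteq> I \<and>
       L2_sum_norm \<mu> n (\<lambda>i x. F i x - (\<Sum>a\<in>A. z a * E a i x)) < r)"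

definition super_wavelet ::
    "nat \<Rightarrow> 'k::nonarch_field \<Rightarrow> (nat \<Rightarrow> 'k) \<Rightarrow> 'k measure \<Rightarrow> nat \<Rightarrow>
      (nat \<Rightarrow> 'k \<Rightarrow> complex) \<Rightarrow> bool"
  where "super_wavelet q \<pp> v \<mu> n \<eta> \<longleftrightarrow>
    (\<forall>i\<in>{1..n}. parseval_frame_wavelet q \<pp> v \<mu> (\<eta> i)) \<and>
    orthonormal_basis \<mu> n (UNIV :: (int \<times> nat) set)
      (\<lambda>(j, k) i. dilation q \<pp> j (translation v k (\<eta> i)))"

end

theory Submission
  imports Defs "HOL-Number_Theory.Cong"
begin

text \<open>
  The coset representatives \<open>u n\<close> form an additive group, because addition in characteristic \<open>p\<close> has no
  carries (\<open>lat_add\<close>, \<open>lat_minus\<close>). Call it the lattice \<open>L\<close>. The field is the direct sum of \<open>L\<close> and the ring of integers,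
  and \<open>chi\<close> is trivial on products of two elements of \<open>L\<close>. Therefore the functions that are equal to
  \<open>chi (l * x)\<close> on one coset \<open>k + O\<close> and vanish elsewhere, for \<open>l\<close> and \<open>k\<close> in \<open>L\<close>, form an orthonormal basis of
  \<open>L\<^sup>2(K)\<close>, and the Fourier transform sends the pair \<open>(l, k)\<close> to \<open>(- k, l)\<close>. Plancherel's theorem and the
  behaviour under translations by \<open>L\<close> are read off from the coefficients in this basis
  (\<open>gabor_Parseval\<close>, \<open>fourier_coeffs_fourier\<close>).

  If every component is a Parseval frame wavelet and the system in the direct sum is orthonormal, then it is
  complete: a vector concentrated in one component satisfies Bessel's inequality with equality, hence lies in
  the closed span (\<open>orthonormal_Parseval_components_complete\<close>). So a super-wavelet is the same as
  Parseval components together with orthonormality, and the two properties are treated separately.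

  Orthonormality is the third condition. Up to a nonzero factor, the inner product of the elements with indices
  \<open>(- m, k)\<close> and \<open>(0, k')\<close> is a Fourier coefficient of the function that is summed over the lattice in the third
  condition for \<open>j = m\<close>. As all coefficients occur, the system is orthonormal iff this periodic function
  is 1 for \<open>m = 0\<close> and 0 otherwise (\<open>orthonormal_iff_correlation\<close>).

  The Parseval property of one component is equivalent to the first two conditions. Let \<open>\<phi>\<close> be the transform of the
  component. Parseval's identity on the ring of integers at each level \<open>j\<close> expands the sum of the squared
  coefficients of a test function with transform \<open>f\<close>, and collecting the terms with the same shift
  \<open>l = \<pp> powi (- j) * m\<close>, \<open>m\<close> in \<open>L\<close>, yields the sum over \<open>l\<close> of the integrals of \<open>f x * cnj (f (l + x)) * t l x\<close>, where
  \<open>t l x\<close> is the sum of \<open>cnj (\<phi> (\<pp> powi j * x)) * \<phi> (\<pp> powi j * (l + x))\<close> over all \<open>j\<close> with \<open>\<pp> powi j * l\<close> in \<open>L\<close>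
  (\<open>quadratic_form_expansion\<close>, \<open>shift_sum_integral\<close>). The first condition says that \<open>t 0\<close> is 1, the second one that \<open>t l\<close>
  vanishes for all other shifts. Together they give the Parseval identity for a dense set of \<open>f\<close>
  (\<open>Parseval_if_shift_sums\<close>). Conversely, polarize the identity and insert the indicator functions of a small
  coset and of its translate by a lattice point \<open>l0\<close>: only the shifts near \<open>l0\<close> contribute, and as the cosets
  shrink, the integral of \<open>t l0\<close> over any coset away from 0 and \<open>- l0\<close> is found to be that of a constant
  (\<open>integral_shift_sum\<close>, \<open>shift_sums_if_Parseval\<close>).
\<close>

section \<open>Absolute value\<close>

lemma absval_eq_dist: "absval (x :: 'k::nonarch_field) = dist x 0"
  by (simp add: dist_absval)

lemma absval_zero [simp]: "absval (0 :: 'k::nonarch_field) = 0"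
  by (simp add: absval_eq_dist)

lemma absval_nonneg [simp]: "absval (x :: 'k::nonarch_field) \<ge> 0"
  by (simp add: absval_eq_dist)

lemma absval_eq_0_iff [simp]: "absval (x :: 'k::nonarch_field) = 0 \<longleftrightarrow> x = 0"
  by (simp add: absval_eq_dist)

lemma absval_one [simp]: "absval (1 :: 'k::nonarch_field) = 1"
proof -
  have "absval (1::'k) * absval (1::'k) = absval (1::'k)" by (simp flip: absval_mult)
  then show ?thesis by simp
qed

lemma absval_minus [simp]: "absval (- x :: 'k::nonarch_field) = absval x"
proof -
  have "absval (-x) = dist 0 x" by (simp add: dist_absval)
  also have "\<dots> = absval x" by (simp add: absval_eq_dist dist_commute)
  finally show ?thesis .
qed

lemma absval_diff_le: "absval (x - y :: 'k::nonarch_field) \<le> max (absval x) (absval y)"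
  using absval_ultrametric[of x "-y"] by simp

text \<open>In an ultrametric triangle the two longest sides have the same length.\<close>
lemma absval_add_eq:
  assumes "absval (x :: 'k::nonarch_field) < absval y"
  shows "absval (x + y) = absval y"
proof (rule antisym)
  show "absval (x + y) \<le> absval y" using absval_ultrametric[of x y] assms by simp
  have "absval y \<le> max (absval (x + y)) (absval x)"
    using absval_diff_le[of "x + y" x] by simp
  then show "absval y \<le> absval (x + y)" using assms by simp
qed

lemma absval_inverse [simp]: "absval (inverse x :: 'k::nonarch_field) = inverse (absval x)"
proof (cases "x = 0")
  case False
  then have "absval x * absval (inverse x) = 1" by (simp flip: absval_mult)
  then show ?thesis using inverse_unique by metis
qed auto

lemma absval_divide [simp]: "absval (x / y :: 'k::nonarch_field) = absval x / absval y"
  by (simp add: divide_inverse absval_mult)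

lemma absval_power [simp]: "absval (x ^ n :: 'k::nonarch_field) = absval x ^ n"
  by (induction n) (auto simp: absval_mult)

lemma absval_powi: "absval (x powi n :: 'k::nonarch_field) = absval x powi n"
  by (simp add: power_int_def)

lemma absval_of_nat_le_1: "absval (of_nat n :: 'k::nonarch_field) \<le> 1"
proof (induction n)
  case (Suc n)
  then show ?case using absval_ultrametric[of "1::'k" "of_nat n"] by simp
qed simp

lemma absval_of_int_le_1: "absval (of_int n :: 'k::nonarch_field) \<le> 1"
  by (cases n) (metis absval_of_nat_le_1 of_int_of_nat_eq,
    metis absval_minus absval_of_nat_le_1 of_int_minus of_int_of_nat_eq)

lemma absval_sum_le:
  assumes "\<And>i. i \<in> A \<Longrightarrow> absval (f i :: 'k::nonarch_field) \<le> r" "r \<ge> 0"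
  shows "absval (\<Sum>i\<in>A. f i) \<le> r"
  using assms
proof (induction A rule: infinite_finite_induct)
  case (insert x F)
  then show ?case using absval_ultrametric[of "f x" "sum f F"] by fastforce
qed auto

lemma continuous_on_add_field: "continuous_on S (\<lambda>x. a + x :: 'k::nonarch_field)"
  unfolding continuous_on_iff by (auto simp: dist_absval)

lemma continuous_on_mult_field: "continuous_on S (\<lambda>x. a * x :: 'k::nonarch_field)"
  unfolding continuous_on_iff
proof (intro ballI allI impI)
  fix x and e :: real assume e: "0 < e"
  have *: "dist (a * y) (a * z) = absval a * dist y z" for y z
    by (simp add: dist_absval flip: absval_mult) (simp add: algebra_simps)
  show "\<exists>d>0. \<forall>x'\<in>S. dist x' x < d \<longrightarrow> dist (a * x') (a * x) < e"
  proof (cases "a = 0")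
    case False
    then have pos: "absval a > 0" by (simp add: less_le)
    then show ?thesis unfolding * using e
      by (intro exI[of _ "e / absval a"]) (auto simp: field_simps)
  qed (use e in auto)
qed

section \<open>The lattice of coset representatives\<close>

context local_field_setup
begin

abbreviation v :: "nat \<Rightarrow> 'k" where "v \<equiv> u p c \<pp> \<epsilon>"

text \<open>The balls around 0 are the fractional ideals. They are indexed by the exponent of the radius:
  \<open>disc 0\<close> is the ring of integers and \<open>disc (-1)\<close> its maximal ideal.\<close>
definition disc :: "int \<Rightarrow> 'k set" where "disc N = {x. absval x \<le> real q powi N}"

text \<open>The coset representatives form an additive group, since addition in characteristic \<open>p\<close> has no
  carries. This group is a lattice that behaves in \<open>K\<close> as the integers do in the real line:
  it is discrete, a complement of the ring of integers, and orthogonal to itself under \<open>chi\<close>.\<close>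
definition lat :: "'k set" where "lat = range v"

lemma p_prime: "prime p"
proof -
  have "p > 0" using local_field char_p unfolding local_field_pos_char_def by simp
  then show ?thesis using char_p prime_CHAR_semidom[where ?'a = 'k] by simp
qed

lemma p_ge_2: "p \<ge> 2" using p_prime prime_ge_2_nat by blast

lemma q_ge_2: "q \<ge> 2"
proof -
  have "2 ^ 1 \<le> (2::nat) ^ c" using c_pos by (intro power_increasing) auto
  also have "\<dots> \<le> p ^ c" using p_ge_2 by (rule power_mono) simp
  finally show ?thesis by (simp add: q_eq)
qed

lemma q_gt_1: "real q > 1" using q_ge_2 by simp
lemma q_pos [simp]: "real q > 0" "q > 0" "q \<noteq> 0" using q_ge_2 by simp_all

lemma pp_nonzero [simp]: "\<pp> \<noteq> 0"
proof
  assume "\<pp> = 0"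
  then have "absval \<pp> = 0" by simp
  then show False using norm_prime_element q_gt_1 by simp
qed

lemma absval_pp_powi [simp]: "absval (\<pp> powi j) = real q powi (- j)"
  by (simp add: absval_powi norm_prime_element power_int_minus power_int_divide_distrib field_simps)

lemma absval_pp: "absval \<pp> = real q powi (- 1)"
  using absval_pp_powi[of 1] by simp

lemma powi_le_iff: "real q powi a \<le> real q powi b \<longleftrightarrow> a \<le> b"
  using power_int_increasing[of a b "real q"] power_int_strict_increasing[of b a "real q"] q_gt_1
  by (metis less_imp_le linorder_not_le not_less)

lemma integer_ring_eq: "integer_ring = disc 0"
  by (simp add: integer_ring_def disc_def)

lemma max_ideal_eq: "(max_ideal :: 'k set) = disc (- 1)"
proof -
  have "x \<in> (*) \<pp> ` integer_ring \<longleftrightarrow> x \<in> disc (- 1)" for x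
  proof
    assume "x \<in> (*) \<pp> ` integer_ring"
    then show "x \<in> disc (- 1)" using mult_left_mono[of "absval _" 1 "inverse (real q)"]
      by (auto simp: integer_ring_def disc_def absval_mult absval_pp power_int_minus)
  next
    assume "x \<in> disc (- 1)"
    then have "absval (x / \<pp>) \<le> 1" by (simp add: disc_def absval_pp)
    then show "x \<in> (*) \<pp> ` integer_ring"
      by (intro image_eqI[of _ _ "x / \<pp>"]) (auto simp: integer_ring_def)
  qed
  then show ?thesis using prime_element by blast
qed

text \<open>The value group is generated by \<open>q\<close>: between two consecutive powers lies no absolute value,
  since \<open>\<pp>\<close> generates the maximal ideal.\<close>
lemma absval_cases:
  assumes "x \<noteq> (0 :: 'k)"
  obtains N :: int where "absval x = real q powi N"
proof -
  have pos: "absval x > 0" using assms by (simp add: less_le)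
  define N where "N = \<lfloor>log (real q) (absval x)\<rfloor>"
  have pw: "real q powi M = real q powr (real_of_int M)" for M
    by (simp add: powr_real_of_int')
  have lo: "real q powi N \<le> absval x"
    using pos q_gt_1 le_log_iff[of "real q" "absval x" "real_of_int N"] by (simp add: pw N_def)
  have hi: "absval x < real q powi (N + 1)"
    using pos q_gt_1 log_less_iff[of "real q" "absval x" "real_of_int (N+1)"]
    unfolding pw N_def by linarith
  define y where "y = \<pp> powi (N + 1) * x"
  have y: "absval y = real q powi (- (N + 1)) * absval x" by (simp add: y_def absval_mult)
  have "absval y < real q powi (- (N + 1)) * real q powi (N + 1)"
    unfolding y using hi by (intro mult_strict_left_mono) auto
  then have "absval y < 1" by (simp flip: power_int_add)
  then have "y \<in> disc (- 1)" using max_ideal_eq by (auto simp: max_ideal_def)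
  then have "real q powi (- (N + 1)) * absval x \<le> real q powi (- 1)" using y by (simp add: disc_def)
  then have "real q powi (N + 1) * (real q powi (- (N + 1)) * absval x)
      \<le> real q powi (N + 1) * real q powi (- 1)"
    by (intro mult_left_mono) auto
  then have "absval x \<le> real q powi N"
    by (simp add: mult.assoc[symmetric] del: minus_add_distrib flip: power_int_add)
      (simp add: power_int_add mult.assoc)
  then show ?thesis using that lo by force
qed

lemma disc_zero [simp]: "0 \<in> disc N" by (simp add: disc_def)

lemma disc_add: "x \<in> disc N \<Longrightarrow> y \<in> disc N \<Longrightarrow> x + y \<in> disc N"
  using absval_ultrametric[of x y] by (auto simp: disc_def)

lemma disc_minus [simp]: "- x \<in> disc N \<longleftrightarrow> x \<in> disc N"
  by (simp add: disc_def)

lemma disc_diff: "x \<in> disc N \<Longrightarrow> y \<in> disc N \<Longrightarrow> x - y \<in> disc N"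
  using absval_diff_le[of x y] by (auto simp: disc_def)

lemma disc_mono: "M \<le> N \<Longrightarrow> disc M \<subseteq> disc N"
  unfolding disc_def using powi_le_iff by force

lemma disc_add_iff [simp]: "d \<in> disc N \<Longrightarrow> x + d \<in> disc N \<longleftrightarrow> x \<in> disc N"
  using disc_add[of x N d] disc_diff[of "x + d" N d] by auto

lemma disc_mult: "x \<in> disc M \<Longrightarrow> y \<in> disc N \<Longrightarrow> x * y \<in> disc (M + N)"
  by (auto simp: disc_def absval_mult power_int_add intro!: mult_mono)

lemma pp_powi_mult_disc: "\<pp> powi j * x \<in> disc N \<longleftrightarrow> x \<in> disc (N + j)"
proof -
  have "real q powi (-j) * absval x \<le> real q powi N \<longleftrightarrow> absval x \<le> real q powi N * real q powi j"
    by (simp add: power_int_minus field_simps)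
  then show ?thesis by (simp add: disc_def absval_mult power_int_add)
qed

lemma ex_disc: "\<exists>n::nat. x \<in> disc (int n)"
proof (cases "x = 0")
  case False
  then obtain N where "absval x = real q powi N" by (rule absval_cases)
  then have "x \<in> disc (int (nat N))" by (simp add: disc_def powi_le_iff)
  then show ?thesis ..
qed auto

lemma not_in_small_disc:
  assumes "x \<noteq> 0" obtains N where "x \<notin> disc N"
proof -
  obtain M where "absval x = real q powi M" using assms by (rule absval_cases)
  then have "x \<notin> disc (M - 1)" by (simp add: disc_def powi_le_iff)
  then show ?thesis by (rule that)
qed

subsection \<open>Digits\<close>

text \<open>Only the residues of the coefficients modulo \<open>p\<close> matter. Arbitrary coefficients are allowed here
  because this makes the closure under addition evident.\<close>
definition digits :: "'k set" where
  "digits = range (\<lambda>a :: nat \<Rightarrow> nat. (\<Sum>k<c. of_nat (a k) * \<epsilon> k) * inverse \<pp>)"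

lemma of_nat_mod_p: "of_nat (n mod p) = (of_nat n :: 'k)"
  using char_p by (metis of_nat_eq_iff_cong_CHAR cong_mod_left cong_refl)

lemma digit_expansion: "\<exists>n<m ^ k. \<forall>i<k. (n div m ^ i) mod m = (a i :: nat) mod m" if "m > 0"
proof (induction k arbitrary: a)
  case 0
  then show ?case by (auto intro: exI[of _ 0])
next
  case (Suc k)
  obtain n where n: "n < m ^ k" "\<forall>i<k. (n div m ^ i) mod m = a (Suc i) mod m"
    using Suc.IH[of "\<lambda>i. a (Suc i)"] by blast
  have "(a 0 mod m + m * n) div m ^ i mod m = a i mod m" if "i < Suc k" for i
  proof (cases i)
    case (Suc i')
    have "(a 0 mod m + m * n) div m ^ Suc i' = (a 0 mod m + m * n) div m div m ^ i'"
      by (simp add: div_mult2_eq)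
    then show ?thesis using n(2) that Suc \<open>m > 0\<close> by simp
  qed simp
  moreover have "a 0 mod m + m * n < m ^ Suc k"
  proof -
    have "a 0 mod m + m * n < m + m * n" using \<open>m > 0\<close> by simp
    also have "\<dots> = m * (n + 1)" by simp
    also have "\<dots> \<le> m * m ^ k" using n(1) by (intro mult_left_mono) auto
    finally show ?thesis by simp
  qed
  ultimately show ?case by blast
qed

lemma digits_eq: "digits = u_digit p c \<pp> \<epsilon> ` {..<q}"
proof
  show "u_digit p c \<pp> \<epsilon> ` {..<q} \<subseteq> digits"
    by (auto simp: digits_def u_digit_def)
  show "digits \<subseteq> u_digit p c \<pp> \<epsilon> ` {..<q}"
  proof
    fix x assume "x \<in> digits"
    then obtain a where a: "x = (\<Sum>k<c. of_nat (a k) * \<epsilon> k) * inverse \<pp>" by (auto simp: digits_def)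
    obtain n where n: "n < p ^ c" "\<forall>i<c. (n div p ^ i) mod p = a i mod p"
      using digit_expansion[of p c a] p_ge_2 by auto
    have "(\<Sum>k<c. of_nat (a k) * \<epsilon> k) = (\<Sum>k<c. of_nat ((n div p ^ k) mod p) * \<epsilon> k)"
      using n(2) by (intro sum.cong) (auto simp: of_nat_mod_p)
    then have "x = u_digit p c \<pp> \<epsilon> n" by (simp add: a u_digit_def)
    then show "x \<in> u_digit p c \<pp> \<epsilon> ` {..<q}" using n(1) q_eq by auto
  qed
qed

lemma digits_add: "x \<in> digits \<Longrightarrow> y \<in> digits \<Longrightarrow> x + y \<in> digits"
proof -
  assume "x \<in> digits" "y \<in> digits"
  then obtain a b where "x = (\<Sum>k<c. of_nat (a k) * \<epsilon> k) * inverse \<pp>"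
    "y = (\<Sum>k<c. of_nat (b k) * \<epsilon> k) * inverse \<pp>" by (auto simp: digits_def)
  then have "x + y = (\<Sum>k<c. of_nat (a k + b k) * \<epsilon> k) * inverse \<pp>"
    by (simp add: sum.distrib algebra_simps)
  then show ?thesis unfolding digits_def by (rule range_eqI[of _ _ "\<lambda>k. a k + b k"])
qed

lemma u_digit_0 [simp]: "u_digit p c \<pp> \<epsilon> 0 = 0"
  by (simp add: u_digit_def)

lemma absval_integral_combination: "absval (\<Sum>k<c. of_int (a k) * \<epsilon> k) \<le> 1"
proof (rule absval_sum_le)
  fix k assume "k \<in> {..<c}"
  then have "absval (\<epsilon> k) \<le> 1" using eps_unit by (auto simp: integer_ring_def)
  then show "absval (of_int (a k) * \<epsilon> k) \<le> 1"
    using mult_mono[OF absval_of_int_le_1[of "a k", where 'k='k]] by (fastforce simp: absval_mult)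
qed simp

lemma absval_u_digit_le: "absval (u_digit p c \<pp> \<epsilon> n) \<le> real q"
  using absval_integral_combination[of "\<lambda>k. int ((n div p ^ k) mod p)"]
  by (simp add: u_digit_def absval_mult norm_prime_element divide_inverse)

text \<open>Two distinct digits are incongruent modulo the maximal ideal, hence as far apart as digits can be.\<close>
lemma absval_u_digit_diff:
  assumes "m < q" "n < q" "m \<noteq> n"
  shows "absval (u_digit p c \<pp> \<epsilon> m - u_digit p c \<pp> \<epsilon> n) = real q"
proof -
  define a where "a k = int ((m div p ^ k) mod p) - int ((n div p ^ k) mod p)" for k
  define s :: 'k where "s = (\<Sum>k<c. of_int (a k) * \<epsilon> k)"
  have eq: "u_digit p c \<pp> \<epsilon> m - u_digit p c \<pp> \<epsilon> n = s * inverse \<pp>"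
    by (simp add: u_digit_def s_def a_def algebra_simps sum_subtractf)
  have digits_eqD: "m' = n'" if "m' < p ^ c'" "n' < p ^ c'"
    "\<forall>k<c'. (m' div p ^ k) mod p = (n' div p ^ k) mod p" for m' n' c'
    using that
  proof (induction c' arbitrary: m' n')
    case (Suc c')
    have "m' div p = n' div p"
    proof (rule Suc.IH)
      show "m' div p < p ^ c'" "n' div p < p ^ c'"
        using Suc.prems p_ge_2 by (auto simp: less_mult_imp_div_less mult.commute)
      show "\<forall>k<c'. m' div p div p ^ k mod p = n' div p div p ^ k mod p"
        using Suc.prems(3)[rule_format, of "Suc _"] by (auto simp: div_mult2_eq)
    qed
    moreover have "m' mod p = n' mod p" using Suc.prems(3)[rule_format, of 0] by simp
    ultimately show ?case by (metis div_mult_mod_eq)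
  qed simp
  have "s \<notin> max_ideal"
  proof
    assume "s \<in> max_ideal"
    then have dvd: "\<forall>k<c. int p dvd a k"
      using eps_basis unfolding residue_basis_def s_def by blast
    have "(m div p ^ k) mod p = (n div p ^ k) mod p" if "k < c" for k
    proof -
      have "[int ((m div p ^ k) mod p) = int ((n div p ^ k) mod p)] (mod int p)"
        using dvd that by (simp add: a_def cong_iff_dvd_diff)
      then show ?thesis by (simp add: cong_def flip: zmod_int)
    qed
    then have "m = n" using digits_eqD[of m c n] assms q_eq by auto
    then show False using assms by simp
  qed
  moreover have "absval s \<le> 1" unfolding s_def by (rule absval_integral_combination)
  ultimately have "absval s = 1" by (simp add: max_ideal_def)
  then show ?thesis unfolding eq by (simp add: absval_mult norm_prime_element)
qed

subsection \<open>The recursion of the enumeration\<close>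

lemma v_eq_sum:
  assumes "n < M"
  shows "v n = (\<Sum>k<M. u_digit p c \<pp> \<epsilon> ((n div q ^ k) mod q) * \<pp> powi (- int k))"
proof -
  have "(\<Sum>k<M. u_digit p c \<pp> \<epsilon> ((n div q ^ k) mod q) * \<pp> powi (- int k))
    = (\<Sum>k\<le>n. u_digit p c \<pp> \<epsilon> ((n div q ^ k) mod q) * \<pp> powi (- int k))"
  proof (rule sum.mono_neutral_right)
    show "\<forall>k\<in>{..<M} - {..n}. u_digit p c \<pp> \<epsilon> ((n div q ^ k) mod q) * \<pp> powi (- int k) = 0"
    proof
      fix k assume "k \<in> {..<M} - {..n}"
      then have "n < k" by auto
      also have "k < 2 ^ k" by (rule less_exp)
      also have "\<dots> \<le> q ^ k" using q_ge_2 by (rule power_mono) simp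
      finally show "u_digit p c \<pp> \<epsilon> ((n div q ^ k) mod q) * \<pp> powi (- int k) = 0" by simp
    qed
  qed (use assms in auto)
  then show ?thesis by (simp add: u_def q_eq)
qed

text \<open>The recursion from which all properties of the enumeration are derived: the last digit in base \<open>q\<close> is
  split off, and the remaining ones are moved by a division by \<open>\<pp>\<close>.\<close>
lemma v_rec: "v n = u_digit p c \<pp> \<epsilon> (n mod q) + v (n div q) / \<pp>"
proof -
  have pp: "\<pp> powi (- 1 - int k) = \<pp> powi (- int k) / \<pp>" for k
    by (simp add: power_int_diff power_int_minus field_simps)
  have "v n = (\<Sum>k<Suc (Suc n). u_digit p c \<pp> \<epsilon> ((n div q ^ k) mod q) * \<pp> powi (- int k))"
    by (rule v_eq_sum) simp
  also have "\<dots> = u_digit p c \<pp> \<epsilon> (n mod q) +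
      (\<Sum>k<Suc n. u_digit p c \<pp> \<epsilon> ((n div q div q ^ k) mod q) * \<pp> powi (- int k) / \<pp>)"
    by (subst sum.lessThan_Suc_shift) (simp add: pp div_mult2_eq)
  also have "\<dots> = u_digit p c \<pp> \<epsilon> (n mod q) + v (n div q) / \<pp>"
    using le_imp_less_Suc[OF div_le_dividend[of n q]] by (simp add: v_eq_sum[of "n div q" "Suc n"] sum_divide_distrib del: sum.lessThan_Suc)
  finally show ?thesis .
qed

lemma v_0 [simp]: "v 0 = 0"
  using v_eq_sum[of 0 1] by simp

lemma v_mult_q: "v (q * n) = v n / \<pp>"
  using v_rec[of "q * n"] q_pos by simp

lemma v_add: "b < q \<Longrightarrow> v (b + q * n) = u_digit p c \<pp> \<epsilon> b + v n / \<pp>"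
  using v_rec[of "b + q * n"] by simp

lemma v_image_power_Suc:
  "v ` {..<q ^ Suc N} = {d + x / \<pp> | d x. d \<in> digits \<and> x \<in> v ` {..<q ^ N}}"
proof (intro equalityI subsetI)
  fix y assume "y \<in> v ` {..<q ^ Suc N}"
  then obtain n where n: "n < q ^ Suc N" "y = v n" by auto
  have "n div q < q ^ N" using n(1) by (simp add: less_mult_imp_div_less mult.commute)
  moreover have "u_digit p c \<pp> \<epsilon> (n mod q) \<in> digits" by (auto simp: digits_eq)
  ultimately show "y \<in> {d + x / \<pp> | d x. d \<in> digits \<and> x \<in> v ` {..<q ^ N}}"
    using v_rec[of n] n(2) by blast
next
  fix y assume "y \<in> {d + x / \<pp> | d x. d \<in> digits \<and> x \<in> v ` {..<q ^ N}}"
  then obtain b n where bn: "b < q" "n < q ^ N" "y = u_digit p c \<pp> \<epsilon> b + v n / \<pp>"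
    by (auto simp: digits_eq)
  have "b + q * n < q * (n + 1)" using bn by simp
  also have "\<dots> \<le> q * q ^ N" using bn by (intro mult_left_mono) auto
  finally have "b + q * n < q ^ Suc N" by simp
  then show "y \<in> v ` {..<q ^ Suc N}" using v_add[OF bn(1), of n] bn(3) by (auto intro!: image_eqI)
qed

text \<open>The sum is formed digit by digit, because a sum of two digits is a digit again.\<close>
lemma v_image_power_add:
  "x \<in> v ` {..<q ^ N} \<Longrightarrow> y \<in> v ` {..<q ^ N} \<Longrightarrow> x + y \<in> v ` {..<q ^ N}"
proof (induction N arbitrary: x y)
  case 0
  then show ?case by auto
next
  case (Suc N)
  from Suc.prems obtain d x' d' y' where *: "d \<in> digits" "d' \<in> digits"
    "x' \<in> v ` {..<q ^ N}" "y' \<in> v ` {..<q ^ N}" "x = d + x' / \<pp>" "y = d' + y' / \<pp>"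
    unfolding v_image_power_Suc by blast
  then have "x + y = (d + d') + (x' + y') / \<pp>" by (simp add: add_divide_distrib)
  then show ?case unfolding v_image_power_Suc using digits_add * Suc.IH by blast
qed

lemma less_q_power: "n < q ^ n"
  using less_exp[of n] power_mono[of 2 q n] q_ge_2 by linarith

lemma lat_add [intro]: "x \<in> lat \<Longrightarrow> y \<in> lat \<Longrightarrow> x + y \<in> lat"
proof -
  assume "x \<in> lat" "y \<in> lat"
  then obtain m n where mn: "x = v m" "y = v n" by (auto simp: lat_def)
  have "q ^ m \<le> q ^ (m + n)" "q ^ n \<le> q ^ (m + n)"
    using q_ge_2 by (auto intro!: power_increasing)
  then have "x \<in> v ` {..<q ^ (m + n)}" "y \<in> v ` {..<q ^ (m + n)}"
    using mn less_q_power[of m] less_q_power[of n] by (auto intro!: imageI)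
  then show ?thesis using v_image_power_add unfolding lat_def by blast
qed

lemma lat_0 [simp]: "0 \<in> lat" unfolding lat_def using v_0 by (metis rangeI)

text \<open>In characteristic \<open>p\<close> the negative is the multiple by \<open>p - 1\<close>.\<close>
lemma lat_minus: "x \<in> lat \<Longrightarrow> - x \<in> lat"
proof -
  assume x: "x \<in> lat"
  have "of_nat n * x \<in> lat" for n by (induction n) (auto simp: algebra_simps x)
  then have "of_nat (p - 1) * x \<in> lat" .
  moreover have "of_nat (p - 1) * x + x = of_nat p * x"
    using p_ge_2 by (simp add: of_nat_diff algebra_simps)
  then have "of_nat (p - 1) * x = - x"
    using char_p of_nat_CHAR[where 'a='k] by (simp add: add_eq_0_iff2)
  ultimately show ?thesis by simp
qed

lemma lat_minus_iff [simp]: "- x \<in> lat \<longleftrightarrow> x \<in> lat"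
  using lat_minus[of x] lat_minus[of "-x"] by auto

lemma lat_diff [intro]: "x \<in> lat \<Longrightarrow> y \<in> lat \<Longrightarrow> x - y \<in> lat"
  using lat_add[of x "- y"] lat_minus[of y] by simp

lemma lat_divide_pp: "x \<in> lat \<Longrightarrow> x / \<pp> \<in> lat"
  unfolding lat_def by (auto simp flip: v_mult_q)

lemma lat_powi: "x \<in> lat \<Longrightarrow> \<pp> powi (- int j) * x \<in> lat"
proof (induction j)
  case (Suc j)
  have "- int (Suc j) = - int j - 1" by simp
  then have "\<pp> powi (- int (Suc j)) = \<pp> powi (- int j) / \<pp>"
    using power_int_diff[of \<pp> "- int j" 1] by (simp only:) simp
  then have "\<pp> powi (- int (Suc j)) * x = (\<pp> powi (- int j) * x) / \<pp>" by simp
  then show ?case using lat_divide_pp Suc by metis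
qed simp

lemma lat_powi_le: "\<pp> powi i * x \<in> lat \<Longrightarrow> j \<le> i \<Longrightarrow> \<pp> powi j * x \<in> lat"
  using lat_powi[of "\<pp> powi i * x" "nat (i - j)"]
  by (simp add: mult.assoc[symmetric] flip: power_int_add)

text \<open>The first digit dominates: a nonzero digit has absolute value \<open>q\<close>, the largest possible one, and each step of
  the recursion multiplies the contribution of the earlier digits by \<open>q\<close>.\<close>
lemma absval_v_ge: "n \<ge> q ^ N \<Longrightarrow> absval (v n) \<ge> real q ^ Suc N"
proof (induction N arbitrary: n)
  case 0
  then have "n \<ge> 1" by simp
  then show ?case
  proof (induction n rule: less_induct)
    case (less n)
    show ?case
    proof (cases "n < q")
      case True
      then show ?thesis using v_add[of n 0] absval_u_digit_diff[of n 0] less.prems by simp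
    next
      case False
      then have "n div q \<ge> 1" using q_pos(2) by (simp add: Suc_leI div_greater_zero_iff)
      moreover have "n div q < n" using less.prems q_ge_2 by simp
      ultimately have "absval (v (n div q)) \<ge> real q ^ Suc 0" using less.IH by blast
      then have "absval (v (n div q) / \<pp>) \<ge> real q * real q"
        by (simp add: norm_prime_element mult_right_mono)
      moreover have "real q * real q > real q * 1" using q_gt_1 by (intro mult_strict_left_mono) auto
      ultimately have *: "absval (v (n div q) / \<pp>) > real q" by linarith
      then have "absval (u_digit p c \<pp> \<epsilon> (n mod q)) < absval (v (n div q) / \<pp>)"
        using absval_u_digit_le[of "n mod q"] by linarith
      then have "absval (v n) = absval (v (n div q) / \<pp>)"
        by (subst v_rec) (rule absval_add_eq)
      then show ?thesis using * by simp
    qed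
  qed
next
  case (Suc N)
  have "n div q \<ge> q ^ N" using Suc.prems div_le_mono[of "q * q ^ N" n q] by simp
  then have "absval (v (n div q)) \<ge> real q ^ Suc N" by (rule Suc.IH)
  then have *: "absval (v (n div q) / \<pp>) \<ge> real q ^ Suc (Suc N)"
    by (simp add: norm_prime_element mult_right_mono mult.commute)
  have "real q ^ 1 < real q ^ Suc (Suc N)" using q_gt_1 by (intro power_strict_increasing) auto
  then have "absval (u_digit p c \<pp> \<epsilon> (n mod q)) < absval (v (n div q) / \<pp>)"
    using absval_u_digit_le[of "n mod q"] * unfolding power_one_right by linarith
  then have "absval (v n) = absval (v (n div q) / \<pp>)"
    by (subst v_rec) (rule absval_add_eq)
  then show ?case using * by simp
qed

lemma absval_v_le: "n < q ^ N \<Longrightarrow> absval (v n) \<le> real q ^ N"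
proof (induction N arbitrary: n)
  case (Suc N)
  have "n div q < q ^ N" using Suc.prems by (simp add: less_mult_imp_div_less mult.commute)
  then have "absval (v (n div q) / \<pp>) \<le> real q ^ Suc N"
    using Suc.IH[of "n div q"] by (simp add: norm_prime_element mult_right_mono mult.commute)
  moreover have "real q ^ 1 \<le> real q ^ Suc N" using q_gt_1 by (intro power_increasing) auto
  then have "absval (u_digit p c \<pp> \<epsilon> (n mod q)) \<le> real q ^ Suc N"
    using absval_u_digit_le[of "n mod q"] unfolding power_one_right by linarith
  ultimately show ?case
    using absval_ultrametric[of "u_digit p c \<pp> \<epsilon> (n mod q)" "v (n div q) / \<pp>"]
    by (subst v_rec) auto
qed simp

lemma lat_disc_eq: "lat \<inter> disc (int N) = v ` {..<q ^ N}"
proof (intro equalityI subsetI)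
  fix x assume "x \<in> lat \<inter> disc (int N)"
  then obtain n where n: "x = v n" "absval (v n) \<le> real q ^ N" by (auto simp: lat_def disc_def)
  moreover have "real q ^ N < real q ^ Suc N" using q_gt_1 by (intro power_strict_increasing) auto
  ultimately have "n < q ^ N" using absval_v_ge[of N n] by (meson linorder_not_le order_trans)
  then show "x \<in> v ` {..<q ^ N}" using n by blast
qed (auto simp: lat_def disc_def absval_v_le)

lemma lat_disc_trivial: "N \<le> 0 \<Longrightarrow> lat \<inter> disc N = {0}"
proof -
  assume "N \<le> 0"
  then have "lat \<inter> disc N \<subseteq> lat \<inter> disc (int 0)" using disc_mono[of N 0] by auto
  also have "\<dots> = {0}" unfolding lat_disc_eq by (auto simp: lessThan_Suc)
  finally show ?thesis by auto
qed

lemma lat_in_discD: "x \<in> lat \<Longrightarrow> x \<in> disc N \<Longrightarrow> N \<le> 0 \<Longrightarrow> x = 0"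
  using lat_disc_trivial by blast

text \<open>If two values agree, then \<open>\<pp>\<close> times the difference of their last digits is a lattice point in the ring of
  integers, hence 0. So the last digits agree, and the recursion reduces the claim to smaller numbers.\<close>
lemma inj_v: "inj v"
proof (rule injI)
  fix m n assume "v m = v n" then show "m = n"
  proof (induction m arbitrary: n rule: less_induct)
    case (less m)
    define d where "d = u_digit p c \<pp> \<epsilon> (m mod q) - u_digit p c \<pp> \<epsilon> (n mod q)"
    have d: "\<pp> * d = v (n div q) - v (m div q)"
      using less.prems v_rec[of m] v_rec[of n] by (simp add: d_def field_simps)
    have "absval d \<le> real q"
      using absval_u_digit_diff[of "m mod q" "n mod q"] q_pos(2)
      by (cases "m mod q = n mod q") (auto simp: d_def)
    then have "absval (\<pp> * d) \<le> 1" by (simp add: absval_mult norm_prime_element)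
    then have "\<pp> * d \<in> disc 0" by (simp add: disc_def)
    moreover have "\<pp> * d \<in> lat" unfolding d by (intro lat_diff) (auto simp: lat_def)
    ultimately have "\<pp> * d = 0" using lat_in_discD by blast
    then have "d = 0" and eq: "v (m div q) = v (n div q)" using d by auto
    then have mod: "m mod q = n mod q"
      using absval_u_digit_diff[of "m mod q" "n mod q"] q_pos(2)
      by (metis absval_zero d_def less_irrefl mod_less_divisor q_pos(1))
    show ?case
    proof (cases "m = 0")
      case True
      then show ?thesis using less.prems absval_v_ge[of 0 n]
        by (cases "n = 0") (auto simp: Suc_le_eq)
    next
      case False
      then have "m div q < m" using q_ge_2 by simp
      then have "m div q = n div q" using less.IH eq by blast
      then show ?thesis using mod by (metis div_mult_mod_eq)
    qed
  qed
qed

lemma card_lat_disc: "card (lat \<inter> disc (int N)) = q ^ N"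
  unfolding lat_disc_eq using card_image[OF inj_on_subset[OF inj_v]] by simp

lemma finite_lat_disc: "finite (lat \<inter> disc N)"
proof -
  have "lat \<inter> disc N \<subseteq> lat \<inter> disc (int (nat N))" using disc_mono[of N "int (nat N)"] by auto
  then show ?thesis unfolding lat_disc_eq by (rule finite_subset) simp
qed

lemma countable_lat: "countable lat" unfolding lat_def by simp

lemma bij_v: "bij_betw v UNIV lat"
  using inj_v by (simp add: bij_betw_def lat_def)

text \<open>Multiply by \<open>\<pp>\<close> until the element is integral. Each step back creates a fractional part in \<open>disc 1\<close>, which a
  digit removes because the \<open>\<epsilon> k\<close> span the residue field.\<close>
lemma lat_cover: "\<exists>l\<in>lat. x - l \<in> disc 0"
proof -
  have "x \<in> disc (int N) \<Longrightarrow> \<exists>l\<in>lat. x - l \<in> disc 0" for N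
  proof (induction N arbitrary: x)
    case 0
    then show ?case by (auto intro: bexI[of _ 0])
  next
    case (Suc N)
    then have "\<pp> * x \<in> disc (int N)" using pp_powi_mult_disc[of 1 x "int N"] by (simp add: add.commute)
    then obtain l where l: "l \<in> lat" "\<pp> * x - l \<in> disc 0" using Suc.IH by blast
    then obtain a where a: "\<pp> * x - l - (\<Sum>k<c. of_int (a k) * \<epsilon> k) \<in> max_ideal"
      using eps_basis integer_ring_eq unfolding residue_basis_def by blast
    have "(\<Sum>k<c. of_int (a k) * \<epsilon> k) = (\<Sum>k<c. of_nat (nat (a k mod int p)) * \<epsilon> k)"
    proof (rule sum.cong[OF refl])
      fix k
      have "of_nat (nat (a k mod int p)) = (of_int (a k mod int p) :: 'k)"
        using p_ge_2 by simp
      also have "\<dots> = of_int (a k)"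
        using char_p by (metis of_int_eq_iff_cong_CHAR cong_mod_left cong_refl)
      finally show "of_int (a k) * \<epsilon> k = of_nat (nat (a k mod int p)) * \<epsilon> k" by simp
    qed
    then have d: "(\<Sum>k<c. of_int (a k) * \<epsilon> k) * inverse \<pp> \<in> digits" by (auto simp: digits_def)
    then obtain b where b: "b < q" "(\<Sum>k<c. of_int (a k) * \<epsilon> k) * inverse \<pp> = v b"
      using v_add[of _ 0] by (auto simp: digits_eq)
    have "(\<Sum>k<c. of_int (a k) * \<epsilon> k) = \<pp> * v b" using b(2)[symmetric] by simp
    then have "\<pp> powi 1 * (x - (l / \<pp> + v b)) \<in> disc (- 1)"
      using a by (simp add: max_ideal_eq algebra_simps)
    then have "x - (l / \<pp> + v b) \<in> disc 0" unfolding pp_powi_mult_disc by simp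
    moreover have "l / \<pp> + v b \<in> lat" using lat_divide_pp[OF l(1)] lat_def by blast
    ultimately show ?case by blast
  qed
  then show ?thesis using ex_disc by blast
qed

lemma lat_unique: "l \<in> lat \<Longrightarrow> l' \<in> lat \<Longrightarrow> x - l \<in> disc 0 \<Longrightarrow> x - l' \<in> disc 0 \<Longrightarrow> l = l'"
  using lat_in_discD[of "l' - l" 0] disc_diff[of "x - l" 0 "x - l'"] by auto

lemma not_q_dvd_iff: "q dvd s \<longleftrightarrow> \<pp> * v s \<in> lat"
proof
  assume "q dvd s"
  then obtain t where "s = q * t" by auto
  then show "\<pp> * v s \<in> lat" using v_mult_q[of t] by (auto simp: lat_def)
next
  assume "\<pp> * v s \<in> lat"
  then obtain t where "\<pp> * v s = v t" by (auto simp: lat_def)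
  then have "v s = v t / \<pp>" by (simp add: field_simps)
  then have "v s = v (q * t)" using v_mult_q[of t] by simp
  then have "s = q * t" using inj_v by (auto dest: injD)
  then show "q dvd s" by simp
qed

end

section \<open>Haar measure\<close>

context local_field_setup
begin

text \<open>The balls of the metric, written as cosets of the additive groups \<open>disc N\<close>.\<close>
definition coset :: "'k \<Rightarrow> int \<Rightarrow> 'k set" where "coset a N = {x. x - a \<in> disc N}"

lemma coset_0: "coset 0 N = disc N" by (simp add: coset_def)

lemma coset_self [simp]: "a \<in> coset a N" by (simp add: coset_def)

lemma coset_eqI: "b \<in> coset a N \<Longrightarrow> coset b N = coset a N"
proof -
  assume "b \<in> coset a N"
  then have b: "b - a \<in> disc N" by (simp add: coset_def)
  have "x - b \<in> disc N \<longleftrightarrow> x - a \<in> disc N" for x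
    using disc_add_iff[OF b, of "x - b"] by simp
  then show ?thesis by (simp add: coset_def)
qed

lemma coset_mono: "M \<le> N \<Longrightarrow> coset a M \<subseteq> coset a N"
  using disc_mono by (auto simp: coset_def)

text \<open>Two balls are nested or disjoint.\<close>
lemma coset_Int: "M \<le> N \<Longrightarrow> coset a M \<inter> coset b N = (if a \<in> coset b N then coset a M else {})"
proof (cases "coset a M \<inter> coset b N = {}")
  case False
  assume MN: "M \<le> N"
  obtain x where x: "x \<in> coset a M" "x \<in> coset b N" using False by auto
  have "coset a N = coset x N" using x MN coset_mono coset_eqI by blast
  also have "\<dots> = coset b N" using x coset_eqI by blast
  finally show ?thesis using coset_mono[OF MN, of a] coset_self[of a N] by auto
next
  case True
  then have "a \<notin> coset b N" using coset_self[of a M] by blast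
  then show ?thesis using True by simp
qed

lemma coset_disjoint: "a \<notin> coset b N \<Longrightarrow> coset a N \<inter> coset b N = {}"
  using coset_Int[of N N a b] by simp

lemma coset_translate: "a + x \<in> coset b N \<longleftrightarrow> x \<in> coset (b - a) N"
  by (simp add: coset_def algebra_simps)

lemma coset_dilate: "\<pp> powi j * x \<in> coset b N \<longleftrightarrow> x \<in> coset (\<pp> powi (- j) * b) (N + j)"
proof -
  have "\<pp> powi j * x - b = \<pp> powi j * (x - \<pp> powi (- j) * b)"
    by (simp add: algebra_simps mult.assoc[symmetric] flip: power_int_add)
  then show ?thesis by (simp add: coset_def pp_powi_mult_disc)
qed

lemma open_coset: "open (coset a N)"
  unfolding open_dist
proof (intro ballI exI conjI allI impI)
  fix x y assume x: "x \<in> coset a N" and d: "dist y x < real q powi N"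
  have "y \<in> coset x N" using d by (simp add: coset_def disc_def dist_absval)
  then show "y \<in> coset a N" using coset_eqI[OF x] by simp
next
  show "0 < real q powi N" by simp
qed

text \<open>Every open set is a countable union of cosets, whose centres may be taken in the countable
  dense subgroup generated by the dilates of the lattice.\<close>
lemma sets_borel_eq: "sets borel = sigma_sets UNIV (range (\<lambda>(a, N). coset a N))"
proof (rule antisym)
  show "sigma_sets UNIV (range (\<lambda>(a, N). coset a N)) \<subseteq> sets borel"
  proof -
    have "range (\<lambda>(a, N). coset a N) \<subseteq> sets borel"
      using borel_open[OF open_coset] by (simp add: image_subset_iff case_prod_beta)
    then show ?thesis using sets.sigma_sets_subset[of _ borel] by simp
  qed
next
  have "U \<in> sigma_sets UNIV (range (\<lambda>(a, N). coset a N))" if U: "open U" for U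
  proof -
    define C where "C = (\<lambda>(j, l). coset (\<pp> powi int j * l) (- int j)) ` {(j::nat, l). l \<in> lat}"
    have "{(j::nat, l). l \<in> lat} = UNIV \<times> lat" by auto
    then have "countable {(j::nat, l). l \<in> lat}" using countable_lat by simp
    then have "countable C" unfolding C_def by (rule countable_image)
    have "x \<in> \<Union>{B \<in> C. B \<subseteq> U}" if x: "x \<in> U" for x
    proof -
      obtain e where e: "e > 0" "\<And>y. dist y x < e \<Longrightarrow> y \<in> U"
        using U x unfolding open_dist by blast
      obtain j where j: "(1 / real q) ^ j < e"
        using real_arch_pow_inv[OF e(1), of "1 / real q"] q_gt_1 by auto
      then have j': "real q powi (- int j) < e"
        by (simp add: power_int_minus power_one_over inverse_eq_divide)
      obtain l where l: "l \<in> lat" "\<pp> powi (- int j) * x - l \<in> disc 0" using lat_cover by blast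
      let ?B = "coset (\<pp> powi int j * l) (- int j)"
      have x_in: "x \<in> ?B"
        using l(2) coset_dilate[of "- int j" x l 0] by (simp add: coset_def)
      have "y \<in> U" if "y \<in> ?B" for y
      proof (rule e(2))
        have "y \<in> coset x (- int j)" using that coset_eqI[OF x_in] by simp
        then show "dist y x < e" using j' by (simp add: coset_def disc_def dist_absval)
      qed
      moreover have "?B \<in> C" using l(1) by (auto simp: C_def)
      ultimately show ?thesis using x_in by auto
    qed
    then have "U = \<Union>{B \<in> C. B \<subseteq> U}" by blast
    also have "\<dots> \<in> sigma_sets UNIV (range (\<lambda>(a, N). coset a N))"
    proof (rule sigma_sets_UNION)
      show "countable {B \<in> C. B \<subseteq> U}" using \<open>countable C\<close> by (rule countable_subset[rotated]) auto
    qed (auto simp: C_def)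
    finally show ?thesis .
  qed
  then show "sets borel \<subseteq> sigma_sets UNIV (range (\<lambda>(a, N). coset a N))"
    unfolding borel_def by (auto intro!: sigma_sets_mono)
qed

lemma Int_stable_coset: "Int_stable (insert {} (range (\<lambda>(a, N). coset a N)))"
proof -
  have "coset a M \<inter> coset b N \<in> insert {} (range (\<lambda>(a, N). coset a N))" for a b M N
  proof (cases "M \<le> N")
    case True
    then show ?thesis by (auto simp: coset_Int)
  next
    case False
    then show ?thesis using coset_Int[of N M b a] by (auto simp: Int_commute)
  qed
  then show ?thesis unfolding Int_stable_def by (auto simp: case_prod_beta)
qed

lemma sets_borel_eq': "sets borel = sigma_sets UNIV (insert {} (range (\<lambda>(a, N). coset a N)))"
  unfolding sets_borel_eq by (intro sigma_sets_eqI) (auto intro: sigma_sets.Empty)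

lemma sets_mu [measurable_cong, simp]: "sets \<mu> = sets borel"
  using haar by (simp add: haar_measure_def)

lemma space_mu [simp]: "space \<mu> = UNIV"
  using sets_eq_imp_space_eq[OF sets_mu] by simp

lemma coset_sets [measurable, simp]: "coset a N \<in> sets borel"
  using open_coset by (rule borel_open)

lemma disc_sets [measurable, simp]: "disc N \<in> sets borel"
  using coset_sets[of 0 N] by (simp add: coset_0)

lemma measurable_translate [measurable]: "(\<lambda>x. a + x) \<in> borel_measurable (borel :: 'k measure)"
  by (intro borel_measurable_continuous_onI continuous_on_add_field)

lemma measurable_dilate [measurable]: "(\<lambda>x. a * x) \<in> borel_measurable (borel :: 'k measure)"
  by (intro borel_measurable_continuous_onI continuous_on_mult_field)

lemma distr_translate: "distr \<mu> \<mu> (\<lambda>x. a + x) = \<mu>"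
proof (rule measure_eqI)
  fix A assume "A \<in> sets (distr \<mu> \<mu> (\<lambda>x. a + x))"
  then have A: "A \<in> sets \<mu>" by simp
  have "(\<lambda>x. a + x) -` A = (+) (- a) ` A"
    by (force simp: image_iff)
  moreover have "emeasure \<mu> ((+) (- a) ` A) = emeasure \<mu> A"
  proof -
    have "\<forall>a. \<forall>E\<in>sets \<mu>. emeasure \<mu> ((+) a ` E) = emeasure \<mu> E"
      using haar unfolding haar_measure_def by (elim conjE)
    from this[rule_format, OF A, of "- a"] show ?thesis .
  qed
  ultimately show "emeasure (distr \<mu> \<mu> (\<lambda>x. a + x)) A = emeasure \<mu> A"
    using A by (subst emeasure_distr) auto
qed simp

lemma emeasure_coset: "emeasure \<mu> (coset a N) = emeasure \<mu> (disc N)"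
proof -
  have "emeasure \<mu> (disc N) = emeasure (distr \<mu> \<mu> (\<lambda>x. - a + x)) (disc N)" unfolding distr_translate ..
  also have "\<dots> = emeasure \<mu> (coset a N)"
    by (subst emeasure_distr) (auto simp: coset_def vimage_def)
  finally show ?thesis ..
qed

lemma coset_partition_disjoint: "disjoint_family_on (\<lambda>l. coset (a + \<pp> powi (- N) * l) N) lat"
proof (clarsimp simp: disjoint_family_on_def)
    fix l l' assume l: "l \<in> lat" "l' \<in> lat" "l \<noteq> l'"
    have "\<pp> powi (- N) * (l - l') \<notin> disc N"
      unfolding pp_powi_mult_disc using l lat_in_discD[of "l - l'" 0] by auto
    then show "coset (a + \<pp> powi (- N) * l) N \<inter> coset (a + \<pp> powi (- N) * l') N = {}"
      by (intro coset_disjoint) (simp add: coset_def algebra_simps)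
qed

text \<open>A disc of radius \<open>q\<^sup>M\<close> is cut into discs of radius \<open>q\<^sup>N\<close> by a dilated piece of the lattice.\<close>
lemma coset_partition:
  assumes NM: "N \<le> M"
  shows "coset a M = (\<Union>l\<in>lat \<inter> disc (M - N). coset (a + \<pp> powi (- N) * l) N)"
proof (intro equalityI subsetI)
    fix x assume x: "x \<in> coset a M"
    obtain l where l: "l \<in> lat" "\<pp> powi N * (x - a) - l \<in> disc 0" using lat_cover by blast
    have "\<pp> powi N * (x - a) \<in> disc (M - N)"
      unfolding pp_powi_mult_disc using x by (simp add: coset_def)
    moreover have "\<pp> powi N * (x - a) - l \<in> disc (M - N)" using l(2) NM disc_mono[of 0 "M - N"] by auto
    ultimately have "l \<in> disc (M - N)" using disc_diff by fastforce
    moreover have "x \<in> coset (a + \<pp> powi (- N) * l) N"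
      using l(2) coset_dilate[of N "x - a" l 0] by (simp add: coset_def algebra_simps)
    ultimately show "x \<in> (\<Union>l\<in>lat \<inter> disc (M - N). coset (a + \<pp> powi (- N) * l) N)" using l(1) by blast
  next
    fix x assume "x \<in> (\<Union>l\<in>lat \<inter> disc (M - N). coset (a + \<pp> powi (- N) * l) N)"
    then obtain l where l: "l \<in> disc (M - N)" "x - (a + \<pp> powi (- N) * l) \<in> disc N"
      by (auto simp: coset_def)
    have "\<pp> powi (- N) * l \<in> disc M" using l(1) unfolding pp_powi_mult_disc by simp
    moreover have "x - (a + \<pp> powi (- N) * l) \<in> disc M" using l(2) disc_mono[OF NM] by auto
    ultimately have "(x - (a + \<pp> powi (- N) * l)) + \<pp> powi (- N) * l \<in> disc M" by (rule disc_add[rotated])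
    then show "x \<in> coset a M" by (simp add: coset_def algebra_simps)
qed

lemma emeasure_disc_ratio: "N \<le> M \<Longrightarrow> emeasure \<mu> (disc M) = of_nat (q ^ nat (M - N)) * emeasure \<mu> (disc N)"
proof -
  assume NM: "N \<le> M"
  have "emeasure \<mu> (disc M) = emeasure \<mu> (\<Union>l\<in>lat \<inter> disc (M - N). coset (0 + \<pp> powi (- N) * l) N)"
    using coset_partition[OF NM, of 0] by (simp add: coset_0)
  also have "\<dots> = (\<Sum>l\<in>lat \<inter> disc (M - N). emeasure \<mu> (coset (0 + \<pp> powi (- N) * l) N))"
    using finite_lat_disc coset_partition_disjoint[of 0 N]
    by (intro sum_emeasure[symmetric]) (auto simp: disjoint_family_on_def)
  also have "\<dots> = of_nat (q ^ nat (M - N)) * emeasure \<mu> (disc N)"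
    using card_lat_disc[of "nat (M - N)"] NM by (simp add: emeasure_coset)
  finally show ?thesis .
qed

lemma emeasure_disc: "emeasure \<mu> (disc N) = ennreal (real q powi N)"
proof -
  have one: "emeasure \<mu> (disc 0) = 1" using haar by (simp add: haar_measure_def integer_ring_eq)
  show ?thesis
  proof (cases "N \<ge> 0")
    case True
    then show ?thesis using emeasure_disc_ratio[of 0 N]
      unfolding one ennreal_of_nat_eq_real_of_nat by (simp add: power_int_def)
  next
    case False
    define m where "m = nat (- N)"
    have m: "N = - int m" using False by (simp add: m_def)
    have e: "1 = ennreal (real q ^ m) * emeasure \<mu> (disc N)"
      using emeasure_disc_ratio[of N 0] one False by (simp add: m_def ennreal_of_nat_eq_real_of_nat)
    have "ennreal (real q powi N) = ennreal (real q powi N) * (ennreal (real q ^ m) * emeasure \<mu> (disc N))"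
      using e by simp
    also have "\<dots> = ennreal (real q powi N * real q ^ m) * emeasure \<mu> (disc N)"
      by (simp add: ennreal_mult mult.assoc)
    also have "real q powi N * real q ^ m = 1" by (simp add: m power_int_minus)
    finally show ?thesis by simp
  qed
qed

lemma emeasure_coset' [simp]: "emeasure \<mu> (coset a N) = ennreal (real q powi N)"
  by (simp add: emeasure_coset emeasure_disc)

lemma measure_coset [simp]: "measure \<mu> (coset a N) = real q powi N"
  by (simp add: measure_def)

lemma UN_disc: "(\<Union>n::nat. disc (int n)) = UNIV" using ex_disc by auto

text \<open>The cosets generate the Borel sets and are closed under nonempty intersections, so a measure that is
  finite on them is determined by its values there.\<close>
lemma measure_eqI_cosets:
  assumes "sets M = sets borel" "sets N = sets borel"
    and "\<And>a r. emeasure M (coset a r) = emeasure N (coset a r)"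
    and "\<And>a r. emeasure M (coset a r) \<noteq> \<infinity>"
  shows "M = N"
proof (rule measure_eqI_generator_eq[OF Int_stable_coset])
  show "range (\<lambda>n. disc (int n)) \<subseteq> insert {} (range (\<lambda>(a, N). coset a N))"
    unfolding coset_0[symmetric] by blast
qed (use assms UN_disc coset_0[symmetric] in \<open>auto simp: sets_borel_eq'\<close>)

lemma sigma_finite_mu: "sigma_finite_measure \<mu>"
proof
  show "\<exists>A. countable A \<and> A \<subseteq> sets \<mu> \<and> \<Union>A = space \<mu> \<and> (\<forall>a\<in>A. emeasure \<mu> a \<noteq> \<infinity>)"
    using UN_disc by (intro exI[of _ "range (\<lambda>n::nat. disc (int n))"]) (auto simp: emeasure_disc)
qed

text \<open>Both measures give the coset of radius \<open>q\<^sup>r\<close> the mass \<open>q powi (r + j)\<close>.\<close>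
lemma distr_dilate: "distr \<mu> \<mu> (\<lambda>x. \<pp> powi j * x) = density \<mu> (\<lambda>_. ennreal (real q powi j))"
proof (rule measure_eqI_cosets)
  fix a r
  have "emeasure (distr \<mu> \<mu> (\<lambda>x. \<pp> powi j * x)) (coset a r)
    = emeasure \<mu> (coset (\<pp> powi (- j) * a) (r + j))"
    by (subst emeasure_distr) (auto simp: coset_dilate vimage_def)
  then have e: "emeasure (distr \<mu> \<mu> (\<lambda>x. \<pp> powi j * x)) (coset a r) = ennreal (real q powi (r + j))"
    by simp
  show "emeasure (distr \<mu> \<mu> (\<lambda>x. \<pp> powi j * x)) (coset a r)
     = emeasure (density \<mu> (\<lambda>_. ennreal (real q powi j))) (coset a r)"
    unfolding e by (subst emeasure_density_const) (auto simp: power_int_add mult.commute simp flip: ennreal_mult)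
  show "emeasure (distr \<mu> \<mu> (\<lambda>x. \<pp> powi j * x)) (coset a r) \<noteq> \<infinity>" unfolding e by simp
qed auto

subsection \<open>Change of variables\<close>

lemma measurable_comp_translate:
  "f \<in> borel_measurable \<mu> \<Longrightarrow> (\<lambda>x. f (a + x)) \<in> borel_measurable \<mu>"
  using measurable_compose[of "\<lambda>x. a + x" \<mu> \<mu> f] by simp

lemma measurable_comp_dilate:
  "f \<in> borel_measurable \<mu> \<Longrightarrow> (\<lambda>x. f (\<pp> powi j * x)) \<in> borel_measurable \<mu>"
  using measurable_compose[of "\<lambda>x. \<pp> powi j * x" \<mu> \<mu> f] by simp

lemma integral_translate:
  fixes f :: "'k \<Rightarrow> 'b::{banach, second_countable_topology}"
  assumes [measurable]: "f \<in> borel_measurable \<mu>"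
  shows "(\<integral>x. f (a + x) \<partial>\<mu>) = (\<integral>x. f x \<partial>\<mu>)"
  using integral_distr[of "\<lambda>x. a + x" \<mu> \<mu> f] by (simp add: distr_translate)

lemma integrable_translate:
  fixes f :: "'k \<Rightarrow> 'b::{banach, second_countable_topology}"
  shows "integrable \<mu> f \<Longrightarrow> integrable \<mu> (\<lambda>x. f (a + x))"
  using integrable_distr[of "\<lambda>x. a + x" \<mu> \<mu> f] by (simp add: distr_translate)

lemma integral_dilate:
  fixes f :: "'k \<Rightarrow> 'b::{banach, second_countable_topology}"
  assumes [measurable]: "f \<in> borel_measurable \<mu>"
  shows "(\<integral>x. f (\<pp> powi j * x) \<partial>\<mu>) = real q powi j *\<^sub>R (\<integral>x. f x \<partial>\<mu>)"
proof -
  have "(\<integral>x. f (\<pp> powi j * x) \<partial>\<mu>) = (\<integral>x. f x \<partial>distr \<mu> \<mu> (\<lambda>x. \<pp> powi j * x))"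
    by (subst integral_distr) auto
  also have "\<dots> = real q powi j *\<^sub>R (\<integral>x. f x \<partial>\<mu>)"
    unfolding distr_dilate by (subst integral_density) auto
  finally show ?thesis .
qed

lemma integrable_dilate:
  fixes f :: "'k \<Rightarrow> 'b::{banach, second_countable_topology}"
  assumes "integrable \<mu> f"
  shows "integrable \<mu> (\<lambda>x. f (\<pp> powi j * x))"
proof -
  have [measurable]: "f \<in> borel_measurable \<mu>" using assms by simp
  have "integrable (distr \<mu> \<mu> (\<lambda>x. \<pp> powi j * x)) f"
    unfolding distr_dilate using assms by (subst integrable_density) auto
  then show ?thesis by (rule integrable_distr[rotated]) auto
qed

lemma AE_translate: "AE x in \<mu>. P x \<Longrightarrow> AE x in \<mu>. P (a + x)"
proof -
  assume "AE x in \<mu>. P x"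
  then have "AE x in distr \<mu> \<mu> (\<lambda>x. a + x). P x" unfolding distr_translate .
  then show ?thesis by (rule AE_distrD[rotated]) simp
qed

lemma AE_dilate: "AE x in \<mu>. P x \<Longrightarrow> AE x in \<mu>. P (\<pp> powi j * x)"
proof -
  assume "AE x in \<mu>. P x"
  then have "AE x in distr \<mu> \<mu> (\<lambda>x. \<pp> powi j * x). P x"
    unfolding distr_dilate by (subst AE_density) (auto elim: eventually_mono)
  then show ?thesis by (rule AE_distrD[rotated]) simp
qed

lemma AE_nonzero: "AE x in \<mu>. x \<noteq> 0"
proof (rule AE_I[of _ _ "{0}"])
  have "emeasure \<mu> {0} \<le> ennreal ((1 / real q) ^ n)" for n
  proof -
    have "emeasure \<mu> {0} \<le> emeasure \<mu> (disc (- int n))" by (intro emeasure_mono) auto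
    then show ?thesis by (simp add: emeasure_disc power_int_minus power_one_over inverse_eq_divide)
  qed
  moreover have "(\<lambda>n. ennreal ((1 / real q) ^ n)) \<longlonglongrightarrow> ennreal 0"
    using q_gt_1 by (intro tendsto_ennrealI LIMSEQ_power_zero) auto
  ultimately have "emeasure \<mu> {0} \<le> ennreal 0"
    by (intro tendsto_lowerbound[of "\<lambda>n. ennreal ((1 / real q) ^ n)" _ sequentially]) auto
  then show "emeasure \<mu> {0} = 0" by simp
qed auto

subsection \<open>Functions are determined by their integrals over cosets\<close>

text \<open>The sets over which the integral vanishes form a Dynkin system that contains all cosets.\<close>
lemma AE_zero_of_coset_integrals:
  fixes h :: "'k \<Rightarrow> complex"
  assumes h: "integrable \<mu> h" and zero: "\<And>a N. (LINT x:coset a N|\<mu>. h x) = 0"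
  shows "AE x in \<mu>. h x = 0"
proof (rule sigma_finite_measure.density_zero[OF sigma_finite_mu h])
  have int: "set_integrable \<mu> A h" if "A \<in> sets borel" for A
    using integrable_mult_indicator[of A \<mu> h] h that by (simp add: set_integrable_def)
  have total: "(LINT x:UNIV|\<mu>. h x) = 0"
  proof -
    have inc: "incseq (\<lambda>n. disc (int n))" by (auto simp: incseq_def intro!: disc_mono)
    have "(\<lambda>n. LINT x:disc (int n)|\<mu>. h x) \<longlonglongrightarrow> (LINT x:(\<Union>n. disc (int n))|\<mu>. h x)"
      using inc int by (intro set_integral_cont_up) (auto simp: UN_disc)
    moreover have "(LINT x:disc (int n)|\<mu>. h x) = 0" for n using zero[of 0 "int n"] by (simp add: coset_0)
    ultimately show ?thesis by (simp add: UN_disc LIMSEQ_const_iff)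
  qed
  fix A assume "A \<in> sets \<mu>"
  then have A: "A \<in> sigma_sets UNIV (insert {} (range (\<lambda>(a, N). coset a N)))"
    by (simp flip: sets_borel_eq')
  have sub: "insert {} (range (\<lambda>(a, N). coset a N)) \<subseteq> Pow UNIV" by simp
  from Int_stable_coset sub A show "(LINT x:A|\<mu>. h x) = 0"
  proof (induction rule: sigma_sets_induct_disjoint)
    case (basic A)
    then show ?case using zero by (auto simp: set_lebesgue_integral_def)
  next
    case empty
    show ?case by (simp add: set_lebesgue_integral_def)
  next
    case (compl A)
    then have [measurable]: "A \<in> sets borel" by (simp add: sets_borel_eq')
    have "(LINT x:UNIV|\<mu>. h x) = (LINT x:A|\<mu>. h x) + (LINT x:UNIV - A|\<mu>. h x)"
      using set_integral_Un[of A "UNIV - A" \<mu> h] int by auto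
    then show ?case using total compl by simp
  next
    case (union A)
    then have A: "\<And>i. A i \<in> sets \<mu>" by (auto simp: sets_borel_eq')
    have "(LINT x:(\<Union>i. A i)|\<mu>. h x) = (\<Sum>i. LINT x:A i|\<mu>. h x)"
      using union A int by (intro lebesgue_integral_countable_add) (auto simp: disjoint_family_on_def)
    then show ?case using union by simp
  qed
qed

text \<open>As cosets are nested or disjoint, cutting a function off to one of them preserves the vanishing of its integrals.\<close>
lemma AE_zero_on_coset:
  fixes h :: "'k \<Rightarrow> complex"
  assumes h: "set_integrable \<mu> (coset a N) h"
    and zero: "\<And>b M. coset b M \<subseteq> coset a N \<Longrightarrow> (LINT x:coset b M|\<mu>. h x) = 0"
  shows "AE x in \<mu>. x \<in> coset a N \<longrightarrow> h x = 0"
proof -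
  have "AE x in \<mu>. indicator (coset a N) x *\<^sub>R h x = 0"
  proof (rule AE_zero_of_coset_integrals)
    show "integrable \<mu> (\<lambda>x. indicator (coset a N) x *\<^sub>R h x)" using h by (simp add: set_integrable_def)
    fix b M
    have "(LINT x:coset b M|\<mu>. indicator (coset a N) x *\<^sub>R h x) = (LINT x:coset b M \<inter> coset a N|\<mu>. h x)"
      unfolding set_lebesgue_integral_def by (intro Bochner_Integration.integral_cong) (auto simp: indicator_def)
    also have "\<dots> = 0"
    proof (cases "M \<le> N")
      case True
      then show ?thesis using zero[of b M] coset_Int[of M N b a]
        by (auto simp: set_lebesgue_integral_def split: if_splits)
    next
      case False
      then show ?thesis using zero[of a N] coset_Int[of N M a b]
        by (auto simp: set_lebesgue_integral_def Int_commute split: if_splits)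
    qed
    finally show "(LINT x:coset b M|\<mu>. indicator (coset a N) x *\<^sub>R h x) = 0" .
  qed
  then show ?thesis by eventually_elim (auto simp: indicator_def split: if_splits)
qed

lemma AE_lat_cosets:
  assumes "\<And>l. l \<in> lat \<Longrightarrow> AE x in \<mu>. x \<in> coset l 0 \<longrightarrow> P x"
  shows "AE x in \<mu>. P x"
proof -
  have "AE x in \<mu>. \<forall>l\<in>lat. x \<in> coset l 0 \<longrightarrow> P x"
    unfolding AE_ball_countable[OF countable_lat] using assms by simp
  then show ?thesis
  proof (rule eventually_mono)
    fix x assume *: "\<forall>l\<in>lat. x \<in> coset l 0 \<longrightarrow> P x"
    obtain l where "l \<in> lat" "x \<in> coset l 0" using lat_cover[of x] by (auto simp: coset_def)
    then show "P x" using *[rule_format, of l] by simp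
  qed
qed

end

section \<open>Square-integrable functions\<close>

lemma borel_measurable_cnj [measurable, simp]:
  "f \<in> borel_measurable M \<Longrightarrow> (\<lambda>x. cnj (f x)) \<in> borel_measurable M"
  using measurable_compose[of f M borel cnj borel]
  by (simp add: borel_measurable_continuous_onI continuous_on_cnj)

lemma L2_measurable [measurable_dest]: "f \<in> L2 M \<Longrightarrow> f \<in> borel_measurable M"
  by (simp add: L2_def)

lemma L2_integrable_square: "f \<in> L2 M \<Longrightarrow> integrable M (\<lambda>x. (cmod (f x))\<^sup>2)"
  by (simp add: L2_def)

lemma L2_I: "f \<in> borel_measurable M \<Longrightarrow> integrable M (\<lambda>x. (cmod (f x))\<^sup>2) \<Longrightarrow> f \<in> L2 M"
  by (simp add: L2_def)

lemma L2_zero [simp]: "(\<lambda>x. 0) \<in> L2 M" by (simp add: L2_def)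

lemma L2_cnj: "f \<in> L2 M \<Longrightarrow> (\<lambda>x. cnj (f x)) \<in> L2 M"
  unfolding L2_def by auto

declare L2_measurable [simp] L2_integrable_square [simp]

lemma L2_dominated:
  assumes "integrable M g" "f \<in> borel_measurable M" "AE x in M. (cmod (f x))\<^sup>2 \<le> g x"
  shows "f \<in> L2 M"
proof (rule L2_I[OF assms(2)])
  show "integrable M (\<lambda>x. (cmod (f x))\<^sup>2)"
    using assms by (intro Bochner_Integration.integrable_bound[OF assms(1)]) (auto elim: eventually_mono)
qed

lemma cmod_add_square_le: "(cmod (a + b))\<^sup>2 \<le> 2 * (cmod a)\<^sup>2 + 2 * (cmod b)\<^sup>2"
proof -
  have "(cmod (a + b))\<^sup>2 \<le> (cmod a + cmod b)\<^sup>2" by (intro power_mono norm_triangle_ineq) simp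
  also have "\<dots> \<le> 2 * (cmod a)\<^sup>2 + 2 * (cmod b)\<^sup>2"
    using sum_squares_bound[of "cmod a" "cmod b"] by (simp add: power2_sum)
  finally show ?thesis .
qed

lemma cmod_mult_le: "cmod a * cmod b \<le> (cmod a)\<^sup>2 + (cmod b)\<^sup>2"
  using sum_squares_bound[of "cmod a" "cmod b"] mult_nonneg_nonneg[of "cmod a" "cmod b"] norm_ge_zero[of a] norm_ge_zero[of b] by linarith

lemma L2_add: "f \<in> L2 M \<Longrightarrow> g \<in> L2 M \<Longrightarrow> (\<lambda>x. f x + g x) \<in> L2 M"
  by (rule L2_dominated[of M "\<lambda>x. 2 * (cmod (f x))\<^sup>2 + 2 * (cmod (g x))\<^sup>2"])
    (auto intro: cmod_add_square_le)

lemma L2_bounded_mult: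
  assumes "f \<in> L2 M" "h \<in> borel_measurable M" "\<And>x. cmod (h x) \<le> B"
  shows "(\<lambda>x. h x * f x) \<in> L2 M"
proof (rule L2_dominated[of M "\<lambda>x. B\<^sup>2 * (cmod (f x))\<^sup>2"])
  have "(cmod (h x * f x))\<^sup>2 \<le> B\<^sup>2 * (cmod (f x))\<^sup>2" for x
    using power_mono[OF assms(3)[of x], of 2] by (simp add: norm_mult power_mult_distrib mult_right_mono)
  then show "AE x in M. (cmod (h x * f x))\<^sup>2 \<le> B\<^sup>2 * (cmod (f x))\<^sup>2" by simp
qed (use assms in auto)

lemma L2_cmult: "f \<in> L2 M \<Longrightarrow> (\<lambda>x. c * f x) \<in> L2 M"
  by (rule L2_bounded_mult[of f M "\<lambda>_. c" "cmod c"]) auto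

lemma L2_diff: "f \<in> L2 M \<Longrightarrow> g \<in> L2 M \<Longrightarrow> (\<lambda>x. f x - g x) \<in> L2 M"
  using L2_add[of f M "\<lambda>x. (-1) * g x"] L2_cmult[of g M "-1"] by simp

lemma L2_sum: "(\<And>i. i \<in> A \<Longrightarrow> f i \<in> L2 M) \<Longrightarrow> (\<lambda>x. \<Sum>i\<in>A. f i x) \<in> L2 M"
  by (induction A rule: infinite_finite_induct) (auto intro: L2_add)

lemma L2_cong_AE:
  assumes "f \<in> L2 M" "g \<in> borel_measurable M" "AE x in M. f x = g x"
  shows "g \<in> L2 M"
  using assms by (intro L2_dominated[of M "\<lambda>x. (cmod (f x))\<^sup>2" g]) (auto elim: eventually_mono)

lemma L2_integrable_mult:
  assumes "f \<in> L2 M" "g \<in> L2 M"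
  shows "integrable M (\<lambda>x. f x * g x)"
proof (rule Bochner_Integration.integrable_bound[of M "\<lambda>x. (cmod (f x))\<^sup>2 + (cmod (g x))\<^sup>2"])
  show "AE x in M. cmod (f x * g x) \<le> norm ((cmod (f x))\<^sup>2 + (cmod (g x))\<^sup>2)"
    using cmod_mult_le by (auto simp: norm_mult)
qed (use assms in auto)

lemma L2_integrable_mult_cnj: "f \<in> L2 M \<Longrightarrow> g \<in> L2 M \<Longrightarrow> integrable M (\<lambda>x. f x * cnj (g x))"
  by (intro L2_integrable_mult L2_cnj)

lemma L2_norm_nonneg [simp]: "L2_norm M f \<ge> 0"
  by (simp add: L2_norm_def)

lemma L2_norm_square: "(L2_norm M f)\<^sup>2 = (\<integral>x. (cmod (f x))\<^sup>2 \<partial>M)"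
  by (simp add: L2_norm_def)

lemma L2_inner_self: "L2_inner M f f = of_real ((L2_norm M f)\<^sup>2)"
  by (simp add: L2_inner_def L2_norm_square complex_norm_square[symmetric] del: of_real_power)

lemma L2_inner_commute: "L2_inner M g f = cnj (L2_inner M f g)"
proof -
  have "cnj (L2_inner M f g) = (\<integral>x. cnj (f x * cnj (g x)) \<partial>M)"
    unfolding L2_inner_def by (rule Bochner_Integration.integral_cnj[symmetric])
  also have "\<dots> = L2_inner M g f"
    unfolding L2_inner_def by (intro Bochner_Integration.integral_cong) (auto simp: mult.commute)
  finally show ?thesis ..
qed

lemma L2_inner_add_left:
  "f \<in> L2 M \<Longrightarrow> f' \<in> L2 M \<Longrightarrow> g \<in> L2 M \<Longrightarrow>
    L2_inner M (\<lambda>x. f x + f' x) g = L2_inner M f g + L2_inner M f' g"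
  by (simp add: L2_inner_def distrib_right L2_integrable_mult_cnj)

lemma L2_inner_diff_left:
  "f \<in> L2 M \<Longrightarrow> f' \<in> L2 M \<Longrightarrow> g \<in> L2 M \<Longrightarrow>
    L2_inner M (\<lambda>x. f x - f' x) g = L2_inner M f g - L2_inner M f' g"
  by (simp add: L2_inner_def left_diff_distrib L2_integrable_mult_cnj)

lemma L2_inner_cmult_left: "L2_inner M (\<lambda>x. c * f x) g = c * L2_inner M f g"
  by (simp add: L2_inner_def mult.assoc)

lemma L2_inner_cmult_right: "L2_inner M f (\<lambda>x. c * g x) = cnj c * L2_inner M f g"
  by (subst L2_inner_commute) (simp add: L2_inner_cmult_left L2_inner_commute[of M g f])

lemma L2_inner_add_right:
  "f \<in> L2 M \<Longrightarrow> g \<in> L2 M \<Longrightarrow> g' \<in> L2 M \<Longrightarrow>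
    L2_inner M f (\<lambda>x. g x + g' x) = L2_inner M f g + L2_inner M f g'"
  by (simp add: L2_inner_def distrib_left L2_integrable_mult_cnj)

lemma L2_inner_sum_left:
  "(\<And>i. i \<in> A \<Longrightarrow> f i \<in> L2 M) \<Longrightarrow> g \<in> L2 M \<Longrightarrow>
    L2_inner M (\<lambda>x. \<Sum>i\<in>A. f i x) g = (\<Sum>i\<in>A. L2_inner M (f i) g)"
  by (simp add: L2_inner_def sum_distrib_right L2_integrable_mult_cnj)

lemma L2_inner_sum_right:
  "(\<And>i. i \<in> A \<Longrightarrow> g i \<in> L2 M) \<Longrightarrow> f \<in> L2 M \<Longrightarrow>
    L2_inner M f (\<lambda>x. \<Sum>i\<in>A. g i x) = (\<Sum>i\<in>A. L2_inner M f (g i))"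
  by (simp add: L2_inner_def sum_distrib_left L2_integrable_mult_cnj)

lemma L2_inner_cong_AE:
  assumes "f \<in> borel_measurable M" "f' \<in> borel_measurable M" "g \<in> borel_measurable M" "g' \<in> borel_measurable M"
    and "AE x in M. f x = f' x" "AE x in M. g x = g' x"
  shows "L2_inner M f g = L2_inner M f' g'"
  unfolding L2_inner_def using assms(5,6)
  by (intro integral_cong_AE) (use assms(1-4) in \<open>auto elim: eventually_elim2\<close>)

lemma L2_norm_cong_AE:
  assumes "f \<in> borel_measurable M" "f' \<in> borel_measurable M" "AE x in M. f x = f' x"
  shows "L2_norm M f = L2_norm M f'"
  unfolding L2_norm_def using assms
  by (intro arg_cong[where f = sqrt] integral_cong_AE) (auto elim: eventually_mono)

lemma L2_norm_eq_0_iff: "f \<in> L2 M \<Longrightarrow> L2_norm M f = 0 \<longleftrightarrow> (AE x in M. f x = 0)"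
  unfolding L2_norm_def real_sqrt_eq_0_iff by (subst integral_nonneg_eq_0_iff_AE) auto

lemma L2_norm_zero [simp]: "L2_norm M (\<lambda>x. 0) = 0" by (simp add: L2_norm_def)

lemma L2_norm_minus_commute: "L2_norm M (\<lambda>x. f x - g x) = L2_norm M (\<lambda>x. g x - f x)"
  unfolding L2_norm_def by (simp add: norm_minus_commute)

lemma L2_norm_add_square:
  assumes "f \<in> L2 M" "g \<in> L2 M"
  shows "(L2_norm M (\<lambda>x. f x + g x))\<^sup>2 = (L2_norm M f)\<^sup>2 + 2 * Re (L2_inner M f g) + (L2_norm M g)\<^sup>2"
proof -
  have "complex_of_real ((L2_norm M (\<lambda>x. f x + g x))\<^sup>2)
    = L2_inner M f f + (L2_inner M f g + L2_inner M g f) + L2_inner M g g"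
    unfolding L2_inner_self[symmetric]
    using assms by (simp add: L2_inner_add_left L2_inner_add_right L2_add)
  also have "\<dots> = complex_of_real ((L2_norm M f)\<^sup>2 + 2 * Re (L2_inner M f g) + (L2_norm M g)\<^sup>2)"
    by (simp add: L2_inner_self L2_inner_commute[of M g f] complex_add_cnj)
  finally show ?thesis by (simp only: of_real_eq_iff)
qed

lemma L2_norm_cmult: "L2_norm M (\<lambda>x. c * f x) = cmod c * L2_norm M f"
  unfolding L2_norm_def by (simp add: norm_mult power_mult_distrib real_sqrt_mult)

lemma L2_norm_diff_square:
  assumes "f \<in> L2 M" "g \<in> L2 M"
  shows "(L2_norm M (\<lambda>x. f x - g x))\<^sup>2 = (L2_norm M f)\<^sup>2 - 2 * Re (L2_inner M f g) + (L2_norm M g)\<^sup>2"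
  using L2_norm_add_square[OF assms(1) L2_cmult[OF assms(2), of "-1"]] L2_norm_cmult[of M "-1" g]
    L2_inner_cmult_right[of M f "-1" g] by simp

lemma L2_Cauchy_Schwarz:
  assumes "f \<in> L2 M" "g \<in> L2 M"
  shows "cmod (L2_inner M f g) \<le> L2_norm M f * L2_norm M g"
proof (cases "L2_norm M g = 0")
  case True
  then have "AE x in M. g x = 0" using assms by (simp add: L2_norm_eq_0_iff)
  then have "L2_inner M f g = L2_inner M f (\<lambda>x. 0)"
    using assms by (intro L2_inner_cong_AE) auto
  then show ?thesis by (simp add: L2_inner_def)
next
  case False
  define a where "a = L2_inner M f g"
  define N where "N = (L2_norm M g)\<^sup>2"
  have N: "N > 0" using False by (simp add: N_def)
  define t where "t = a / N"
  have "0 \<le> (L2_norm M (\<lambda>x. f x - t * g x))\<^sup>2" by simp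
  also have "\<dots> = (L2_norm M f)\<^sup>2 - 2 * Re (cnj t * a) + (cmod t)\<^sup>2 * N"
    using assms by (subst L2_norm_diff_square)
      (auto simp: L2_cmult L2_inner_cmult_right L2_norm_cmult a_def N_def power_mult_distrib)
  also have "cnj t * a = of_real ((cmod a)\<^sup>2 / N)"
    using complex_norm_square[of a] by (simp add: t_def mult.commute)
  also have "(cmod t)\<^sup>2 * N = (cmod a)\<^sup>2 / N"
    using N by (simp add: t_def norm_divide power_divide power2_eq_square)
  finally have "(cmod a)\<^sup>2 \<le> (L2_norm M f)\<^sup>2 * N" using N by (simp add: field_simps)
  then have "(cmod a)\<^sup>2 \<le> (L2_norm M f * L2_norm M g)\<^sup>2" by (simp add: N_def power_mult_distrib)
  then show ?thesis unfolding a_def by (rule power2_le_imp_le) simp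
qed

lemma L2_norm_triangle:
  assumes "f \<in> L2 M" "g \<in> L2 M"
  shows "L2_norm M (\<lambda>x. f x + g x) \<le> L2_norm M f + L2_norm M g"
proof (rule power2_le_imp_le)
  have "Re (L2_inner M f g) \<le> L2_norm M f * L2_norm M g"
    using complex_Re_le_cmod L2_Cauchy_Schwarz[OF assms] by (rule order_trans)
  then show "(L2_norm M (\<lambda>x. f x + g x))\<^sup>2 \<le> (L2_norm M f + L2_norm M g)\<^sup>2"
    unfolding L2_norm_add_square[OF assms] by (simp add: power2_sum)
qed simp

lemma L2_norm_triangle_diff:
  assumes "f \<in> L2 M" "g \<in> L2 M" "h \<in> L2 M"
  shows "L2_norm M (\<lambda>x. f x - h x) \<le> L2_norm M (\<lambda>x. f x - g x) + L2_norm M (\<lambda>x. g x - h x)"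
  using L2_norm_triangle[OF L2_diff[OF assms(1,2)] L2_diff[OF assms(2,3)]] by simp

lemma L2_norm_diff_le:
  assumes "f \<in> L2 M" "g \<in> L2 M"
  shows "\<bar>L2_norm M f - L2_norm M g\<bar> \<le> L2_norm M (\<lambda>x. f x - g x)"
  using L2_norm_triangle_diff[OF assms L2_zero] L2_norm_triangle_diff[OF assms(2,1) L2_zero]
  by (simp add: L2_norm_minus_commute[of M g f])

lemma L2_norm_tendsto:
  assumes "\<And>n. F n \<in> L2 M" "f \<in> L2 M" "(\<lambda>n. L2_norm M (\<lambda>x. F n x - f x)) \<longlonglongrightarrow> 0"
  shows "(\<lambda>n. L2_norm M (F n)) \<longlonglongrightarrow> L2_norm M f"
proof (rule LIM_zero_cancel, rule Lim_null_comparison[OF _ assms(3)], rule always_eventually, rule allI)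
  show "norm (L2_norm M (F n) - L2_norm M f) \<le> L2_norm M (\<lambda>x. F n x - f x)" for n
    using L2_norm_diff_le[OF assms(1,2)] by simp
qed

lemma L2_inner_tendsto:
  assumes "\<And>n. F n \<in> L2 M" "f \<in> L2 M" "g \<in> L2 M" "(\<lambda>n. L2_norm M (\<lambda>x. F n x - f x)) \<longlonglongrightarrow> 0"
  shows "(\<lambda>n. L2_inner M (F n) g) \<longlonglongrightarrow> L2_inner M f g"
proof (rule LIM_zero_cancel)
  have le: "cmod (L2_inner M (F n) g - L2_inner M f g) \<le> L2_norm M (\<lambda>x. F n x - f x) * L2_norm M g" for n
    using L2_Cauchy_Schwarz[OF L2_diff[OF assms(1,2)] assms(3)] assms by (simp add: L2_inner_diff_left)
  have lim: "(\<lambda>n. L2_norm M (\<lambda>x. F n x - f x) * L2_norm M g) \<longlonglongrightarrow> 0"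
    by (rule tendsto_mult_left_zero[OF assms(4)])
  show "(\<lambda>n. L2_inner M (F n) g - L2_inner M f g) \<longlonglongrightarrow> 0"
    by (rule Lim_null_comparison[OF always_eventually[OF allI[OF le]] lim])
qed

lemma L2_limit_unique:
  assumes "\<And>n. F n \<in> L2 M" "f \<in> L2 M" "g \<in> L2 M"
    and "(\<lambda>n. L2_norm M (\<lambda>x. F n x - f x)) \<longlonglongrightarrow> 0" "(\<lambda>n. L2_norm M (\<lambda>x. F n x - g x)) \<longlonglongrightarrow> 0"
  shows "AE x in M. f x = g x"
proof -
  have "L2_norm M (\<lambda>x. f x - g x) \<le> L2_norm M (\<lambda>x. F n x - f x) + L2_norm M (\<lambda>x. F n x - g x)" for n
    using L2_norm_triangle_diff[OF assms(2) assms(1) assms(3)] by (simp add: L2_norm_minus_commute[of M f])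
  moreover have "(\<lambda>n. L2_norm M (\<lambda>x. F n x - f x) + L2_norm M (\<lambda>x. F n x - g x)) \<longlonglongrightarrow> 0 + 0"
    using assms by (intro tendsto_intros)
  ultimately have "L2_norm M (\<lambda>x. f x - g x) \<le> 0"
    by (intro tendsto_lowerbound[of "\<lambda>n. L2_norm M (\<lambda>x. F n x - f x) + L2_norm M (\<lambda>x. F n x - g x)" _ sequentially])
      auto
  then have "L2_norm M (\<lambda>x. f x - g x) = 0" by (simp add: antisym)
  then show ?thesis using assms L2_diff[OF assms(2,3)] by (simp add: L2_norm_eq_0_iff)
qed

subsection \<open>Completeness\<close>

lemma nn_integral_cmod_square:
  "f \<in> L2 M \<Longrightarrow> (\<integral>\<^sup>+x. ennreal ((cmod (f x))\<^sup>2) \<partial>M) = ennreal ((L2_norm M f)\<^sup>2)"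
  unfolding L2_norm_square by (subst nn_integral_eq_integral) auto

text \<open>A sequence whose consecutive differences satisfy \<open>\<parallel>d\<^sub>k\<parallel>\<^sup>2 \<le> 8\<^sup>-\<^sup>k\<close> converges almost
  everywhere: the function \<open>\<Sum> 4\<^sup>k |d\<^sub>k|\<^sup>2\<close> is integrable, hence finite, so \<open>|d\<^sub>k|\<close> is
  dominated by a multiple of \<open>2\<^sup>-\<^sup>k\<close>.\<close>
lemma half_power_square: "((1/2::real) ^ k)\<^sup>2 = (1/4) ^ k"
  by (simp only: power2_eq_square power_mult_distrib[symmetric]) simp

lemma L2_fast_Cauchy_converges_AE:
  assumes G: "\<And>k. G k \<in> L2 M" and fast: "\<And>k. (L2_norm M (\<lambda>x. G (Suc k) x - G k x))\<^sup>2 \<le> (1/8) ^ k"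
  shows "AE x in M. convergent (\<lambda>k. G k x)"
proof -
  define d where "d k x = (cmod (G (Suc k) x - G k x))\<^sup>2" for k x
  have [measurable]: "G k \<in> borel_measurable M" for k using G by simp
  have D: "(\<lambda>x. G (Suc k) x - G k x) \<in> L2 M" for k using G by (intro L2_diff)
  have "(\<integral>\<^sup>+x. (\<Sum>k. ennreal (4 ^ k * d k x)) \<partial>M) = (\<Sum>k. \<integral>\<^sup>+x. ennreal (4 ^ k * d k x) \<partial>M)"
    by (intro nn_integral_suminf) (auto simp: d_def)
  also have "\<dots> \<le> (\<Sum>k. ennreal ((1/2) ^ k))"
  proof (intro suminf_le allI)
    fix k
    have "(\<integral>\<^sup>+x. ennreal (4 ^ k * d k x) \<partial>M) = ennreal (4 ^ k) * (\<integral>\<^sup>+x. ennreal (d k x) \<partial>M)"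
      by (simp add: ennreal_mult d_def nn_integral_cmult)
    also have "\<dots> = ennreal (4 ^ k * (L2_norm M (\<lambda>x. G (Suc k) x - G k x))\<^sup>2)"
      using nn_integral_cmod_square[OF D] by (simp add: d_def ennreal_mult)
    also have "4 ^ k * (L2_norm M (\<lambda>x. G (Suc k) x - G k x))\<^sup>2 \<le> 4 ^ k * (1/8) ^ k"
      using fast by (intro mult_left_mono) auto
    also have "(4::real) ^ k * (1/8) ^ k = (4 * (1/8)) ^ k" by (simp only: power_mult_distrib)
    also have "(4 * (1/8) :: real) = 1/2" by simp
    finally show "(\<integral>\<^sup>+x. ennreal (4 ^ k * d k x) \<partial>M) \<le> ennreal ((1/2) ^ k)"
      by this (rule ennreal_leI)
  qed auto
  also have "\<dots> = ennreal (\<Sum>k. (1/2) ^ k)" by (intro suminf_ennreal2) (auto simp: summable_geometric)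
  also have "\<dots> < \<infinity>" by simp
  finally have "(\<integral>\<^sup>+x. (\<Sum>k. ennreal (4 ^ k * d k x)) \<partial>M) \<noteq> \<infinity>" by simp
  then have "AE x in M. (\<Sum>k. ennreal (4 ^ k * d k x)) \<noteq> \<infinity>"
    by (intro nn_integral_noteq_infinite) (auto simp: d_def)
  then show ?thesis
  proof (rule eventually_mono)
    fix x assume fin: "(\<Sum>k. ennreal (4 ^ k * d k x)) \<noteq> \<infinity>"
    define S where "S = enn2real (\<Sum>k. ennreal (4 ^ k * d k x))"
    have S: "4 ^ k * d k x \<le> S" for k
    proof -
      have "ennreal (4 ^ k * d k x) \<le> (\<Sum>k. ennreal (4 ^ k * d k x))"
        using sum_le_suminf[of "\<lambda>k. ennreal (4 ^ k * d k x)" "{k}"] by simp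
      also have "\<dots> = ennreal S" using fin by (simp add: S_def less_top)
      finally show ?thesis by (simp add: S_def)
    qed
    have bound: "norm (G (Suc k) x - G k x) \<le> sqrt S * (1/2) ^ k" for k
    proof (rule power2_le_imp_le)
      have "S \<ge> 0" by (simp add: S_def)
      have "(sqrt S * (1/2) ^ k)\<^sup>2 = S * (1/4) ^ k"
        using \<open>S \<ge> 0\<close> by (simp only: power_mult_distrib real_sqrt_pow2 half_power_square)
      moreover have "d k x \<le> S * (1/4) ^ k"
        using S[of k] by (simp add: power_one_over pos_le_divide_eq mult.commute)
      ultimately show "(norm (G (Suc k) x - G k x))\<^sup>2 \<le> (sqrt S * (1/2) ^ k)\<^sup>2"
        unfolding d_def by (simp only:)
    qed (simp add: S_def)
    have "summable (\<lambda>k. sqrt S * (1/2) ^ k)" by (intro summable_mult summable_geometric) simp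
    then have "summable (\<lambda>k. G (Suc k) x - G k x)"
      by (rule summable_comparison_test'[of _ 0, OF _ bound])
    then have "convergent (\<lambda>n. G n x - G 0 x)"
      by (simp only: summable_iff_convergent sum_lessThan_telescope[of "\<lambda>k. G k x"])
    from convergent_add[OF this convergent_const[of "G 0 x"]] show "convergent (\<lambda>k. G k x)" by simp
  qed
qed

text \<open>A subsequence converges almost everywhere by the previous lemma, and Fatou's lemma shows that its pointwise
  limit is the limit in norm of the whole sequence.\<close>
theorem L2_complete:
  assumes F: "\<And>n. F n \<in> L2 M"
    and Cauchy: "\<And>e. e > 0 \<Longrightarrow> \<exists>N. \<forall>m\<ge>N. \<forall>n\<ge>N. L2_norm M (\<lambda>x. F m x - F n x) < e"
  obtains f where "f \<in> L2 M" "(\<lambda>n. L2_norm M (\<lambda>x. F n x - f x)) \<longlonglongrightarrow> 0"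
proof -
  have [measurable]: "F n \<in> borel_measurable M" for n using F by simp
  have "\<exists>N. \<forall>k. N k < N (Suc k) \<and>
      (\<forall>m\<ge>N k. \<forall>n\<ge>N k. L2_norm M (\<lambda>x. F m x - F n x) < sqrt ((1/8) ^ k))"
  proof -
    define Q where "Q k N \<longleftrightarrow> (\<forall>m\<ge>N. \<forall>n\<ge>N. L2_norm M (\<lambda>x. F m x - F n x) < sqrt ((1/8) ^ k))" for k N
    have Q: "\<exists>N'. Q k N' \<and> N < N'" for k N
    proof -
      obtain N' where "Q k N'" using Cauchy[of "sqrt ((1/8) ^ k)"] by (auto simp: Q_def)
      then have "Q k (max N' (Suc N))" by (auto simp: Q_def)
      then show ?thesis by (intro exI[of _ "max N' (Suc N)"]) auto
    qed
    have "\<exists>N. \<forall>k. Q k (N k) \<and> N k < N (Suc k)"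
      using Q by (intro dependent_nat_choice[where P=Q and Q="\<lambda>k. (<)"]) blast+
    then show ?thesis unfolding Q_def by blast
  qed
  then obtain N where N: "strict_mono N"
    "\<And>k m n. m \<ge> N k \<Longrightarrow> n \<ge> N k \<Longrightarrow> L2_norm M (\<lambda>x. F m x - F n x) < sqrt ((1/8) ^ k)"
    unfolding strict_mono_Suc_iff by blast
  have "AE x in M. convergent (\<lambda>k. F (N k) x)"
  proof (rule L2_fast_Cauchy_converges_AE[OF F])
    fix k
    have "L2_norm M (\<lambda>x. F (N (Suc k)) x - F (N k) x) < sqrt ((1/8) ^ k)"
      using N(1) by (intro N(2)) (auto simp: strict_mono_less_eq)
    then have "(L2_norm M (\<lambda>x. F (N (Suc k)) x - F (N k) x))\<^sup>2 \<le> (sqrt ((1/8) ^ k))\<^sup>2"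
      by (intro power_mono) auto
    then show "(L2_norm M (\<lambda>x. F (N (Suc k)) x - F (N k) x))\<^sup>2 \<le> (1/8) ^ k" by simp
  qed
  then have lim: "AE x in M. (\<lambda>k. F (N k) x) \<longlonglongrightarrow> lim (\<lambda>k. F (N k) x)"
    by (auto simp: convergent_LIMSEQ_iff)
  define f where "f x = lim (\<lambda>k. F (N k) x)" for x
  have [measurable]: "f \<in> borel_measurable M" unfolding f_def by measurable
  have dist: "(\<integral>\<^sup>+x. ennreal ((cmod (F n x - f x))\<^sup>2) \<partial>M) \<le> ennreal (e\<^sup>2)"
    if e: "e > 0" "\<forall>m\<ge>n0. \<forall>n\<ge>n0. L2_norm M (\<lambda>x. F m x - F n x) < e" and n: "n \<ge> n0" for e n n0
  proof -
    have "(\<integral>\<^sup>+x. ennreal ((cmod (F n x - f x))\<^sup>2) \<partial>M)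
      = (\<integral>\<^sup>+x. liminf (\<lambda>k. ennreal ((cmod (F n x - F (N k) x))\<^sup>2)) \<partial>M)"
      using lim
    proof (intro nn_integral_cong_AE, elim eventually_mono)
      fix x assume "(\<lambda>k. F (N k) x) \<longlonglongrightarrow> lim (\<lambda>k. F (N k) x)"
      then have "(\<lambda>k. ennreal ((cmod (F n x - F (N k) x))\<^sup>2)) \<longlonglongrightarrow> ennreal ((cmod (F n x - f x))\<^sup>2)"
        unfolding f_def by (intro tendsto_intros tendsto_ennrealI)
      then show "ennreal ((cmod (F n x - f x))\<^sup>2) = liminf (\<lambda>k. ennreal ((cmod (F n x - F (N k) x))\<^sup>2))"
        using lim_imp_Liminf[OF sequentially_bot] by metis
    qed
    also have "\<dots> \<le> liminf (\<lambda>k. \<integral>\<^sup>+x. ennreal ((cmod (F n x - F (N k) x))\<^sup>2) \<partial>M)"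
      by (intro nn_integral_liminf) auto
    also have "\<dots> = liminf (\<lambda>k. ennreal ((L2_norm M (\<lambda>x. F n x - F (N k) x))\<^sup>2))"
      using nn_integral_cmod_square[OF L2_diff[OF F F]] by simp
    also have "\<dots> \<le> ennreal (e\<^sup>2)"
    proof (rule Liminf_le)
      have "eventually (\<lambda>k. N k \<ge> n0) sequentially"
        using filterlim_subseq[OF N(1)] by (auto simp: filterlim_at_top)
      then show "\<forall>\<^sub>F k in sequentially. ennreal ((L2_norm M (\<lambda>x. F n x - F (N k) x))\<^sup>2) \<le> ennreal (e\<^sup>2)"
      proof eventually_elim
        case (elim k)
        then have "L2_norm M (\<lambda>x. F n x - F (N k) x) \<le> e" using e(2) n by (simp add: less_imp_le)
        then show ?case by (intro ennreal_leI power_mono) auto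
      qed
    qed simp
    finally show ?thesis .
  qed
  have diff: "(\<lambda>x. F n x - f x) \<in> L2 M \<and> L2_norm M (\<lambda>x. F n x - f x) \<le> e"
    if e: "e > 0" "\<forall>m\<ge>n0. \<forall>n\<ge>n0. L2_norm M (\<lambda>x. F m x - F n x) < e" and n: "n \<ge> n0" for e n n0
  proof -
    have le: "(\<integral>\<^sup>+x. ennreal ((cmod (F n x - f x))\<^sup>2) \<partial>M) \<le> ennreal (e\<^sup>2)" using that by (rule dist)
    then have "(\<integral>\<^sup>+x. ennreal ((cmod (F n x - f x))\<^sup>2) \<partial>M) < \<infinity>"
      using ennreal_less_top le_less_trans by (metis infinity_ennreal_def)
    then have L2: "(\<lambda>x. F n x - f x) \<in> L2 M"
      by (intro L2_I integrableI_nonneg) auto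
    then have "(L2_norm M (\<lambda>x. F n x - f x))\<^sup>2 \<le> e\<^sup>2"
      using le nn_integral_cmod_square[OF L2] by simp
    then show ?thesis using L2 e by (auto intro: power2_le_imp_le)
  qed
  show ?thesis
  proof (rule that)
    obtain n0 where "\<forall>m\<ge>n0. \<forall>n\<ge>n0. L2_norm M (\<lambda>x. F m x - F n x) < 1" using Cauchy[of 1] by auto
    then have "(\<lambda>x. F n0 x - f x) \<in> L2 M" using diff[of 1 n0 n0] by auto
    then show "f \<in> L2 M" using L2_diff[OF F, of "\<lambda>x. F n0 x - f x" n0] by simp
    show "(\<lambda>n. L2_norm M (\<lambda>x. F n x - f x)) \<longlonglongrightarrow> 0"
    proof (rule LIMSEQ_I)
      fix r :: real assume "r > 0"
      then obtain n0 where "\<forall>m\<ge>n0. \<forall>n\<ge>n0. L2_norm M (\<lambda>x. F m x - F n x) < r / 2" using Cauchy[of "r/2"] by auto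
      then have *: "L2_norm M (\<lambda>x. F n x - f x) \<le> r / 2" if "n \<ge> n0" for n
        using diff[of "r/2" n0 n] \<open>r > 0\<close> that by auto
      show "\<exists>no. \<forall>n\<ge>no. norm (L2_norm M (\<lambda>x. F n x - f x) - 0) < r"
      proof (intro exI[of _ n0] allI impI)
        fix n assume "n \<ge> n0"
        from *[OF this] show "norm (L2_norm M (\<lambda>x. F n x - f x) - 0) < r" using \<open>r > 0\<close> by simp
      qed
    qed
  qed
qed

subsection \<open>Orthonormal sequences\<close>

lemma L2_norm_square_orthonormal_sum:
  assumes "finite A" "\<And>i. i \<in> A \<Longrightarrow> e i \<in> L2 M"
    and orth: "\<And>i j. i \<in> A \<Longrightarrow> j \<in> A \<Longrightarrow> L2_inner M (e i) (e j) = (if i = j then 1 else 0)"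
  shows "(L2_norm M (\<lambda>x. \<Sum>i\<in>A. c i * e i x))\<^sup>2 = (\<Sum>i\<in>A. (cmod (c i))\<^sup>2)"
proof -
  have L2: "(\<lambda>x. c i * e i x) \<in> L2 M" if "i \<in> A" for i using assms(2)[OF that] by (rule L2_cmult)
  have "complex_of_real ((L2_norm M (\<lambda>x. \<Sum>i\<in>A. c i * e i x))\<^sup>2)
      = (\<Sum>i\<in>A. \<Sum>j\<in>A. c i * (cnj (c j) * L2_inner M (e i) (e j)))"
    unfolding L2_inner_self[symmetric] using L2
    by (simp add: L2_inner_sum_left L2_inner_sum_right L2_sum L2_inner_cmult_left L2_inner_cmult_right
        assms(2) sum_distrib_left)
  also have "\<dots> = (\<Sum>i\<in>A. \<Sum>j\<in>A. if i = j then c i * cnj (c j) else 0)"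
    using orth by (intro sum.cong refl) auto
  also have "\<dots> = (\<Sum>i\<in>A. c i * cnj (c i))" using assms(1) by (simp add: sum.delta')
  also have "\<dots> = complex_of_real (\<Sum>i\<in>A. (cmod (c i))\<^sup>2)"
    by (simp only: complex_norm_square of_real_sum)
  finally show ?thesis by (simp only: of_real_eq_iff)
qed

lemma L2_Bessel:
  assumes "finite A" "\<And>i. i \<in> A \<Longrightarrow> e i \<in> L2 M" "f \<in> L2 M"
    and orth: "\<And>i j. i \<in> A \<Longrightarrow> j \<in> A \<Longrightarrow> L2_inner M (e i) (e j) = (if i = j then 1 else 0)"
  shows "(\<Sum>i\<in>A. (cmod (L2_inner M f (e i)))\<^sup>2) \<le> (L2_norm M f)\<^sup>2"
proof -
  let ?c = "\<lambda>i. L2_inner M f (e i)"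
  let ?s = "\<lambda>x. \<Sum>i\<in>A. ?c i * e i x"
  have s: "?s \<in> L2 M" using assms(2) by (intro L2_sum L2_cmult)
  have "L2_inner M f ?s = (\<Sum>i\<in>A. cnj (?c i) * ?c i)"
    using assms(2,3) by (simp add: L2_inner_sum_right L2_cmult L2_inner_cmult_right)
  also have "\<dots> = of_real (\<Sum>i\<in>A. (cmod (?c i))\<^sup>2)"
    by (simp only: complex_norm_square of_real_sum mult.commute)
  finally have "Re (L2_inner M f ?s) = (\<Sum>i\<in>A. (cmod (?c i))\<^sup>2)" by simp
  moreover have "0 \<le> (L2_norm M (\<lambda>x. f x - ?s x))\<^sup>2" by simp
  ultimately show ?thesis
    using L2_norm_diff_square[OF assms(3) s] L2_norm_square_orthonormal_sum[OF assms(1,2) orth, of ?c] by simp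
qed

theorem Riesz_Fischer:
  fixes e :: "nat \<Rightarrow> 'a \<Rightarrow> complex"
  assumes e: "\<And>i. e i \<in> L2 M"
    and orth: "\<And>i j. L2_inner M (e i) (e j) = (if i = j then 1 else 0)"
    and c: "summable (\<lambda>i. (cmod (c i))\<^sup>2)"
  obtains f where "f \<in> L2 M" "\<And>i. L2_inner M f (e i) = c i" "(\<lambda>i. (cmod (c i))\<^sup>2) sums (L2_norm M f)\<^sup>2"
proof -
  define F where "F n = (\<lambda>x. \<Sum>i<n. c i * e i x)" for n
  have F: "F n \<in> L2 M" for n unfolding F_def using e by (intro L2_sum L2_cmult)
  have Fdiff: "(L2_norm M (\<lambda>x. F m x - F n x))\<^sup>2 = (\<Sum>i\<in>{n..<m}. (cmod (c i))\<^sup>2)" if "n \<le> m" for m n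
  proof -
    have "F m x - F n x = (\<Sum>i\<in>{n..<m}. c i * e i x)" for x
      unfolding F_def using that sum_diff_nat_ivl[of 0 n m "\<lambda>i. c i * e i x"]
      by (simp add: atLeast0LessThan)
    then show ?thesis using L2_norm_square_orthonormal_sum[of "{n..<m}" e M c] e orth by simp
  qed
  have Cauchy: "\<exists>N. \<forall>m\<ge>N. \<forall>n\<ge>N. L2_norm M (\<lambda>x. F m x - F n x) < r" if r: "r > 0" for r
  proof -
    obtain N where N: "\<And>m n. m \<ge> N \<Longrightarrow> norm (\<Sum>i\<in>{m..<n}. (cmod (c i))\<^sup>2) < r\<^sup>2"
      using c[unfolded summable_Cauchy, rule_format, of "r\<^sup>2"] r by auto
    have *: "L2_norm M (\<lambda>x. F m x - F n x) < r" if "n \<ge> N" "n \<le> m" for m n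
    proof (rule power2_less_imp_less)
      show "(L2_norm M (\<lambda>x. F m x - F n x))\<^sup>2 < r\<^sup>2"
        unfolding Fdiff[OF that(2)] using N[OF that(1), of m] by (simp add: sum_nonneg)
    qed (use \<open>r > 0\<close> in simp)
    have "L2_norm M (\<lambda>x. F m x - F n x) < r" if "n \<ge> N" "m \<ge> N" for m n
      using *[of n m] *[of m n] that L2_norm_minus_commute[of M "F m" "F n"] by (cases "n \<le> m") auto
    then show ?thesis by blast
  qed
  obtain f where f: "f \<in> L2 M" "(\<lambda>n. L2_norm M (\<lambda>x. F n x - f x)) \<longlonglongrightarrow> 0"
    using L2_complete[OF F Cauchy] .
  have "L2_inner M f (e i) = c i" for i
  proof (rule LIMSEQ_unique)
    show "(\<lambda>n. L2_inner M (F n) (e i)) \<longlonglongrightarrow> L2_inner M f (e i)"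
      by (rule L2_inner_tendsto[OF F f(1) e f(2)])
    have "L2_inner M (F n) (e i) = c i" if "n > i" for n
    proof -
      have "L2_inner M (F n) (e i) = (\<Sum>j<n. c j * (if j = i then 1 else 0))"
        unfolding F_def using e by (subst L2_inner_sum_left) (auto simp: L2_cmult L2_inner_cmult_left orth)
      also have "\<dots> = c i" using that by (simp add: if_distrib cong: if_cong)
      finally show ?thesis .
    qed
    then show "(\<lambda>n. L2_inner M (F n) (e i)) \<longlonglongrightarrow> c i"
      by (intro tendsto_eventually) (auto simp: eventually_at_top_dense)
  qed
  moreover have "(\<lambda>i. (cmod (c i))\<^sup>2) sums (L2_norm M f)\<^sup>2"
  proof -
    have *: "(L2_norm M (F n))\<^sup>2 = (\<Sum>i<n. (cmod (c i))\<^sup>2)" for n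
      using Fdiff[of 0 n] by (simp add: F_def lessThan_atLeast0)
    have "(\<lambda>n. (L2_norm M (F n))\<^sup>2) \<longlonglongrightarrow> (L2_norm M f)\<^sup>2"
      by (rule tendsto_power[OF L2_norm_tendsto[OF F f]])
    then show ?thesis unfolding * sums_def .
  qed
  ultimately show ?thesis by (rule that[OF f(1)])
qed

text \<open>By Riesz and Fischer there is a function with the coefficients of \<open>f\<close> whose norm is given by them, and by
  totality this function is \<open>f\<close>.\<close>
theorem L2_Parseval:
  fixes e :: "nat \<Rightarrow> 'a \<Rightarrow> complex"
  assumes e: "\<And>i. e i \<in> L2 M"
    and orth: "\<And>i j. L2_inner M (e i) (e j) = (if i = j then 1 else 0)"
    and total: "\<And>f. f \<in> L2 M \<Longrightarrow> (\<And>i. L2_inner M f (e i) = 0) \<Longrightarrow> AE x in M. f x = 0"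
    and f: "f \<in> L2 M"
  shows "((\<lambda>i. (cmod (L2_inner M f (e i)))\<^sup>2) has_sum (L2_norm M f)\<^sup>2) UNIV"
proof -
  have "summable (\<lambda>i. (cmod (L2_inner M f (e i)))\<^sup>2)"
    using L2_Bessel[OF _ e f orth] by (intro summableI_nonneg_bounded) auto
  then obtain g where g: "g \<in> L2 M" "\<And>i. L2_inner M g (e i) = L2_inner M f (e i)"
    "(\<lambda>i. (cmod (L2_inner M f (e i)))\<^sup>2) sums (L2_norm M g)\<^sup>2"
    using Riesz_Fischer[OF e orth, of "\<lambda>i. L2_inner M f (e i)"] by auto
  have "AE x in M. f x - g x = 0"
    using f g e by (intro total L2_diff) (simp_all add: L2_inner_diff_left)
  then have "L2_norm M f = L2_norm M g" using f g by (intro L2_norm_cong_AE) auto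
  then show ?thesis using g(3) by (simp add: sums_nonneg_imp_has_sum)
qed

subsection \<open>Parseval frames\<close>

lemma complex_polarization:
  "4 * (z * cnj w) = (of_real ((cmod (z + w))\<^sup>2) + - of_real ((cmod (z - w))\<^sup>2))
    + (\<i> * of_real ((cmod (z + \<i> * w))\<^sup>2) + - (\<i> * of_real ((cmod (z - \<i> * w))\<^sup>2)))"
  by (simp add: complex_norm_square algebra_simps del: of_real_power)

lemma L2_polarization:
  assumes f: "f \<in> L2 M" and g: "g \<in> L2 M"
  shows "4 * L2_inner M f g =
    (of_real ((L2_norm M (\<lambda>x. f x + g x))\<^sup>2) + - of_real ((L2_norm M (\<lambda>x. f x - g x))\<^sup>2))
    + (\<i> * of_real ((L2_norm M (\<lambda>x. f x + \<i> * g x))\<^sup>2) + - (\<i> * of_real ((L2_norm M (\<lambda>x. f x - \<i> * g x))\<^sup>2)))"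
proof -
  have re: "L2_norm M (\<lambda>x. \<i> * g x) = L2_norm M g" by (simp add: L2_norm_cmult)
  show ?thesis
    by (simp add: L2_norm_add_square L2_norm_diff_square f g L2_cmult L2_inner_cmult_right re del: of_real_power)
      (simp add: complex_eq_iff)
qed

theorem L2_Parseval_bilinear:
  assumes \<psi>: "\<And>a. a \<in> I \<Longrightarrow> \<psi> a \<in> L2 M"
    and P: "\<And>f. f \<in> L2 M \<Longrightarrow> ((\<lambda>a. (cmod (L2_inner M f (\<psi> a)))\<^sup>2) has_sum (L2_norm M f)\<^sup>2) I"
    and f: "f \<in> L2 M" and g: "g \<in> L2 M"
  shows "((\<lambda>a. L2_inner M f (\<psi> a) * cnj (L2_inner M g (\<psi> a))) has_sum L2_inner M f g) I"
proof -
  have Q: "((\<lambda>a. complex_of_real ((cmod (L2_inner M h (\<psi> a)))\<^sup>2)) has_sum of_real ((L2_norm M h)\<^sup>2)) I"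
    if "h \<in> L2 M" for h using P[OF that] by (rule has_sum_of_real)
  have ig: "(\<lambda>x. \<i> * g x) \<in> L2 M" using g by (rule L2_cmult)
  note h = has_sum_add[OF has_sum_add[OF Q[OF L2_add[OF f g]] has_sum_uminusI[OF Q[OF L2_diff[OF f g]]]]
    has_sum_add[OF has_sum_cmult_right[OF Q[OF L2_add[OF f ig]], of \<i>]
      has_sum_uminusI[OF has_sum_cmult_right[OF Q[OF L2_diff[OF f ig]], of \<i>]]]]
  have "((\<lambda>a. 4 * (L2_inner M f (\<psi> a) * cnj (L2_inner M g (\<psi> a)))) has_sum 4 * L2_inner M f g) I"
    unfolding L2_polarization[OF f g]
    by (rule has_sum_cong[THEN iffD2, OF _ h])
      (simp only: complex_polarization L2_inner_add_left L2_inner_diff_left L2_inner_cmult_left f g ig \<psi>)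
  then show ?thesis using has_sum_cmult_right[of _ I _ "1/4"] by fastforce
qed

text \<open>Bessel's inequality for finitely many coefficients passes to limits. Hence the analysis map is a contraction
  into the square-summable families, and the equality of norms passes to limits as well.\<close>
theorem L2_Parseval_dense:
  assumes \<psi>: "\<And>a. a \<in> I \<Longrightarrow> \<psi> a \<in> L2 M" and D: "D \<subseteq> L2 M"
    and dense: "\<And>f r. f \<in> L2 M \<Longrightarrow> r > 0 \<Longrightarrow> \<exists>g\<in>D. L2_norm M (\<lambda>x. f x - g x) < r"
    and P: "\<And>f. f \<in> D \<Longrightarrow> ((\<lambda>a. (cmod (L2_inner M f (\<psi> a)))\<^sup>2) has_sum (L2_norm M f)\<^sup>2) I"
    and f: "f \<in> L2 M"
  shows "((\<lambda>a. (cmod (L2_inner M f (\<psi> a)))\<^sup>2) has_sum (L2_norm M f)\<^sup>2) I"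
proof -
  define S where "S h A = (\<Sum>a\<in>A. (cmod (L2_inner M h (\<psi> a)))\<^sup>2)" for h A
  have approx: "\<exists>G. (\<forall>n::nat. G n \<in> D) \<and> (\<lambda>n. L2_norm M (\<lambda>x. G n x - h x)) \<longlonglongrightarrow> 0" if h: "h \<in> L2 M" for h
  proof -
    have "\<forall>n::nat. \<exists>g\<in>D. L2_norm M (\<lambda>x. h x - g x) < inverse (real (Suc n))"
      using dense[OF h] by (simp del: of_nat_Suc)
    then have "\<exists>G. \<forall>n. G n \<in> D \<and> L2_norm M (\<lambda>x. h x - G n x) < inverse (real (Suc n))"
      unfolding Bex_def by (rule choice)
    then obtain G where G: "\<And>n. G n \<in> D" "\<And>n. L2_norm M (\<lambda>x. h x - G n x) < inverse (real (Suc n))"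
      by auto
    have "(\<lambda>n. L2_norm M (\<lambda>x. G n x - h x)) \<longlonglongrightarrow> 0"
      using G(2) by (intro Lim_null_comparison[OF _ LIMSEQ_inverse_real_of_nat] always_eventually allI)
        (simp add: L2_norm_minus_commute[of M _ h] less_imp_le)
    then show ?thesis using G(1) by blast
  qed
  have D_le: "S g A \<le> (L2_norm M g)\<^sup>2" if "g \<in> D" "finite A" "A \<subseteq> I" for g A
    unfolding S_def using finite_sum_le_has_sum[OF P[OF that(1)] that(2,3)] by simp
  have Bessel: "S h A \<le> (L2_norm M h)\<^sup>2" if h: "h \<in> L2 M" and A: "finite A" "A \<subseteq> I" for h A
  proof -
    obtain G where G: "\<And>n::nat. G n \<in> D" "(\<lambda>n. L2_norm M (\<lambda>x. G n x - h x)) \<longlonglongrightarrow> 0"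
      using approx[OF h] by blast
    have GL: "G n \<in> L2 M" for n using G(1) D by blast
    have "(\<lambda>n. S (G n) A) \<longlonglongrightarrow> S h A"
      unfolding S_def
    proof (rule tendsto_sum)
      fix a assume "a \<in> A"
      then have "\<psi> a \<in> L2 M" using A \<psi> by auto
      from tendsto_power[OF tendsto_norm[OF L2_inner_tendsto[OF GL h this G(2)]]]
      show "(\<lambda>n. (cmod (L2_inner M (G n) (\<psi> a)))\<^sup>2) \<longlonglongrightarrow> (cmod (L2_inner M h (\<psi> a)))\<^sup>2" .
    qed
    moreover have "(\<lambda>n. (L2_norm M (G n))\<^sup>2) \<longlonglongrightarrow> (L2_norm M h)\<^sup>2"
      by (rule tendsto_power[OF L2_norm_tendsto[OF GL h G(2)]])
    ultimately show ?thesis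
      by (rule LIMSEQ_le) (simp add: D_le G(1) A)
  qed
  have summable: "(\<lambda>a. (cmod (L2_inner M f (\<psi> a)))\<^sup>2) summable_on I"
    using Bessel[OF f] by (intro nonneg_bdd_above_summable_on bdd_aboveI[of _ "(L2_norm M f)\<^sup>2"]) (auto simp: S_def)
  define T where "T = (\<Sum>\<^sub>\<infinity>a\<in>I. (cmod (L2_inner M f (\<psi> a)))\<^sup>2)"
  have T: "S f A \<le> T" if "finite A" "A \<subseteq> I" for A
    unfolding S_def T_def using summable that by (intro finite_sum_le_infsum) auto
  have T0: "T \<ge> 0" unfolding T_def by (intro infsum_nonneg) simp
  have "T \<le> (L2_norm M f)\<^sup>2"
    unfolding T_def using summable Bessel[OF f] by (intro infsum_le_finite_sums) (auto simp: S_def)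
  moreover have "L2_norm M f \<le> sqrt T"
  proof -
    obtain G where G: "\<And>n::nat. G n \<in> D" "(\<lambda>n. L2_norm M (\<lambda>x. G n x - f x)) \<longlonglongrightarrow> 0"
      using approx[OF f] by blast
    have GL: "G n \<in> L2 M" for n using G(1) D by blast
    have "L2_norm M (G n) \<le> sqrt T + L2_norm M (\<lambda>x. G n x - f x)" for n
    proof -
      let ?r = "sqrt T + L2_norm M (\<lambda>x. G n x - f x)"
      have "S (G n) A \<le> ?r\<^sup>2" if A: "finite A" "A \<subseteq> I" for A
      proof -
        have "sqrt (S (G n) A) = L2_set (\<lambda>a. cmod (L2_inner M (G n) (\<psi> a))) A" by (simp add: S_def L2_set_def)
        also have "\<dots> \<le> L2_set (\<lambda>a. cmod (L2_inner M f (\<psi> a)) + cmod (L2_inner M (\<lambda>x. G n x - f x) (\<psi> a))) A"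
        proof (intro L2_set_mono)
          fix a assume "a \<in> A"
          then have "L2_inner M (G n) (\<psi> a) = L2_inner M f (\<psi> a) + L2_inner M (\<lambda>x. G n x - f x) (\<psi> a)"
            using A \<psi> GL f by (subst L2_inner_diff_left) auto
          then show "cmod (L2_inner M (G n) (\<psi> a))
              \<le> cmod (L2_inner M f (\<psi> a)) + cmod (L2_inner M (\<lambda>x. G n x - f x) (\<psi> a))"
            by (simp add: norm_triangle_ineq)
        qed simp
        also have "\<dots> \<le> sqrt (S f A) + sqrt (S (\<lambda>x. G n x - f x) A)"
          unfolding S_def L2_set_def[symmetric] by (rule L2_set_triangle_ineq)
        also have "\<dots> \<le> sqrt T + sqrt ((L2_norm M (\<lambda>x. G n x - f x))\<^sup>2)"
          using T[OF A] Bessel[OF L2_diff[OF GL f] A] by (intro add_mono real_sqrt_le_mono)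
        finally have "sqrt (S (G n) A) \<le> ?r" by simp
        then have "(sqrt (S (G n) A))\<^sup>2 \<le> ?r\<^sup>2" by (intro power_mono) (auto simp: S_def sum_nonneg)
        then show ?thesis by (simp add: S_def sum_nonneg)
      qed
      then have "(L2_norm M (G n))\<^sup>2 \<le> ?r\<^sup>2"
        using has_sum_le_finite_sums[OF P[OF G(1)]] by (simp add: S_def)
      then show ?thesis using T0 by (intro power2_le_imp_le[OF _ add_nonneg_nonneg]) auto
    qed
    moreover have "(\<lambda>n. sqrt T + L2_norm M (\<lambda>x. G n x - f x)) \<longlonglongrightarrow> sqrt T + 0"
      using G(2) by (intro tendsto_intros)
    ultimately show ?thesis
      using L2_norm_tendsto[OF GL f G(2)] by (intro LIMSEQ_le[of "\<lambda>n. L2_norm M (G n)"]) auto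
  qed
  then have "(L2_norm M f)\<^sup>2 \<le> T"
    using power_mono[of "L2_norm M f" "sqrt T" 2] T0 by simp
  ultimately have "T = (L2_norm M f)\<^sup>2" by simp
  then show ?thesis using summable unfolding T_def by (simp add: has_sum_iff)
qed

subsection \<open>Integrals of series over countable index sets\<close>

text \<open>Dominated convergence for series, transported from sequences along an enumeration of the index set.\<close>
lemma has_sum_integral:
  fixes f :: "'i \<Rightarrow> 'a \<Rightarrow> complex"
  assumes "countable I" and f: "\<And>i. i \<in> I \<Longrightarrow> integrable M (f i)"
    and s: "(\<lambda>i. \<integral>x. cmod (f i x) \<partial>M) summable_on I"
  shows "AE x in M. (\<lambda>i. cmod (f i x)) summable_on I"
    and "integrable M (\<lambda>x. \<Sum>\<^sub>\<infinity>i\<in>I. f i x)"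
    and "((\<lambda>i. \<integral>x. f i x \<partial>M) has_sum (\<integral>x. (\<Sum>\<^sub>\<infinity>i\<in>I. f i x) \<partial>M)) I"
proof -
  define t where "t = to_nat_on I"
  have t: "inj_on t I" unfolding t_def using \<open>countable I\<close> by (rule inj_on_to_nat_on)
  define g where "g n = (if n \<in> t ` I then f (inv_into I t n) else (\<lambda>x. 0))" for n
  have g_t: "g (t i) = f i" if "i \<in> I" for i using that t by (simp add: g_def)
  have g_out: "g n = (\<lambda>x. 0)" if "n \<notin> t ` I" for n using that by (simp add: g_def)
  have g: "integrable M (g n)" for n using f inv_into_into[of n t I] by (auto simp: g_def)
  have transfer: "((\<lambda>n. F (g n)) has_sum S) UNIV \<longleftrightarrow> ((\<lambda>i. F (f i)) has_sum S) I"
    if "F (\<lambda>x. 0) = 0" for F :: "('a \<Rightarrow> complex) \<Rightarrow> 'b::{comm_monoid_add,t2_space}" and S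
  proof -
    have "((\<lambda>n. F (g n)) has_sum S) UNIV \<longleftrightarrow> ((\<lambda>n. F (g n)) has_sum S) (t ` I)"
      using that g_out by (intro has_sum_cong_neutral) auto
    also have "\<dots> \<longleftrightarrow> ((\<lambda>i. F (g (t i))) has_sum S) I"
      using has_sum_reindex[OF t] by (simp add: o_def)
    also have "\<dots> \<longleftrightarrow> ((\<lambda>i. F (f i)) has_sum S) I" by (intro has_sum_cong) (simp add: g_t)
    finally show ?thesis .
  qed
  have transfer': "(\<lambda>n. F (g n)) summable_on UNIV \<longleftrightarrow> (\<lambda>i. F (f i)) summable_on I"
    if "F (\<lambda>x. 0) = 0" for F :: "('a \<Rightarrow> complex) \<Rightarrow> 'b::{comm_monoid_add,t2_space}"
    using transfer[of F, OF that] unfolding summable_on_def by simp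
  have "(\<lambda>n. \<integral>x. cmod (g n x) \<partial>M) summable_on UNIV"
    using s by (subst transfer'[of "\<lambda>h. \<integral>x. cmod (h x) \<partial>M"]) auto
  then have sg: "summable (\<lambda>n. \<integral>x. cmod (g n x) \<partial>M)" by (rule summable_on_imp_summable)
  have "(\<Sum>n. \<integral>\<^sup>+x. ennreal (cmod (g n x)) \<partial>M) = (\<Sum>n. ennreal (\<integral>x. cmod (g n x) \<partial>M))"
    using g by (subst nn_integral_eq_integral) auto
  also have "\<dots> = ennreal (\<Sum>n. \<integral>x. cmod (g n x) \<partial>M)" using sg by (intro suminf_ennreal2) auto
  finally have "(\<integral>\<^sup>+x. (\<Sum>n. ennreal (cmod (g n x))) \<partial>M) \<noteq> \<infinity>"
    using g by (subst nn_integral_suminf) auto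
  then have "AE x in M. (\<Sum>n. ennreal (cmod (g n x))) \<noteq> \<infinity>"
    using g by (intro nn_integral_noteq_infinite) auto
  then have AEs: "AE x in M. summable (\<lambda>n. cmod (g n x))"
    by (rule eventually_mono) (auto intro!: summable_suminf_not_top)
  then show AE: "AE x in M. (\<lambda>i. cmod (f i x)) summable_on I"
  proof (rule eventually_mono)
    fix x assume "summable (\<lambda>n. cmod (g n x))"
    then have "(\<lambda>n. cmod (g n x)) summable_on UNIV" by (subst summable_on_UNIV_nonneg_real_iff) auto
    then show "(\<lambda>i. cmod (f i x)) summable_on I" by (subst (asm) transfer'[of "\<lambda>h. cmod (h x)"]) auto
  qed
  have suminf: "AE x in M. (\<Sum>n. g n x) = (\<Sum>\<^sub>\<infinity>i\<in>I. f i x)"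
    using AE AEs
  proof eventually_elim
    case (elim x)
    have "((\<lambda>n. g n x) has_sum (\<Sum>n. g n x)) UNIV"
      using elim summable_sums[OF summable_norm_cancel] by (intro norm_summable_imp_has_sum) auto
    then have "((\<lambda>i. f i x) has_sum (\<Sum>n. g n x)) I" by (subst (asm) transfer[of "\<lambda>h. h x"]) auto
    then show ?case by (simp add: infsumI)
  qed
  have int_g: "integrable M (\<lambda>x. \<Sum>n. g n x)" using g AEs sg by (intro integrable_suminf) auto
  have meas: "(\<lambda>x. \<Sum>\<^sub>\<infinity>i\<in>I. f i x) \<in> borel_measurable M"
  proof -
    have "(\<lambda>x. \<Sum>\<^sub>\<infinity>i\<in>I. f i x) = (\<lambda>x. if summable (\<lambda>n. cmod (g n x)) then (\<Sum>n. g n x) else 0)"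
    proof
      fix x
      show "(\<Sum>\<^sub>\<infinity>i\<in>I. f i x) = (if summable (\<lambda>n. cmod (g n x)) then (\<Sum>n. g n x) else 0)"
      proof (cases "summable (\<lambda>n. cmod (g n x))")
        case True
        then have "((\<lambda>n. g n x) has_sum (\<Sum>n. g n x)) UNIV"
          using summable_sums[OF summable_norm_cancel] by (intro norm_summable_imp_has_sum) auto
        then have "((\<lambda>i. f i x) has_sum (\<Sum>n. g n x)) I" by (subst (asm) transfer[of "\<lambda>h. h x"]) auto
        then show ?thesis using True by (simp add: infsumI)
      next
        case False
        then have "\<not> (\<lambda>n. cmod (g n x)) summable_on UNIV" using summable_on_imp_summable by blast
        then have "\<not> (\<lambda>i. cmod (f i x)) summable_on I" by (subst (asm) transfer'[of "\<lambda>h. cmod (h x)"]) auto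
        then have "\<not> (\<lambda>i. f i x) summable_on I" unfolding summable_on_iff_abs_summable_on_complex .
        then show ?thesis using False by (simp add: infsum_not_exists)
      qed
    qed
    moreover have [measurable]: "g n \<in> borel_measurable M" for n using g by simp
    have "(\<lambda>x. if summable (\<lambda>n. cmod (g n x)) then (\<Sum>n. g n x) else 0) \<in> borel_measurable M"
      unfolding summable_iff_convergent Cauchy_convergent_iff[symmetric]
      by (intro measurable_If borel_measurable_suminf borel_measurable_const sets_Collect_Cauchy
          borel_measurable_sum borel_measurable_norm) simp_all
    ultimately show ?thesis by simp
  qed
  show "integrable M (\<lambda>x. \<Sum>\<^sub>\<infinity>i\<in>I. f i x)"
    using int_g suminf meas by (subst integrable_cong_AE[symmetric, of "\<lambda>x. \<Sum>n. g n x"]) auto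
  have eq: "(\<integral>x. (\<Sum>\<^sub>\<infinity>i\<in>I. f i x) \<partial>M) = (\<integral>x. (\<Sum>n. g n x) \<partial>M)"
    using suminf meas int_g by (intro integral_cong_AE) (auto elim: eventually_mono)
  have "((\<lambda>n. \<integral>x. g n x \<partial>M) has_sum (\<integral>x. (\<Sum>n. g n x) \<partial>M)) UNIV"
  proof (rule norm_summable_imp_has_sum)
    show "summable (\<lambda>n. norm (\<integral>x. g n x \<partial>M))"
      using sg by (rule summable_comparison_test'[of _ 0]) auto
    show "(\<lambda>n. \<integral>x. g n x \<partial>M) sums (\<integral>x. (\<Sum>n. g n x) \<partial>M)"
      using g AEs sg by (intro sums_integral) auto
  qed
  then show "((\<lambda>i. \<integral>x. f i x \<partial>M) has_sum (\<integral>x. (\<Sum>\<^sub>\<infinity>i\<in>I. f i x) \<partial>M)) I"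
    unfolding eq by (subst (asm) transfer[of "\<lambda>h. \<integral>x. h x \<partial>M"]) auto
qed

section \<open>The Gabor basis\<close>

context local_field_setup
begin

lemma chi_add: "chi (x + y) = chi x * chi y"
  using character by (auto simp: additive_character_def)

lemma cmod_chi [simp]: "cmod (chi x) = 1"
  using character by (auto simp: additive_character_def)

lemma chi_disc: "x \<in> disc 0 \<Longrightarrow> chi x = 1"
  using character_trivial by (simp add: integer_ring_eq)

lemma chi_0 [simp]: "chi 0 = 1" by (simp add: chi_disc)

lemma chi_mult_cnj [simp]: "chi x * cnj (chi x) = 1"
  using complex_norm_square[of "chi x"] by simp

lemma chi_minus: "chi (- x) = cnj (chi x)"
proof -
  have "chi (- x) * chi x = 1" by (simp flip: chi_add)
  then have "cnj (chi x) = (chi (- x) * chi x) * cnj (chi x)" by (simp only: mult_1_left)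
  then show ?thesis by (simp only: mult.assoc chi_mult_cnj mult_1_right)
qed

lemma chi_diff: "chi (x - y) = chi x * cnj (chi y)"
  using chi_add[of x "- y"] by (simp add: chi_minus)

lemma chi_lat: "l \<in> lat \<Longrightarrow> k \<in> lat \<Longrightarrow> chi (l * k) = 1"
  using character_u by (auto simp: lat_def)

lemma chi_measurable [measurable]: "chi \<in> borel_measurable borel"
  using character by (auto simp: additive_character_def intro: borel_measurable_continuous_onI)

lemma chi_mult_measurable [measurable]: "(\<lambda>x. chi (y * x)) \<in> borel_measurable borel"
  using measurable_compose[OF measurable_dilate chi_measurable] .

text \<open>The set of all \<open>y * x\<close> with \<open>x\<close> in \<open>disc N\<close> contains \<open>disc 1\<close>, where \<open>chi\<close> is not trivial.\<close>
lemma chi_nontrivial_on_disc: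
  assumes "y \<notin> disc (- N)" obtains x where "x \<in> disc N" "chi (y * x) \<noteq> 1"
proof -
  obtain w where w: "w \<in> integer_ring" "chi (inverse \<pp> * w) \<noteq> 1" using character_nontrivial by auto
  define z where "z = inverse \<pp> * w"
  have z: "z \<in> disc 1"
    using w(1) by (auto simp: z_def integer_ring_def disc_def absval_mult absval_pp power_int_minus)
  have y: "y \<noteq> 0" using assms by auto
  then obtain M where M: "absval y = real q powi M" by (rule absval_cases)
  then have "M > - N" using assms by (simp add: disc_def powi_le_iff)
  have "inverse y \<in> disc (- M)" by (simp add: disc_def M power_int_minus)
  then have "inverse y * z \<in> disc (- M + 1)" using z by (rule disc_mult)
  then have "inverse y * z \<in> disc N" using disc_mono[of "- M + 1" N] \<open>M > - N\<close> by auto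
  moreover have "chi (y * (inverse y * z)) \<noteq> 1" using y w(2) by (simp add: z_def mult.assoc[symmetric])
  ultimately show ?thesis by (rule that)
qed

text \<open>A character integrates to zero over a coset of a disc on which it is not constant.\<close>
lemma integral_chi_coset:
  "(\<integral>x. indicator (coset a N) x * chi (y * x) \<partial>\<mu>) = (if y \<in> disc (- N) then of_real (real q powi N) * chi (y * a) else 0)"
proof (cases "y \<in> disc (- N)")
  case True
  have eq: "chi (y * x) = chi (y * a)" if "x \<in> coset a N" for x
  proof -
    have "y * (x - a) \<in> disc (- N + N)" using True that by (intro disc_mult) (auto simp: coset_def)
    then have "chi (y * (x - a)) = 1" by (simp add: chi_disc)
    then have "chi (y * a + y * (x - a)) = chi (y * a)" unfolding chi_add by simp
    then show ?thesis by (simp add: algebra_simps)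
  qed
  have "(\<integral>x. indicator (coset a N) x * chi (y * x) \<partial>\<mu>)
      = (\<integral>x. indicat_real (coset a N) x *\<^sub>R chi (y * a) \<partial>\<mu>)"
  proof (rule Bochner_Integration.integral_cong[OF refl])
    fix x
    show "indicator (coset a N) x * chi (y * x) = indicat_real (coset a N) x *\<^sub>R chi (y * a)"
      using eq[of x] by (cases "x \<in> coset a N") simp_all
  qed
  also have "\<dots> = (\<integral>x. indicat_real (coset a N) x \<partial>\<mu>) *\<^sub>R chi (y * a)"
    by (intro integral_scaleR_left) (simp add: integrable_indicator_iff)
  also have "\<dots> = of_real (real q powi N) * chi (y * a)" by (simp add: scaleR_conv_of_real)
  finally show ?thesis using True by simp
next
  case False
  then obtain z where z: "z \<in> disc N" "chi (y * z) \<noteq> 1" by (rule chi_nontrivial_on_disc)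
  define I where "I = (\<integral>x. indicator (coset a N) x * chi (y * x) \<partial>\<mu>)"
  have mem: "z + x \<in> coset a N \<longleftrightarrow> x \<in> coset a N" for x
    using disc_add_iff[OF z(1), of "x - a"] by (simp add: coset_def algebra_simps)
  have "I = (\<integral>x. indicator (coset a N) (z + x) * chi (y * (z + x)) \<partial>\<mu>)"
    unfolding I_def by (rule integral_translate[symmetric]) measurable
  also have "\<dots> = (\<integral>x. chi (y * z) * (indicator (coset a N) x * chi (y * x)) \<partial>\<mu>)"
    by (intro Bochner_Integration.integral_cong) (auto simp: distrib_left chi_add indicator_def mem)
  also have "\<dots> = chi (y * z) * I" by (simp add: I_def)
  finally have "(1 - chi (y * z)) * I = 0" by (simp add: algebra_simps)
  then show ?thesis using z(2) False by (simp add: I_def)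
qed

text \<open>The field is the sum of the lattice and the ring of integers, and the characters of the latter are indexed by
  the lattice. So these functions, for \<open>l\<close> and \<open>k\<close> in the lattice, form an orthonormal basis that consists of the
  Fourier bases of all cosets of the ring of integers.\<close>
definition gabor :: "'k \<Rightarrow> 'k \<Rightarrow> 'k \<Rightarrow> complex" where
  "gabor l k x = indicator (coset k 0) x * chi (l * x)"

lemma indicator_coset_L2: "(\<lambda>x. indicator (coset a N) x :: complex) \<in> L2 \<mu>"
proof (rule L2_I)
  have "integrable \<mu> (indicat_real (coset a N))" by (simp add: integrable_indicator_iff)
  moreover have "(cmod (indicator (coset a N) x))\<^sup>2 = indicat_real (coset a N) x" for x
    by (simp add: indicator_def)
  ultimately show "integrable \<mu> (\<lambda>x. (cmod (indicator (coset a N) x))\<^sup>2)" by simp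
qed simp

lemma gabor_L2 [simp]: "gabor l k \<in> L2 \<mu>"
proof -
  have "(\<lambda>x. chi (l * x) * indicator (coset k 0) x) \<in> L2 \<mu>"
    by (rule L2_bounded_mult[OF indicator_coset_L2, of _ 1]) auto
  then show ?thesis by (simp add: gabor_def[abs_def] mult.commute)
qed

lemma lat_coset_eq: "l \<in> lat \<Longrightarrow> k \<in> lat \<Longrightarrow> x \<in> coset l 0 \<Longrightarrow> x \<in> coset k 0 \<Longrightarrow> l = k"
  using lat_unique[of l k x] by (simp add: coset_def)

lemma gabor_orthonormal:
  assumes "l \<in> lat" "l' \<in> lat" "k \<in> lat" "k' \<in> lat"
  shows "L2_inner \<mu> (gabor l k) (gabor l' k') = (if l = l' \<and> k = k' then 1 else 0)"
proof (cases "k = k'")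
  case True
  have "L2_inner \<mu> (gabor l k) (gabor l' k') = (\<integral>x. indicator (coset k 0) x * chi ((l - l') * x) \<partial>\<mu>)"
    unfolding L2_inner_def gabor_def True
    by (intro Bochner_Integration.integral_cong) (auto simp: indicator_def left_diff_distrib chi_diff)
  then show ?thesis
    unfolding integral_chi_coset using True assms lat_in_discD[of "l - l'" 0] by (auto simp: lat_diff)
next
  case False
  then have "(\<lambda>x. gabor l k x * cnj (gabor l' k' x)) = (\<lambda>x. 0)"
    using lat_coset_eq[OF assms(3,4)] by (auto simp: gabor_def indicator_def fun_eq_iff)
  then show ?thesis unfolding L2_inner_def using False by (simp only: integral_zero) simp
qed

text \<open>Orthogonality relations in the finite group \<open>disc (-M)/disc 0\<close>, represented by lattice points.\<close>
lemma indicator_coset_eq_sum_chi: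
  assumes "M \<le> 0" "x \<in> coset b 0"
  shows "indicator (coset b M) x = of_real (real q powi M) * (\<Sum>l\<in>lat \<inter> disc (- M). chi (l * (x - b)))"
proof (cases "x \<in> coset b M")
  case True
  have "chi (l * (x - b)) = 1" if "l \<in> disc (- M)" for l
    using disc_mult[of l "- M" "x - b" M] that True by (intro chi_disc) (auto simp: coset_def)
  then have "(\<Sum>l\<in>lat \<inter> disc (- M). chi (l * (x - b))) = of_nat (card (lat \<inter> disc (- M)))" by simp
  also have "card (lat \<inter> disc (- M)) = q ^ nat (- M)" using card_lat_disc[of "nat (- M)"] assms by simp
  finally have sum: "(\<Sum>l\<in>lat \<inter> disc (- M). chi (l * (x - b))) = of_real (real (q ^ nat (- M)))"
    by simp
  have "real (q ^ nat (- M)) = real q powi (- M)" using assms by (simp add: power_int_def)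
  then have "real q powi M * real (q ^ nat (- M)) = 1" by (simp add: power_int_minus)
  then have "of_real (real q powi M) * (\<Sum>l\<in>lat \<inter> disc (- M). chi (l * (x - b))) = 1"
    unfolding sum of_real_mult[symmetric] by (simp only: of_real_1)
  then show ?thesis using True by (simp add: indicator_def)
next
  case False
  then have "x - b \<notin> disc M" by (simp add: coset_def)
  then obtain z where z: "z \<in> disc (- M)" "chi ((x - b) * z) \<noteq> 1"
    using chi_nontrivial_on_disc[of "x - b" "- M"] by auto
  obtain l where l: "l \<in> lat" "z - l \<in> disc 0" using lat_cover by blast
  have l': "l \<in> disc (- M)"
    using disc_diff[OF z(1), of "z - l"] l(2) disc_mono[of 0 "- M"] assms by auto
  have "(z - l) * (x - b) \<in> disc (0 + 0)" using l(2) assms(2) by (intro disc_mult) (auto simp: coset_def)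
  then have "chi ((z - l) * (x - b)) = 1" by (simp add: chi_disc)
  moreover have "chi ((z - l) * (x - b) + l * (x - b)) = chi ((z - l) * (x - b)) * chi (l * (x - b))" by (rule chi_add)
  ultimately have ne: "chi (l * (x - b)) \<noteq> 1" using z(2) by (simp add: algebra_simps)
  let ?A = "lat \<inter> disc (- M)"
  have "(\<Sum>m\<in>?A. chi (m * (x - b))) = (\<Sum>m\<in>?A. chi ((m + l) * (x - b)))"
    using l(1) l' by (intro sum.reindex_bij_witness[of _ "\<lambda>m. m + l" "\<lambda>m. m - l"]) (auto intro: disc_diff)
  also have "\<dots> = chi (l * (x - b)) * (\<Sum>m\<in>?A. chi (m * (x - b)))"
    by (simp only: distrib_right chi_add sum_distrib_left) (intro sum.cong refl mult.commute)
  finally have "(\<Sum>m\<in>?A. chi (m * (x - b))) = 0" using ne by simp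
  then show ?thesis using False by simp
qed

lemma coset_subset_imp_le: "coset b M \<subseteq> coset a N \<Longrightarrow> M \<le> N"
proof -
  assume "coset b M \<subseteq> coset a N"
  then have "emeasure \<mu> (coset b M) \<le> emeasure \<mu> (coset a N)" by (intro emeasure_mono) auto
  then show ?thesis by (simp add: powi_le_iff)
qed

lemma L2_times_indicator: "h \<in> L2 \<mu> \<Longrightarrow> (\<lambda>x. indicator (coset a N) x * h x) \<in> L2 \<mu>"
  by (rule L2_bounded_mult[of h \<mu> _ 1]) (auto simp: indicator_def)

lemma L2_integrable_on_coset: "h \<in> L2 \<mu> \<Longrightarrow> integrable \<mu> (\<lambda>x. indicator (coset a N) x * h x)"
  by (rule L2_integrable_mult[OF indicator_coset_L2])

text \<open>The indicator function of a smaller coset is a linear combination of the given characters, so all integrals of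
  \<open>h\<close> over smaller cosets vanish.\<close>
lemma gabor_total_on_coset:
  assumes h: "integrable \<mu> (\<lambda>x. indicator (coset k 0) x * h x)"
    and zero: "\<And>l. l \<in> lat \<Longrightarrow> (\<integral>x. h x * cnj (gabor l k x) \<partial>\<mu>) = 0"
  shows "AE x in \<mu>. x \<in> coset k 0 \<longrightarrow> h x = 0"
proof (rule AE_zero_on_coset)
  have sc: "indicator A x *\<^sub>R h x = indicator A x * h x" for A x by (simp add: indicator_def)
  show "set_integrable \<mu> (coset k 0) h" using h by (simp add: set_integrable_def sc)
  fix b M assume sub: "coset b M \<subseteq> coset k 0"
  have M: "M \<le> 0" using sub by (rule coset_subset_imp_le)
  have kb: "coset k 0 = coset b 0"
    by (rule coset_eqI[symmetric]) (rule subsetD[OF sub coset_self])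
  have int: "integrable \<mu> (\<lambda>x. h x * cnj (gabor l k x))" for l
  proof (rule Bochner_Integration.integrable_bound[OF h])
    have "(\<lambda>x. (indicator (coset k 0) x * h x) * cnj (chi (l * x))) \<in> borel_measurable \<mu>"
      using borel_measurable_integrable[OF h] by measurable
    also have "(\<lambda>x. (indicator (coset k 0) x * h x) * cnj (chi (l * x))) = (\<lambda>x. h x * cnj (gabor l k x))"
      by (auto simp: gabor_def indicator_def)
    finally show "(\<lambda>x. h x * cnj (gabor l k x)) \<in> borel_measurable \<mu>" .
  qed (auto simp: gabor_def indicator_def norm_mult)
  have "indicator (coset b M) x * h x
      = (\<Sum>l\<in>lat \<inter> disc (- M). of_real (real q powi M) * chi (l * b) * (h x * cnj (gabor l k x)))" for x
  proof (cases "x \<in> coset k 0")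
    case True
    then have x: "x \<in> coset b 0" using kb by simp
    have "indicator (coset b M) x = cnj (indicator (coset b M) x)" by (simp add: indicator_def)
    also have "\<dots> = of_real (real q powi M) * (\<Sum>l\<in>lat \<inter> disc (- M). chi (l * b) * cnj (chi (l * x)))"
      unfolding indicator_coset_eq_sum_chi[OF M x] by (simp add: right_diff_distrib chi_diff mult.commute)
    finally show ?thesis using True
      by (simp add: gabor_def sum_distrib_left sum_distrib_right mult_ac)
  next
    case False
    then show ?thesis using sub by (auto simp: gabor_def indicator_def)
  qed
  then have "(LINT x:coset b M|\<mu>. h x) =
      (\<integral>x. (\<Sum>l\<in>lat \<inter> disc (- M). of_real (real q powi M) * chi (l * b) * (h x * cnj (gabor l k x))) \<partial>\<mu>)"
    by (simp add: set_lebesgue_integral_def sc)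
  also have "\<dots> = (\<Sum>l\<in>lat \<inter> disc (- M). of_real (real q powi M) * chi (l * b) * (\<integral>x. h x * cnj (gabor l k x) \<partial>\<mu>))"
    by (subst Bochner_Integration.integral_sum)
      (auto intro!: Bochner_Integration.integrable_mult_right int simp del: complex_cnj_mult)
  also have "\<dots> = 0" using zero by simp
  finally show "(LINT x:coset b M|\<mu>. h x) = 0" .
qed

lemma gabor_total:
  assumes h: "h \<in> L2 \<mu>" and zero: "\<And>l k. l \<in> lat \<Longrightarrow> k \<in> lat \<Longrightarrow> L2_inner \<mu> h (gabor l k) = 0"
  shows "AE x in \<mu>. h x = 0"
proof (rule AE_lat_cosets)
  fix k assume k: "k \<in> lat"
  show "AE x in \<mu>. x \<in> coset k 0 \<longrightarrow> h x = 0"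
    using zero[OF _ k] unfolding L2_inner_def
    by (intro gabor_total_on_coset L2_integrable_on_coset[OF h])
qed

definition lat_pair :: "nat \<Rightarrow> 'k \<times> 'k" where
  "lat_pair n = map_prod v v (prod_decode n)"

lemma bij_lat_pair: "bij_betw lat_pair UNIV (lat \<times> lat)"
proof -
  have "bij_betw (map_prod v v) (UNIV \<times> UNIV) (lat \<times> lat)"
    using bij_v by (intro bij_betw_map_prod)
  then have "bij_betw (map_prod v v \<circ> prod_decode) UNIV (lat \<times> lat)"
    using bij_betw_trans[OF bij_prod_decode, of "map_prod v v"] by simp
  then show ?thesis by (simp add: lat_pair_def[abs_def] o_def)
qed

definition gabor_seq :: "nat \<Rightarrow> 'k \<Rightarrow> complex" where
  "gabor_seq n = (case lat_pair n of (l, k) \<Rightarrow> gabor l k)"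

lemma lat_pair_mem: "fst (lat_pair n) \<in> lat" "snd (lat_pair n) \<in> lat"
  using bij_lat_pair bij_betwE[of lat_pair UNIV "lat \<times> lat"] by (auto simp: mem_Times_iff)

lemma gabor_seq_L2: "gabor_seq n \<in> L2 \<mu>" by (simp add: gabor_seq_def split: prod.split)

lemma gabor_seq_orthonormal: "L2_inner \<mu> (gabor_seq m) (gabor_seq n) = (if m = n then 1 else 0)"
proof -
  have "lat_pair m = lat_pair n \<longleftrightarrow> m = n"
    using bij_lat_pair by (auto simp: bij_betw_def inj_on_def)
  then show ?thesis unfolding gabor_seq_def case_prod_beta
    by (subst gabor_orthonormal[OF lat_pair_mem(1) lat_pair_mem(1) lat_pair_mem(2) lat_pair_mem(2)])
      (simp add: prod_eq_iff[symmetric])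
qed

lemma lat_pair_surj: "l \<in> lat \<Longrightarrow> k \<in> lat \<Longrightarrow> \<exists>n. lat_pair n = (l, k)"
  using bij_lat_pair unfolding bij_betw_def by (metis SigmaI imageE)

lemma gabor_seq_total:
  assumes "h \<in> L2 \<mu>" "\<And>n. L2_inner \<mu> h (gabor_seq n) = 0"
  shows "AE x in \<mu>. h x = 0"
proof (rule gabor_total[OF assms(1)])
  fix l k assume "l \<in> lat" "k \<in> lat"
  then obtain n where "lat_pair n = (l, k)" using lat_pair_surj by blast
  then show "L2_inner \<mu> h (gabor l k) = 0" using assms(2)[of n] by (simp add: gabor_seq_def)
qed

lemma gabor_Parseval:
  assumes "f \<in> L2 \<mu>"
  shows "((\<lambda>(l, k). (cmod (L2_inner \<mu> f (gabor l k)))\<^sup>2) has_sum (L2_norm \<mu> f)\<^sup>2) (lat \<times> lat)"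
proof -
  have "((\<lambda>n. (cmod (L2_inner \<mu> f (gabor_seq n)))\<^sup>2) has_sum (L2_norm \<mu> f)\<^sup>2) UNIV"
    by (rule L2_Parseval[OF gabor_seq_L2 gabor_seq_orthonormal gabor_seq_total assms])
  then have "((\<lambda>n. (\<lambda>(l, k). (cmod (L2_inner \<mu> f (gabor l k)))\<^sup>2) (lat_pair n)) has_sum (L2_norm \<mu> f)\<^sup>2) UNIV"
    by (simp add: gabor_seq_def case_prod_beta)
  then show ?thesis unfolding has_sum_reindex_bij_betw[OF bij_lat_pair] .
qed

lemma gabor_Parseval_bilinear:
  assumes "f \<in> L2 \<mu>" "g \<in> L2 \<mu>"
  shows "((\<lambda>(l, k). L2_inner \<mu> f (gabor l k) * cnj (L2_inner \<mu> g (gabor l k))) has_sum L2_inner \<mu> f g) (lat \<times> lat)"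
proof -
  have P: "((\<lambda>a. (cmod (L2_inner \<mu> h (gabor (fst a) (snd a))))\<^sup>2) has_sum (L2_norm \<mu> h)\<^sup>2) (lat \<times> lat)"
    if "h \<in> L2 \<mu>" for h using gabor_Parseval[OF that] by (simp add: case_prod_unfold)
  show ?thesis
    using L2_Parseval_bilinear[of "lat \<times> lat" "\<lambda>a. gabor (fst a) (snd a)", OF gabor_L2 P assms]
    by (simp add: case_prod_unfold)
qed

lemma gabor_Riesz_Fischer:
  assumes "(\<lambda>(l, k). (cmod (b l k))\<^sup>2) summable_on (lat \<times> lat)"
  shows "\<exists>f\<in>L2 \<mu>. \<forall>l\<in>lat. \<forall>k\<in>lat. L2_inner \<mu> f (gabor l k) = b l k"
proof -
  define d where "d n = (case lat_pair n of (l, k) \<Rightarrow> b l k)" for n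
  have "(\<lambda>n. (\<lambda>(l, k). (cmod (b l k))\<^sup>2) (lat_pair n)) summable_on UNIV"
    using assms unfolding summable_on_reindex_bij_betw[OF bij_lat_pair] .
  then have "summable (\<lambda>n. (cmod (d n))\<^sup>2)"
    using summable_on_imp_summable by (simp add: d_def case_prod_beta)
  then obtain f where f: "f \<in> L2 \<mu>" "\<And>n. L2_inner \<mu> f (gabor_seq n) = d n"
    using Riesz_Fischer[OF gabor_seq_L2 gabor_seq_orthonormal, of d] by metis
  have "L2_inner \<mu> f (gabor l k) = b l k" if "l \<in> lat" "k \<in> lat" for l k
  proof -
    obtain n where "lat_pair n = (l, k)" using lat_pair_surj \<open>l \<in> lat\<close> \<open>k \<in> lat\<close> by blast
    then show ?thesis using f(2)[of n] by (simp add: gabor_seq_def d_def)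
  qed
  then show ?thesis using f(1) by blast
qed

lemma L2_eqI_gabor:
  assumes "f \<in> L2 \<mu>" "g \<in> L2 \<mu>"
    and "\<And>l k. l \<in> lat \<Longrightarrow> k \<in> lat \<Longrightarrow> L2_inner \<mu> f (gabor l k) = L2_inner \<mu> g (gabor l k)"
  shows "AE x in \<mu>. f x = g x"
proof -
  have "AE x in \<mu>. f x - g x = 0"
    using assms by (intro gabor_total L2_diff) (simp_all add: L2_inner_diff_left)
  then show ?thesis by simp
qed

text \<open>An integral over the whole field is the sum of the integrals over the cosets of the ring of integers.\<close>
lemma lat_integral_has_sum:
  fixes F :: "'k \<Rightarrow> complex"
  assumes F: "integrable \<mu> F"
  shows "(\<lambda>k. \<integral>x. cmod (indicator (coset k 0) x * F x) \<partial>\<mu>) summable_on lat"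
    and "((\<lambda>k. \<integral>x. indicator (coset k 0) x * F x \<partial>\<mu>) has_sum (\<integral>x. F x \<partial>\<mu>)) lat"
proof -
  have int: "integrable \<mu> (\<lambda>x. indicator (coset k 0) x * F x)" for k
  proof (rule Bochner_Integration.integrable_bound[OF F])
    show "(\<lambda>x. indicator (coset k 0) x * F x) \<in> borel_measurable \<mu>"
      using borel_measurable_integrable[OF F] by measurable
  qed (auto simp: indicator_def norm_mult)
  have nint: "integrable \<mu> (\<lambda>x. cmod (indicator (coset k 0) x * F x))" for k
    using int by (rule integrable_norm)
  have bound: "(\<Sum>k\<in>A. \<integral>x. cmod (indicator (coset k 0) x * F x) \<partial>\<mu>) \<le> (\<integral>x. cmod (F x) \<partial>\<mu>)"
    if A: "finite A" "A \<subseteq> lat" for A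
  proof -
    have "(\<Sum>k\<in>A. \<integral>x. cmod (indicator (coset k 0) x * F x) \<partial>\<mu>)
        = (\<integral>x. (\<Sum>k\<in>A. cmod (indicator (coset k 0) x * F x)) \<partial>\<mu>)"
      using nint by (intro Bochner_Integration.integral_sum[symmetric])
    also have "\<dots> \<le> (\<integral>x. cmod (F x) \<partial>\<mu>)"
    proof (rule integral_mono)
      fix x
      show "(\<Sum>k\<in>A. cmod (indicator (coset k 0) x * F x)) \<le> cmod (F x)"
      proof (cases "\<exists>k\<in>A. x \<in> coset k 0")
        case True
        then obtain k where k: "k \<in> A" "x \<in> coset k 0" by blast
        have single: "x \<notin> coset i 0" if "i \<in> A - {k}" for i
          using lat_coset_eq[of i k x] A k that by auto
        have "(\<Sum>k\<in>A. cmod (indicator (coset k 0) x * F x)) = (\<Sum>k\<in>{k}. cmod (indicator (coset k 0) x * F x))"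
          using A k single by (intro sum.mono_neutral_right) simp_all
        then show ?thesis using k by (simp add: indicator_def)
      next
        case False
        then have "(\<Sum>k\<in>A. cmod (indicator (coset k 0) x * F x)) = 0" by (intro sum.neutral) (auto simp: indicator_def)
        then show ?thesis by simp
      qed
    qed (use nint F in auto)
    finally show ?thesis .
  qed
  show s: "(\<lambda>k. \<integral>x. cmod (indicator (coset k 0) x * F x) \<partial>\<mu>) summable_on lat"
    using bound by (intro nonneg_bdd_above_summable_on bdd_aboveI[of _ "\<integral>x. cmod (F x) \<partial>\<mu>"]) auto
  have "(\<Sum>\<^sub>\<infinity>k\<in>lat. indicator (coset k 0) x * F x) = F x" for x
  proof -
    obtain k where k: "k \<in> lat" "x \<in> coset k 0" using lat_cover[of x] by (auto simp: coset_def)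
    have "(\<Sum>\<^sub>\<infinity>k\<in>lat. indicator (coset k 0) x * F x) = (\<Sum>\<^sub>\<infinity>k\<in>{k}. indicator (coset k 0) x * F x)"
      using k lat_coset_eq by (intro infsum_cong_neutral) (auto simp: indicator_def)
    then show ?thesis using k by (simp add: indicator_def)
  qed
  then show "((\<lambda>k. \<integral>x. indicator (coset k 0) x * F x \<partial>\<mu>) has_sum (\<integral>x. F x \<partial>\<mu>)) lat"
    using has_sum_integral(3)[OF countable_lat int s] by simp
qed

end

section \<open>The Fourier transform on square-integrable functions\<close>

context local_field_setup
begin

text \<open>The transform of \<open>gabor l k\<close> is \<open>gabor (- k) l\<close>. This relation between the coefficients of \<open>f\<close> and of
  \<open>g\<close> says that \<open>g\<close> is the transform of \<open>f\<close> up to a null set; existence, isometry and surjectivity are immediate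
  from Parseval's identity and the theorem of Riesz and Fischer.\<close>
definition fourier_coeffs :: "('k \<Rightarrow> complex) \<Rightarrow> ('k \<Rightarrow> complex) \<Rightarrow> bool" where
  "fourier_coeffs f g \<longleftrightarrow> g \<in> L2 \<mu> \<and>
    (\<forall>l\<in>lat. \<forall>k\<in>lat. L2_inner \<mu> g (gabor (- k) l) = L2_inner \<mu> f (gabor l k))"

lemma fourier_coeffsD: "fourier_coeffs f g \<Longrightarrow> l \<in> lat \<Longrightarrow> k \<in> lat \<Longrightarrow>
    L2_inner \<mu> g (gabor k l) = L2_inner \<mu> f (gabor l (- k))"
  unfolding fourier_coeffs_def using lat_minus[of k] by fastforce

lemma fourier_coeffs_L2: "fourier_coeffs f g \<Longrightarrow> g \<in> L2 \<mu>"
  by (simp add: fourier_coeffs_def)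

lemma bij_lat_rotate: "bij_betw (\<lambda>(m, l). (l, - m)) (lat \<times> lat) (lat \<times> lat)"
  by (rule bij_betw_byWitness[where f' = "\<lambda>(l, k). (- k, l)"]) auto

lemma ex_fourier_coeffs: "f \<in> L2 \<mu> \<Longrightarrow> \<exists>g. fourier_coeffs f g"
proof -
  assume f: "f \<in> L2 \<mu>"
  have "(\<lambda>(l, k). (cmod (L2_inner \<mu> f (gabor l k)))\<^sup>2) summable_on (lat \<times> lat)"
    using gabor_Parseval[OF f] by (rule has_sum_imp_summable)
  then have "(\<lambda>x. (\<lambda>(l, k). (cmod (L2_inner \<mu> f (gabor l k)))\<^sup>2) ((\<lambda>(m, l). (l, - m)) x)) summable_on (lat \<times> lat)"
    unfolding summable_on_reindex_bij_betw[OF bij_lat_rotate] .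
  then have "(\<lambda>(m, l). (cmod (L2_inner \<mu> f (gabor l (- m))))\<^sup>2) summable_on (lat \<times> lat)"
    by (simp add: case_prod_unfold)
  then obtain g where "g \<in> L2 \<mu>" "\<forall>m\<in>lat. \<forall>l\<in>lat. L2_inner \<mu> g (gabor m l) = L2_inner \<mu> f (gabor l (- m))"
    using gabor_Riesz_Fischer[of "\<lambda>m l. L2_inner \<mu> f (gabor l (- m))"] by auto
  then have "fourier_coeffs f g" by (auto simp: fourier_coeffs_def)
  then show "\<exists>g. fourier_coeffs f g" by auto
qed

lemma fourier_coeffs_surj: "g \<in> L2 \<mu> \<Longrightarrow> \<exists>f\<in>L2 \<mu>. fourier_coeffs f g"
proof -
  assume g: "g \<in> L2 \<mu>"
  have bij: "bij_betw (\<lambda>(l, k). (- k, l)) (lat \<times> lat) (lat \<times> lat)"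
    by (rule bij_betw_byWitness[where f' = "\<lambda>(m, l). (l, - m)"]) auto
  have "(\<lambda>(l, k). (cmod (L2_inner \<mu> g (gabor l k)))\<^sup>2) summable_on (lat \<times> lat)"
    using gabor_Parseval[OF g] by (rule has_sum_imp_summable)
  then have "(\<lambda>x. (\<lambda>(l, k). (cmod (L2_inner \<mu> g (gabor l k)))\<^sup>2) ((\<lambda>(l, k). (- k, l)) x)) summable_on (lat \<times> lat)"
    unfolding summable_on_reindex_bij_betw[OF bij] .
  then have "(\<lambda>(l, k). (cmod (L2_inner \<mu> g (gabor (- k) l)))\<^sup>2) summable_on (lat \<times> lat)"
    by (simp add: case_prod_unfold)
  then obtain f where "f \<in> L2 \<mu>" "\<forall>l\<in>lat. \<forall>k\<in>lat. L2_inner \<mu> f (gabor l k) = L2_inner \<mu> g (gabor (- k) l)"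
    using gabor_Riesz_Fischer[of "\<lambda>l k. L2_inner \<mu> g (gabor (- k) l)"] by auto
  then have "f \<in> L2 \<mu> \<and> fourier_coeffs f g" using g by (simp add: fourier_coeffs_def)
  then show "\<exists>f\<in>L2 \<mu>. fourier_coeffs f g" by auto
qed

lemma fourier_coeffs_unique: "fourier_coeffs f g \<Longrightarrow> fourier_coeffs f h \<Longrightarrow> AE x in \<mu>. g x = h x"
  by (rule L2_eqI_gabor) (auto simp: fourier_coeffs_L2 fourier_coeffsD)

lemma fourier_coeffs_cong_AE:
  assumes "fourier_coeffs f g" "h \<in> borel_measurable \<mu>" "AE x in \<mu>. g x = h x"
  shows "fourier_coeffs f h"
proof -
  have g: "g \<in> L2 \<mu>" using assms(1) by (rule fourier_coeffs_L2)
  then have h: "h \<in> L2 \<mu>" using assms(2,3) by (rule L2_cong_AE)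
  have "L2_inner \<mu> h (gabor k l) = L2_inner \<mu> g (gabor k l)" for k l
    using assms(3) g h by (intro L2_inner_cong_AE) (auto elim: eventually_mono)
  then show ?thesis using assms(1) h by (simp add: fourier_coeffs_def)
qed

lemma fourier_coeffs_diff:
  assumes "fourier_coeffs f g" "fourier_coeffs f' g'" "f \<in> L2 \<mu>" "f' \<in> L2 \<mu>"
  shows "fourier_coeffs (\<lambda>x. f x - f' x) (\<lambda>x. g x - g' x)"
  using assms by (simp add: fourier_coeffs_def L2_diff L2_inner_diff_left)

lemma fourier_coeffs_inner:
  assumes "fourier_coeffs f g" "fourier_coeffs f' g'" "f \<in> L2 \<mu>" "f' \<in> L2 \<mu>"
  shows "L2_inner \<mu> g g' = L2_inner \<mu> f f'"
proof -
  have "((\<lambda>x. (\<lambda>(l, k). L2_inner \<mu> f (gabor l k) * cnj (L2_inner \<mu> f' (gabor l k))) ((\<lambda>(m, l). (l, - m)) x))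
      has_sum L2_inner \<mu> f f') (lat \<times> lat)"
    unfolding has_sum_reindex_bij_betw[OF bij_lat_rotate] using assms(3,4) by (rule gabor_Parseval_bilinear)
  moreover have "((\<lambda>x. (\<lambda>(l, k). L2_inner \<mu> f (gabor l k) * cnj (L2_inner \<mu> f' (gabor l k))) ((\<lambda>(m, l). (l, - m)) x))
      has_sum L2_inner \<mu> f f') (lat \<times> lat) \<longleftrightarrow>
      ((\<lambda>(m, l). L2_inner \<mu> g (gabor m l) * cnj (L2_inner \<mu> g' (gabor m l))) has_sum L2_inner \<mu> f f') (lat \<times> lat)"
    by (rule has_sum_cong) (auto simp: fourier_coeffsD[OF assms(1)] fourier_coeffsD[OF assms(2)])
  ultimately have "((\<lambda>(m, l). L2_inner \<mu> g (gabor m l) * cnj (L2_inner \<mu> g' (gabor m l))) has_sum L2_inner \<mu> f f') (lat \<times> lat)"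
    by simp
  moreover have "((\<lambda>(m, l). L2_inner \<mu> g (gabor m l) * cnj (L2_inner \<mu> g' (gabor m l))) has_sum L2_inner \<mu> g g') (lat \<times> lat)"
    by (rule gabor_Parseval_bilinear[OF fourier_coeffs_L2[OF assms(1)] fourier_coeffs_L2[OF assms(2)]])
  ultimately show ?thesis by (rule has_sum_unique[symmetric])
qed

lemma L2_norm_eqI_inner: "L2_inner M f f = L2_inner M' g g \<Longrightarrow> L2_norm M f = L2_norm M' g"
  unfolding L2_inner_self of_real_eq_iff by (simp add: power2_eq_iff_nonneg)

lemma fourier_coeffs_norm: "fourier_coeffs f g \<Longrightarrow> f \<in> L2 \<mu> \<Longrightarrow> L2_norm \<mu> g = L2_norm \<mu> f"
  by (rule L2_norm_eqI_inner) (rule fourier_coeffs_inner)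

subsection \<open>Integrable functions\<close>

lemma integrable_mult_chi:
  "integrable \<mu> F \<Longrightarrow> integrable \<mu> (\<lambda>x. F x * cnj (chi (y * x)))"
proof (rule Bochner_Integration.integrable_bound)
  assume "integrable \<mu> F"
  then have [measurable]: "F \<in> borel_measurable \<mu>" by simp
  show "(\<lambda>x. F x * cnj (chi (y * x))) \<in> borel_measurable \<mu>" by measurable
qed (auto simp: norm_mult)

text \<open>The transform of an integrable function is continuous by dominated convergence.\<close>
lemma fourier_L1_measurable:
  assumes F: "integrable \<mu> F"
  shows "fourier_L1 chi \<mu> F \<in> borel_measurable borel"
proof (rule borel_measurable_continuous_onI)
  have [measurable]: "F \<in> borel_measurable \<mu>" using F by simp
  have chi_cont: "continuous_on UNIV chi" using character by (simp add: additive_character_def)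
  show "continuous_on UNIV (fourier_L1 chi \<mu> F)"
    unfolding continuous_on_sequentially
  proof (intro allI ballI impI, elim conjE)
    fix X and a :: 'k assume X: "X \<longlonglongrightarrow> a"
    show "(fourier_L1 chi \<mu> F \<circ> X) \<longlonglongrightarrow> fourier_L1 chi \<mu> F a"
      unfolding fourier_L1_def o_def
    proof (rule integral_dominated_convergence[where w = "\<lambda>x. cmod (F x)"])
      show "AE x in \<mu>. (\<lambda>n. F x * cnj (chi (X n * x))) \<longlonglongrightarrow> F x * cnj (chi (a * x))"
      proof (rule AE_I2)
        fix x
        have "continuous_on UNIV (\<lambda>y. chi (x * y))"
          using continuous_on_compose2[OF chi_cont continuous_on_mult_field[of UNIV x]] by simp
        then have "(\<lambda>n. chi (x * X n)) \<longlonglongrightarrow> chi (x * a)"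
          using X by (auto intro: continuous_on_tendsto_compose)
        then show "(\<lambda>n. F x * cnj (chi (X n * x))) \<longlonglongrightarrow> F x * cnj (chi (a * x))"
          by (intro tendsto_intros) (simp add: mult.commute)
      qed
    qed (use F in \<open>auto simp: norm_mult\<close>)
  qed
qed

text \<open>The product of the fractional parts \<open>l\<close> and \<open>k\<close> and the product of the integral parts do not contribute.\<close>
lemma chi_on_cosets:
  assumes "l \<in> lat" "k \<in> lat" "\<xi> \<in> coset l 0" "x \<in> coset k 0"
  shows "chi (\<xi> * x) = chi (l * x) * chi (k * \<xi>)"
proof -
  have "(\<xi> - l) * (x - k) \<in> disc (0 + 0)" using assms by (intro disc_mult) (auto simp: coset_def)
  then have "chi ((\<xi> - l) * (x - k)) = 1" by (simp add: chi_disc)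
  moreover have "\<xi> * x = (\<xi> - l) * (x - k) + (l * x + (k * \<xi> - l * k))" by (simp add: algebra_simps)
  then have "chi (\<xi> * x) = chi ((\<xi> - l) * (x - k)) * (chi (l * x) * (chi (k * \<xi>) * cnj (chi (l * k))))"
    by (simp only: chi_add chi_diff)
  ultimately show ?thesis using assms(1,2) by (simp add: chi_lat)
qed

text \<open>On each coset of the ring of integers the transform of an integrable function is an absolutely
  convergent Fourier series, whose coefficients are Gabor coefficients of the function.\<close>
lemma fourier_L1_series:
  assumes F: "integrable \<mu> F" and l: "l \<in> lat"
  shows "(\<lambda>k. cmod (\<integral>x. F x * cnj (gabor l k x) \<partial>\<mu>)) summable_on lat"
    and "\<xi> \<in> coset l 0 \<Longrightarrow>
      ((\<lambda>k. cnj (chi (k * \<xi>)) * (\<integral>x. F x * cnj (gabor l k x) \<partial>\<mu>)) has_sum fourier_L1 chi \<mu> F \<xi>) lat"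
proof -
  have "cmod (\<integral>x. F x * cnj (gabor l k x) \<partial>\<mu>) \<le> (\<integral>x. cmod (indicator (coset k 0) x * F x) \<partial>\<mu>)" for k
  proof -
    have "cmod (\<integral>x. F x * cnj (gabor l k x) \<partial>\<mu>) \<le> (\<integral>x. cmod (F x * cnj (gabor l k x)) \<partial>\<mu>)"
      by (rule integral_norm_bound)
    also have "\<dots> = (\<integral>x. cmod (indicator (coset k 0) x * F x) \<partial>\<mu>)"
      by (intro Bochner_Integration.integral_cong) (auto simp: norm_mult gabor_def)
    finally show ?thesis .
  qed
  then show "(\<lambda>k. cmod (\<integral>x. F x * cnj (gabor l k x) \<partial>\<mu>)) summable_on lat"
    using lat_integral_has_sum(1)[OF F] by (rule_tac summable_on_comparison_test) auto
  assume \<xi>: "\<xi> \<in> coset l 0"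
  have eq: "(\<integral>x. indicator (coset k 0) x * (F x * cnj (chi (\<xi> * x))) \<partial>\<mu>)
      = cnj (chi (k * \<xi>)) * (\<integral>x. F x * cnj (gabor l k x) \<partial>\<mu>)" if "k \<in> lat" for k
  proof -
    have "(\<integral>x. indicator (coset k 0) x * (F x * cnj (chi (\<xi> * x))) \<partial>\<mu>)
      = (\<integral>x. cnj (chi (k * \<xi>)) * (F x * cnj (gabor l k x)) \<partial>\<mu>)"
    proof (rule Bochner_Integration.integral_cong[OF refl])
      fix x
      show "indicator (coset k 0) x * (F x * cnj (chi (\<xi> * x))) = cnj (chi (k * \<xi>)) * (F x * cnj (gabor l k x))"
        using chi_on_cosets[OF l that \<xi>, of x] by (cases "x \<in> coset k 0") (simp_all add: gabor_def)
    qed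
    then show ?thesis by simp
  qed
  show "((\<lambda>k. cnj (chi (k * \<xi>)) * (\<integral>x. F x * cnj (gabor l k x) \<partial>\<mu>)) has_sum fourier_L1 chi \<mu> F \<xi>) lat"
    unfolding fourier_L1_def
    by (rule has_sum_cong[THEN iffD1, OF eq lat_integral_has_sum(2)[OF integrable_mult_chi[OF F]]])
qed

lemma cmod_fourier_L1_le: "cmod (fourier_L1 chi \<mu> F \<xi>) \<le> (\<integral>x. cmod (F x) \<partial>\<mu>)"
  unfolding fourier_L1_def using integral_norm_bound[of \<mu> "\<lambda>x. F x * cnj (chi (\<xi> * x))"] by (simp add: norm_mult)

lemma fourier_L1_coeff:
  assumes F: "integrable \<mu> F" and l: "l \<in> lat" and k: "k \<in> lat"
  shows "(\<integral>\<xi>. fourier_L1 chi \<mu> F \<xi> * cnj (gabor (- k) l \<xi>) \<partial>\<mu>) = (\<integral>x. F x * cnj (gabor l k x) \<partial>\<mu>)"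
proof -
  define b where "b k' = (\<integral>x. F x * cnj (gabor l k' x) \<partial>\<mu>)" for k'
  define f where "f k' \<xi> = b k' * (gabor (- k') l \<xi> * cnj (gabor (- k) l \<xi>))" for k' \<xi>
  have f_eq: "f k' \<xi> = b k' * (indicator (coset l 0) \<xi> * (cnj (chi (k' * \<xi>)) * chi (k * \<xi>)))" for k' \<xi>
    by (simp add: f_def gabor_def chi_minus indicator_def)
  have int: "integrable \<mu> (f k')" for k'
    unfolding f_def by (intro Bochner_Integration.integrable_mult_right L2_integrable_mult_cnj) simp_all
  have "(\<integral>\<xi>. cmod (f k' \<xi>) \<partial>\<mu>) = cmod (b k')" for k'
  proof -
    have "(\<integral>\<xi>. cmod (f k' \<xi>) \<partial>\<mu>) = (\<integral>\<xi>. cmod (b k') * indicat_real (coset l 0) \<xi> \<partial>\<mu>)"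
      by (intro Bochner_Integration.integral_cong) (auto simp: f_eq norm_mult indicator_def)
    then show ?thesis by simp
  qed
  then have s: "(\<lambda>k'. \<integral>\<xi>. cmod (f k' \<xi>) \<partial>\<mu>) summable_on lat"
    using fourier_L1_series(1)[OF F l] by (simp add: b_def)
  have "(\<Sum>\<^sub>\<infinity>k'\<in>lat. f k' \<xi>) = fourier_L1 chi \<mu> F \<xi> * cnj (gabor (- k) l \<xi>)" for \<xi>
  proof (cases "\<xi> \<in> coset l 0")
    case True
    have "((\<lambda>k'. (cnj (chi (k' * \<xi>)) * b k') * chi (k * \<xi>)) has_sum fourier_L1 chi \<mu> F \<xi> * chi (k * \<xi>)) lat"
      unfolding b_def by (intro has_sum_cmult_left fourier_L1_series(2)[OF F l True])
    then have "(\<Sum>\<^sub>\<infinity>k'\<in>lat. (cnj (chi (k' * \<xi>)) * b k') * chi (k * \<xi>)) = fourier_L1 chi \<mu> F \<xi> * chi (k * \<xi>)"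
      by (rule infsumI)
    moreover have "f k' \<xi> = (cnj (chi (k' * \<xi>)) * b k') * chi (k * \<xi>)" for k'
      using True by (simp add: f_eq mult_ac)
    ultimately show ?thesis using True by (simp add: gabor_def chi_minus)
  next
    case False
    then show ?thesis by (simp add: f_eq gabor_def)
  qed
  then have "((\<lambda>k'. \<integral>\<xi>. f k' \<xi> \<partial>\<mu>) has_sum (\<integral>\<xi>. fourier_L1 chi \<mu> F \<xi> * cnj (gabor (- k) l \<xi>) \<partial>\<mu>)) lat"
    using has_sum_integral(3)[OF countable_lat int s] by simp
  moreover have "(\<integral>\<xi>. f k' \<xi> \<partial>\<mu>) = (if k' = k then b k else 0)" if "k' \<in> lat" for k'
  proof -
    have "(\<integral>\<xi>. f k' \<xi> \<partial>\<mu>) = b k' * L2_inner \<mu> (gabor (- k') l) (gabor (- k) l)"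
      by (simp add: f_def L2_inner_def)
    then show ?thesis using that k l by (simp add: gabor_orthonormal)
  qed
  then have "((\<lambda>k'. \<integral>\<xi>. f k' \<xi> \<partial>\<mu>) has_sum b k) lat"
    using k by (intro has_sum_finite_neutralI[of "{k}"]) auto
  ultimately show ?thesis unfolding b_def by (rule has_sum_unique)
qed

text \<open>Compare the integral transform on each coset of the ring of integers with the function that has the exchanged
  coefficients. In particular this proves that the integral transform is square-integrable.\<close>
lemma fourier_L1_coeffs:
  assumes F: "integrable \<mu> F" and F2: "F \<in> L2 \<mu>"
  shows "fourier_coeffs F (fourier_L1 chi \<mu> F)"
proof -
  obtain g where g: "fourier_coeffs F g" using ex_fourier_coeffs[OF F2] by blast
  then have g2: "g \<in> L2 \<mu>" by (rule fourier_coeffs_L2)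
  have meas [measurable]: "fourier_L1 chi \<mu> F \<in> borel_measurable \<mu>" using fourier_L1_measurable[OF F] by simp
  have "AE \<xi> in \<mu>. g \<xi> - fourier_L1 chi \<mu> F \<xi> = 0"
  proof (rule AE_lat_cosets)
    fix l assume l: "l \<in> lat"
    have loc: "integrable \<mu> (\<lambda>\<xi>. indicator (coset l 0) \<xi> * fourier_L1 chi \<mu> F \<xi>)"
    proof (rule Bochner_Integration.integrable_bound)
      show "integrable \<mu> (\<lambda>\<xi>. (\<integral>x. cmod (F x) \<partial>\<mu>) * indicat_real (coset l 0) \<xi>)"
        by (intro Bochner_Integration.integrable_mult_right) (simp add: integrable_indicator_iff)
      show "AE \<xi> in \<mu>. cmod (indicator (coset l 0) \<xi> * fourier_L1 chi \<mu> F \<xi>)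
          \<le> norm ((\<integral>x. cmod (F x) \<partial>\<mu>) * indicat_real (coset l 0) \<xi>)"
        using cmod_fourier_L1_le[of F] by (intro AE_I2) (auto simp: indicator_def)
    qed measurable
    have int: "integrable \<mu> (\<lambda>\<xi>. fourier_L1 chi \<mu> F \<xi> * cnj (gabor m l \<xi>))" for m
    proof -
      have "integrable \<mu> (\<lambda>\<xi>. (indicator (coset l 0) \<xi> * fourier_L1 chi \<mu> F \<xi>) * cnj (chi (m * \<xi>)))"
        using loc by (rule integrable_mult_chi)
      also have "(\<lambda>\<xi>. (indicator (coset l 0) \<xi> * fourier_L1 chi \<mu> F \<xi>) * cnj (chi (m * \<xi>)))
          = (\<lambda>\<xi>. fourier_L1 chi \<mu> F \<xi> * cnj (gabor m l \<xi>))"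
        by (auto simp: gabor_def indicator_def fun_eq_iff)
      finally show ?thesis .
    qed
    show "AE \<xi> in \<mu>. \<xi> \<in> coset l 0 \<longrightarrow> g \<xi> - fourier_L1 chi \<mu> F \<xi> = 0"
    proof (rule gabor_total_on_coset)
      show "integrable \<mu> (\<lambda>\<xi>. indicator (coset l 0) \<xi> * (g \<xi> - fourier_L1 chi \<mu> F \<xi>))"
        using Bochner_Integration.integrable_diff[OF L2_integrable_on_coset[OF g2, of l 0] loc]
        by (simp add: right_diff_distrib)
      fix m assume m: "m \<in> lat"
      have "(\<integral>\<xi>. (g \<xi> - fourier_L1 chi \<mu> F \<xi>) * cnj (gabor m l \<xi>) \<partial>\<mu>)
          = L2_inner \<mu> g (gabor m l) - (\<integral>\<xi>. fourier_L1 chi \<mu> F \<xi> * cnj (gabor m l \<xi>) \<partial>\<mu>)"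
        unfolding left_diff_distrib L2_inner_def
        by (rule Bochner_Integration.integral_diff[OF L2_integrable_mult_cnj[OF g2 gabor_L2] int])
      also have "\<dots> = 0"
        using fourier_L1_coeff[OF F l lat_minus[OF m]] fourier_coeffsD[OF g l m] by (simp add: L2_inner_def)
      finally show "(\<integral>\<xi>. (g \<xi> - fourier_L1 chi \<mu> F \<xi>) * cnj (gabor m l \<xi>) \<partial>\<mu>) = 0" .
    qed
  qed
  then have "AE \<xi> in \<mu>. g \<xi> = fourier_L1 chi \<mu> F \<xi>" by simp
  then show ?thesis by (rule fourier_coeffs_cong_AE[OF g meas])
qed

subsection \<open>The transform\<close>

definition truncate :: "('k \<Rightarrow> complex) \<Rightarrow> nat \<Rightarrow> 'k \<Rightarrow> complex" where
  "truncate f m x = indicator (disc (int m)) x * f x"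

lemma truncate_L2: "f \<in> L2 \<mu> \<Longrightarrow> truncate f m \<in> L2 \<mu>"
  using L2_times_indicator[of f 0 "int m"] by (simp add: truncate_def[abs_def] coset_0)

lemma truncate_integrable: "f \<in> L2 \<mu> \<Longrightarrow> integrable \<mu> (truncate f m)"
  using L2_integrable_on_coset[of f 0 "int m"] by (simp add: truncate_def[abs_def] coset_0)

lemma L2_norm_tendsto_0_dominated:
  assumes h: "\<And>m. h m \<in> borel_measurable M" and f: "f \<in> L2 M"
    and le: "\<And>m x. cmod (h m x) \<le> cmod (f x)" and lim: "\<And>x. (\<lambda>m. h m x) \<longlonglongrightarrow> 0"
  shows "(\<lambda>m. L2_norm M (h m)) \<longlonglongrightarrow> 0"
proof -
  have "(\<lambda>m. \<integral>x. (cmod (h m x))\<^sup>2 \<partial>M) \<longlonglongrightarrow> (\<integral>x. 0 \<partial>M)"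
  proof (rule integral_dominated_convergence[where w = "\<lambda>x. (cmod (f x))\<^sup>2"])
    show "AE x in M. (\<lambda>m. (cmod (h m x))\<^sup>2) \<longlonglongrightarrow> 0"
      using tendsto_power[OF tendsto_norm_zero[OF lim], of _ 2] by simp
    show "AE x in M. norm ((cmod (h m x))\<^sup>2) \<le> (cmod (f x))\<^sup>2" for m
      using le by (auto intro!: power_mono)
  qed (use h f in auto)
  then have "(\<lambda>m. sqrt (\<integral>x. (cmod (h m x))\<^sup>2 \<partial>M)) \<longlonglongrightarrow> sqrt 0" by (intro tendsto_real_sqrt) simp
  then show ?thesis by (simp add: L2_norm_def)
qed

lemma truncate_tendsto: "f \<in> L2 \<mu> \<Longrightarrow> (\<lambda>m. L2_norm \<mu> (\<lambda>x. truncate f m x - f x)) \<longlonglongrightarrow> 0"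
proof (rule L2_norm_tendsto_0_dominated)
  fix x
  obtain n where n: "x \<in> disc (int n)" using ex_disc by blast
  have "x \<in> disc (int m)" if "m \<ge> n" for m using n disc_mono[of "int n" "int m"] that by auto
  then have "truncate f m x - f x = 0" if "m \<ge> n" for m using that by (simp add: truncate_def)
  then show "(\<lambda>m. truncate f m x - f x) \<longlonglongrightarrow> 0"
    by (intro tendsto_eventually) (auto simp: eventually_at_top_linorder)
qed (auto simp: truncate_def indicator_def intro: L2_measurable L2_diff truncate_L2)

text \<open>The limit property that defines the transform holds for the function with the exchanged Gabor
  coefficients, so the transform has these coefficients.\<close>
lemma fourier_limit_property:
  assumes f: "f \<in> L2 \<mu>" and g: "fourier_coeffs f g"
    and F: "\<And>m. integrable \<mu> (F m) \<and> F m \<in> L2 \<mu>" "(\<lambda>m. L2_norm \<mu> (\<lambda>x. F m x - f x)) \<longlonglongrightarrow> 0"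
  shows "(\<forall>m. fourier_L1 chi \<mu> (F m) \<in> L2 \<mu>) \<and>
    (\<lambda>m. L2_norm \<mu> (\<lambda>\<xi>. fourier_L1 chi \<mu> (F m) \<xi> - g \<xi>)) \<longlonglongrightarrow> 0"
proof -
  have "fourier_coeffs (F m) (fourier_L1 chi \<mu> (F m))" for m using F by (intro fourier_L1_coeffs) auto
  then have "fourier_L1 chi \<mu> (F m) \<in> L2 \<mu>"
      "L2_norm \<mu> (\<lambda>\<xi>. fourier_L1 chi \<mu> (F m) \<xi> - g \<xi>) = L2_norm \<mu> (\<lambda>x. F m x - f x)" for m
    using F(1) f g by (auto intro: fourier_coeffs_L2 fourier_coeffs_norm fourier_coeffs_diff L2_diff)
  then show ?thesis using F(2) by simp
qed

theorem fourier_coeffs_fourier: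
  assumes f: "f \<in> L2 \<mu>"
  shows "fourier_coeffs f (fourier chi \<mu> f)"
proof -
  define P where "P g \<longleftrightarrow> g \<in> L2 \<mu> \<and>
    (\<forall>F :: nat \<Rightarrow> 'k \<Rightarrow> complex.
      (\<forall>m. integrable \<mu> (F m) \<and> F m \<in> L2 \<mu>) \<longrightarrow>
      (\<lambda>m. L2_norm \<mu> (\<lambda>x. F m x - f x)) \<longlonglongrightarrow> 0 \<longrightarrow>
      (\<forall>m. fourier_L1 chi \<mu> (F m) \<in> L2 \<mu>) \<and>
      (\<lambda>m. L2_norm \<mu> (\<lambda>\<xi>. fourier_L1 chi \<mu> (F m) \<xi> - g \<xi>)) \<longlonglongrightarrow> 0)" for g
  obtain g where g: "fourier_coeffs f g" using ex_fourier_coeffs[OF f] by blast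
  have "P g" unfolding P_def using fourier_coeffs_L2[OF g] fourier_limit_property[OF f g] by simp
  moreover have "fourier chi \<mu> f = (SOME g. P g)" unfolding P_def fourier_def ..
  ultimately have P: "P (fourier chi \<mu> f)" using someI[of P g] by simp
  have T: "\<forall>m. integrable \<mu> (truncate f m) \<and> truncate f m \<in> L2 \<mu>"
    using f by (simp add: truncate_L2 truncate_integrable)
  have "AE \<xi> in \<mu>. g \<xi> = fourier chi \<mu> f \<xi>"
  proof (rule L2_limit_unique[of "\<lambda>m. fourier_L1 chi \<mu> (truncate f m)"])
    show "fourier_L1 chi \<mu> (truncate f m) \<in> L2 \<mu>" for m
      using fourier_limit_property[OF f g, of "truncate f"] T truncate_tendsto[OF f] by auto
    show "(\<lambda>m. L2_norm \<mu> (\<lambda>\<xi>. fourier_L1 chi \<mu> (truncate f m) \<xi> - g \<xi>)) \<longlonglongrightarrow> 0"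
      using fourier_limit_property[OF f g, of "truncate f"] T truncate_tendsto[OF f] by auto
    show "(\<lambda>m. L2_norm \<mu> (\<lambda>\<xi>. fourier_L1 chi \<mu> (truncate f m) \<xi> - fourier chi \<mu> f \<xi>)) \<longlonglongrightarrow> 0"
      using P[unfolded P_def, THEN conjunct2, rule_format, of "truncate f"] T truncate_tendsto[OF f] by auto
    show "g \<in> L2 \<mu>" using g by (rule fourier_coeffs_L2)
    show "fourier chi \<mu> f \<in> L2 \<mu>" using P by (simp add: P_def)
  qed
  then show ?thesis using P by (intro fourier_coeffs_cong_AE[OF g]) (auto simp: P_def)
qed

lemma fourier_L2 [simp]: "f \<in> L2 \<mu> \<Longrightarrow> fourier chi \<mu> f \<in> L2 \<mu>"
  by (rule fourier_coeffs_L2[OF fourier_coeffs_fourier])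

theorem Plancherel:
  "f \<in> L2 \<mu> \<Longrightarrow> g \<in> L2 \<mu> \<Longrightarrow> L2_inner \<mu> (fourier chi \<mu> f) (fourier chi \<mu> g) = L2_inner \<mu> f g"
  by (rule fourier_coeffs_inner[OF fourier_coeffs_fourier fourier_coeffs_fourier])

lemma L2_norm_fourier: "f \<in> L2 \<mu> \<Longrightarrow> L2_norm \<mu> (fourier chi \<mu> f) = L2_norm \<mu> f"
  by (rule fourier_coeffs_norm[OF fourier_coeffs_fourier])

lemma fourier_surj:
  assumes "g \<in> L2 \<mu>" obtains f where "f \<in> L2 \<mu>" "AE \<xi> in \<mu>. fourier chi \<mu> f \<xi> = g \<xi>"
  using fourier_coeffs_surj[OF assms] fourier_coeffs_unique fourier_coeffs_fourier by metis

lemma fourier_eq_fourier_L1: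
  "integrable \<mu> F \<Longrightarrow> F \<in> L2 \<mu> \<Longrightarrow> AE \<xi> in \<mu>. fourier chi \<mu> F \<xi> = fourier_L1 chi \<mu> F \<xi>"
  by (rule fourier_coeffs_unique[OF fourier_coeffs_fourier fourier_L1_coeffs])

lemma fourier_tendsto:
  assumes "\<And>m. F m \<in> L2 \<mu>" "f \<in> L2 \<mu>" "(\<lambda>m. L2_norm \<mu> (\<lambda>x. F m x - f x)) \<longlonglongrightarrow> 0"
  shows "(\<lambda>m. L2_norm \<mu> (\<lambda>\<xi>. fourier chi \<mu> (F m) \<xi> - fourier chi \<mu> f \<xi>)) \<longlonglongrightarrow> 0"
proof -
  have "L2_norm \<mu> (\<lambda>\<xi>. fourier chi \<mu> (F m) \<xi> - fourier chi \<mu> f \<xi>) = L2_norm \<mu> (\<lambda>x. F m x - f x)" for m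
    using assms(1,2)
    by (intro fourier_coeffs_norm fourier_coeffs_diff fourier_coeffs_fourier L2_diff)
  then show ?thesis using assms(3) by simp
qed

subsection \<open>Dilations and translations\<close>

abbreviation D :: "int \<Rightarrow> ('k \<Rightarrow> complex) \<Rightarrow> 'k \<Rightarrow> complex" where "D \<equiv> dilation q \<pp>"
abbreviation T :: "nat \<Rightarrow> ('k \<Rightarrow> complex) \<Rightarrow> 'k \<Rightarrow> complex" where "T \<equiv> translation v"

lemma powr_half_square: "(real q powr (real_of_int j / 2))\<^sup>2 = real q powi j"
proof -
  have "(real q powr (real_of_int j / 2))\<^sup>2 = real q powr (real_of_int j / 2 + real_of_int j / 2)"
    by (simp only: power2_eq_square powr_add)
  then show ?thesis by (simp add: powr_real_of_int')
qed

lemma dilation_inner: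
  assumes "f \<in> borel_measurable \<mu>" "g \<in> borel_measurable \<mu>"
  shows "L2_inner \<mu> (D j f) (D j g) = L2_inner \<mu> f g"
proof -
  have [measurable]: "f \<in> borel_measurable borel" "g \<in> borel_measurable borel" using assms by simp_all
  let ?s = "complex_of_real (real q powr (real_of_int j / 2))"
  have ss: "?s * ?s = of_real (real q powi j)"
    using powr_half_square[of j] by (simp add: power2_eq_square flip: of_real_mult)
  have "L2_inner \<mu> (D j f) (D j g)
      = (\<integral>x. (?s * ?s) * (f (\<pp> powi (- j) * x) * cnj (g (\<pp> powi (- j) * x))) \<partial>\<mu>)"
    unfolding L2_inner_def dilation_def
    by (intro Bochner_Integration.integral_cong) (auto simp: mult_ac)
  also have "\<dots> = of_real (real q powi j) * (real q powi (- j) *\<^sub>R L2_inner \<mu> f g)"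
    unfolding ss L2_inner_def
    by (subst integral_mult_right_zero, subst integral_dilate) simp_all
  also have "\<dots> = L2_inner \<mu> f g"
    by (simp add: scaleR_conv_of_real mult.assoc[symmetric] power_int_minus flip: of_real_mult)
  finally show ?thesis .
qed

lemma dilation_norm: "f \<in> borel_measurable \<mu> \<Longrightarrow> L2_norm \<mu> (D j f) = L2_norm \<mu> f"
  by (rule L2_norm_eqI_inner) (rule dilation_inner)

lemma dilation_measurable: "f \<in> borel_measurable \<mu> \<Longrightarrow> D j f \<in> borel_measurable \<mu>"
  unfolding dilation_def[abs_def]
  by (intro borel_measurable_times borel_measurable_const measurable_comp_dilate)

lemma dilation_L2 [simp]: "f \<in> L2 \<mu> \<Longrightarrow> D j f \<in> L2 \<mu>"
proof (rule L2_I)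
  assume f: "f \<in> L2 \<mu>"
  then show "D j f \<in> borel_measurable \<mu>" by (intro dilation_measurable L2_measurable)
  have "integrable \<mu> (\<lambda>x. (real q powr (real_of_int j / 2))\<^sup>2 * (cmod (f (\<pp> powi (- j) * x)))\<^sup>2)"
    using integrable_dilate[OF L2_integrable_square[OF f], of "- j"] by (rule Bochner_Integration.integrable_mult_right)
  then show "integrable \<mu> (\<lambda>x. (cmod (D j f x))\<^sup>2)"
    by (simp add: dilation_def norm_mult power_mult_distrib)
qed

lemma dilation_diff: "D j (\<lambda>x. f x - g x) = (\<lambda>x. D j f x - D j g x)"
  by (simp add: dilation_def right_diff_distrib fun_eq_iff)

lemma translation_L2 [simp]: "f \<in> L2 \<mu> \<Longrightarrow> T k f \<in> L2 \<mu>"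
proof (rule L2_I)
  assume f: "f \<in> L2 \<mu>"
  have eq: "T k h x = h (- v k + x)" for h x by (simp add: translation_def)
  show "T k f \<in> borel_measurable \<mu>"
    unfolding eq[abs_def] using f by (intro measurable_comp_translate L2_measurable)
  show "integrable \<mu> (\<lambda>x. (cmod (T k f x))\<^sup>2)"
    unfolding eq using f integrable_translate[OF L2_integrable_square] by blast
qed

text \<open>A dilation does not permute the Gabor basis. For integrable functions the formula is a change of variables,
  and truncations carry it over to the limit.\<close>
lemma fourier_dilation:
  assumes f: "f \<in> L2 \<mu>"
  shows "AE \<xi> in \<mu>. fourier chi \<mu> (D j f) \<xi> = D (- j) (fourier chi \<mu> f) \<xi>"
proof (rule L2_limit_unique[of "\<lambda>m. fourier chi \<mu> (D j (truncate f m))"])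
  have t: "truncate f m \<in> L2 \<mu>" "integrable \<mu> (truncate f m)" for m
    using f by (simp_all add: truncate_L2 truncate_integrable)
  have L1: "fourier_L1 chi \<mu> (D j F) \<xi> = D (- j) (fourier_L1 chi \<mu> F) \<xi>" if F: "integrable \<mu> F" for F \<xi>
  proof -
    have [measurable]: "F \<in> borel_measurable borel" using borel_measurable_integrable[OF F] by simp
    let ?s = "complex_of_real (real q powr (real_of_int j / 2))"
    have chi_arg: "\<xi> * x = (\<pp> powi j * \<xi>) * (\<pp> powi (- j) * x)" for x
      by (simp add: power_int_minus)
    have "fourier_L1 chi \<mu> (D j F) \<xi>
      = (\<integral>x. ?s * (F (\<pp> powi (- j) * x) * cnj (chi ((\<pp> powi j * \<xi>) * (\<pp> powi (- j) * x)))) \<partial>\<mu>)"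
      unfolding fourier_L1_def dilation_def by (subst chi_arg) (simp add: mult.assoc)
    also have "\<dots> = ?s * (real q powi (- j) *\<^sub>R fourier_L1 chi \<mu> F (\<pp> powi j * \<xi>))"
      unfolding fourier_L1_def
      by (subst integral_mult_right_zero, subst integral_dilate) simp_all
    also have "\<dots> = of_real (real q powr (real_of_int j / 2) * real q powi (- j)) * fourier_L1 chi \<mu> F (\<pp> powi j * \<xi>)"
      by (simp add: scaleR_conv_of_real mult.assoc)
    also have "real q powr (real_of_int j / 2) * real q powi (- j) = real q powr (real_of_int (- j) / 2)"
    proof -
      have "real q powi (- j) = real q powr (real_of_int (- j))" by (rule powr_real_of_int'[symmetric]) simp_all
      then show ?thesis by (simp flip: powr_add)
    qed
    finally have "fourier_L1 chi \<mu> (D j F) \<xi>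
      = of_real (real q powr (real_of_int (- j) / 2)) * fourier_L1 chi \<mu> F (\<pp> powi j * \<xi>)" .
    then show ?thesis unfolding dilation_def[of _ _ "- j"] minus_minus .
  qed
  have int: "integrable \<mu> (D j (truncate f m))" for m
    unfolding dilation_def[abs_def]
    by (intro Bochner_Integration.integrable_mult_right integrable_dilate t)
  show "fourier chi \<mu> (D j (truncate f m)) \<in> L2 \<mu>" for m using t by simp
  show "fourier chi \<mu> (D j f) \<in> L2 \<mu>" "D (- j) (fourier chi \<mu> f) \<in> L2 \<mu>" using f by simp_all
  have norm: "L2_norm \<mu> (\<lambda>x. D i g x - D i h x) = L2_norm \<mu> (\<lambda>x. g x - h x)" if "g \<in> L2 \<mu>" "h \<in> L2 \<mu>" for g h i
    unfolding dilation_diff[symmetric] using that by (intro dilation_norm L2_measurable L2_diff)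
  show "(\<lambda>m. L2_norm \<mu> (\<lambda>\<xi>. fourier chi \<mu> (D j (truncate f m)) \<xi> - fourier chi \<mu> (D j f) \<xi>)) \<longlonglongrightarrow> 0"
    using f t truncate_tendsto[OF f] by (intro fourier_tendsto) (simp_all add: norm)
  have "L2_norm \<mu> (\<lambda>\<xi>. fourier chi \<mu> (D j (truncate f m)) \<xi> - D (- j) (fourier chi \<mu> f) \<xi>)
      = L2_norm \<mu> (\<lambda>\<xi>. fourier chi \<mu> (truncate f m) \<xi> - fourier chi \<mu> f \<xi>)" for m
  proof -
    have a: "AE \<xi> in \<mu>. fourier chi \<mu> (D j (truncate f m)) \<xi> = fourier_L1 chi \<mu> (D j (truncate f m)) \<xi>"
      using t by (intro fourier_eq_fourier_L1[OF int]) simp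
    have b: "AE \<xi> in \<mu>. fourier chi \<mu> (truncate f m) (\<pp> powi j * \<xi>) = fourier_L1 chi \<mu> (truncate f m) (\<pp> powi j * \<xi>)"
      by (rule AE_dilate[OF fourier_eq_fourier_L1[OF t(2,1)]])
    have "AE \<xi> in \<mu>. fourier chi \<mu> (D j (truncate f m)) \<xi> = D (- j) (fourier chi \<mu> (truncate f m)) \<xi>"
      using a b by eventually_elim (simp add: L1[OF t(2)] dilation_def)
    then have "L2_norm \<mu> (\<lambda>\<xi>. fourier chi \<mu> (D j (truncate f m)) \<xi> - D (- j) (fourier chi \<mu> f) \<xi>)
      = L2_norm \<mu> (\<lambda>\<xi>. D (- j) (fourier chi \<mu> (truncate f m)) \<xi> - D (- j) (fourier chi \<mu> f) \<xi>)"
      using f t by (intro L2_norm_cong_AE L2_measurable L2_diff) (auto elim: eventually_mono)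
    then show ?thesis using f t by (simp add: norm)
  qed
  then show "(\<lambda>m. L2_norm \<mu> (\<lambda>\<xi>. fourier chi \<mu> (D j (truncate f m)) \<xi> - D (- j) (fourier chi \<mu> f) \<xi>)) \<longlonglongrightarrow> 0"
    using fourier_tendsto[OF t(1) f truncate_tendsto[OF f]] by simp
qed

lemma gabor_translate:
  assumes "l \<in> lat" "m \<in> lat"
  shows "gabor l k (m + x) = gabor l (k - m) x"
proof -
  have "m + x \<in> coset k 0 \<longleftrightarrow> x \<in> coset (k - m) 0" by (rule coset_translate)
  then show ?thesis using chi_lat[OF assms] by (simp add: gabor_def distrib_left chi_add indicator_def)
qed

text \<open>A translation by a lattice point permutes the Gabor basis, and so does the corresponding modulation.\<close>
lemma fourier_translation:
  assumes f: "f \<in> L2 \<mu>"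
  shows "AE \<xi> in \<mu>. fourier chi \<mu> (T k f) \<xi> = cnj (chi (v k * \<xi>)) * fourier chi \<mu> f \<xi>"
proof (rule L2_eqI_gabor)
  have vk: "v k \<in> lat" by (simp add: lat_def)
  show "fourier chi \<mu> (T k f) \<in> L2 \<mu>" using f by simp
  show "(\<lambda>\<xi>. cnj (chi (v k * \<xi>)) * fourier chi \<mu> f \<xi>) \<in> L2 \<mu>"
    using f by (intro L2_bounded_mult[of _ _ _ 1]) simp_all
  fix m l assume m: "m \<in> lat" and l: "l \<in> lat"
  have fm: "f \<in> borel_measurable borel" using L2_measurable[OF f] by simp
  have "L2_inner \<mu> (fourier chi \<mu> (T k f)) (gabor m l) = L2_inner \<mu> (T k f) (gabor l (- m))"
    using f by (intro fourier_coeffsD[OF fourier_coeffs_fourier l m]) simp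
  also have "\<dots> = (\<integral>x. T k f (v k + x) * cnj (gabor l (- m) (v k + x)) \<partial>\<mu>)"
    unfolding L2_inner_def using f by (intro integral_translate[symmetric] L2_measurable borel_measurable_times borel_measurable_cnj) simp_all
  also have "\<dots> = L2_inner \<mu> f (gabor l (- (m + v k)))"
    unfolding L2_inner_def gabor_translate[OF l vk] by (simp add: translation_def algebra_simps)
  also have "\<dots> = L2_inner \<mu> (fourier chi \<mu> f) (gabor (m + v k) l)"
    using m vk by (intro fourier_coeffsD[OF fourier_coeffs_fourier[OF f] l, symmetric]) auto
  also have "\<dots> = L2_inner \<mu> (\<lambda>\<xi>. cnj (chi (v k * \<xi>)) * fourier chi \<mu> f \<xi>) (gabor m l)"
    unfolding L2_inner_def gabor_def
    by (rule Bochner_Integration.integral_cong[OF refl])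
      (simp only: distrib_right chi_add complex_cnj_mult, simp only: mult_ac)
  finally show "L2_inner \<mu> (fourier chi \<mu> (T k f)) (gabor m l)
    = L2_inner \<mu> (\<lambda>\<xi>. cnj (chi (v k * \<xi>)) * fourier chi \<mu> f \<xi>) (gabor m l)" .
qed

end

section \<open>Periodization and orthonormality\<close>

context local_field_setup
begin

definition periodization :: "('k \<Rightarrow> complex) \<Rightarrow> 'k \<Rightarrow> complex" where
  "periodization G \<xi> = (\<Sum>\<^sub>\<infinity>l\<in>lat. G (l + \<xi>))"

lemma bij_lat_shift: "m \<in> lat \<Longrightarrow> bij_betw (\<lambda>l. l + m) lat lat"
  by (rule bij_betw_byWitness[where f' = "\<lambda>l. l - m"]) auto

lemma summable_lat_shift:
  fixes F :: "'k \<Rightarrow> real"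
  shows "m \<in> lat \<Longrightarrow> (\<lambda>l. F (l + (m + \<xi>))) summable_on lat \<longleftrightarrow> (\<lambda>l. F (l + \<xi>)) summable_on lat"
  using summable_on_reindex_bij_betw[OF bij_lat_shift, of m "\<lambda>l. F (l + \<xi>)"] by (simp add: add.assoc)

lemma periodization_shift: "m \<in> lat \<Longrightarrow> periodization G (m + \<xi>) = periodization G \<xi>"
  using infsum_reindex_bij_betw[OF bij_lat_shift, of m "\<lambda>l. G (l + \<xi>)"] by (simp add: periodization_def add.assoc)

text \<open>A periodic property need only be verified on the ring of integers.\<close>
lemma AE_lat_periodic:
  assumes "AE \<xi> in \<mu>. \<xi> \<in> coset 0 0 \<longrightarrow> P \<xi>" "\<And>m \<xi>. m \<in> lat \<Longrightarrow> P (m + \<xi>) \<Longrightarrow> P \<xi>"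
  shows "AE \<xi> in \<mu>. P \<xi>"
proof (rule AE_lat_cosets)
  fix m assume m: "m \<in> lat"
  show "AE \<xi> in \<mu>. \<xi> \<in> coset m 0 \<longrightarrow> P \<xi>"
    using AE_translate[OF assms(1), of "- m"]
  proof (rule eventually_mono)
    fix \<xi> assume "- m + \<xi> \<in> coset 0 0 \<longrightarrow> P (- m + \<xi>)"
    then show "\<xi> \<in> coset m 0 \<longrightarrow> P \<xi>"
      using assms(2)[OF lat_minus[OF m], of \<xi>] by (simp add: coset_def)
  qed
qed

lemma periodization_integral:
  assumes G: "integrable \<mu> G"
  shows "AE \<xi> in \<mu>. (\<lambda>l. cmod (G (l + \<xi>))) summable_on lat"
    and "integrable \<mu> (\<lambda>\<xi>. indicator (coset 0 0) \<xi> * periodization G \<xi>)"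
    and "(\<integral>\<xi>. indicator (coset 0 0) \<xi> * periodization G \<xi> \<partial>\<mu>) = (\<integral>\<xi>. G \<xi> \<partial>\<mu>)"
proof -
  have [measurable]: "G \<in> borel_measurable borel" using borel_measurable_integrable[OF G] by simp
  define f where "f l \<xi> = indicator (coset 0 0) \<xi> * G (l + \<xi>)" for l \<xi>
  have tr: "f l \<xi> = indicator (coset l 0) (l + \<xi>) * G (l + \<xi>)" for l \<xi>
    by (simp add: f_def indicator_def coset_def)
  have loc: "integrable \<mu> (\<lambda>x. indicator (coset l 0) x * G x)" for l
    by (rule Bochner_Integration.integrable_bound[OF G]) (auto simp: indicator_def norm_mult)
  have int: "integrable \<mu> (f l)" for l
    unfolding tr[abs_def] by (rule integrable_translate[OF loc])
  have "(\<integral>\<xi>. cmod (f l \<xi>) \<partial>\<mu>) = (\<integral>x. cmod (indicator (coset l 0) x * G x) \<partial>\<mu>)" for l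
    unfolding tr by (rule integral_translate) measurable
  then have s: "(\<lambda>l. \<integral>\<xi>. cmod (f l \<xi>) \<partial>\<mu>) summable_on lat"
    using lat_integral_has_sum(1)[OF G] by simp
  have f_infsum: "(\<Sum>\<^sub>\<infinity>l\<in>lat. f l \<xi>) = indicator (coset 0 0) \<xi> * periodization G \<xi>" for \<xi>
    by (simp only: f_def periodization_def infsum_cmult_right')
  note I = has_sum_integral[OF countable_lat int s, unfolded f_infsum]
  show "integrable \<mu> (\<lambda>\<xi>. indicator (coset 0 0) \<xi> * periodization G \<xi>)" by (rule I(2))
  have "(\<integral>\<xi>. f l \<xi> \<partial>\<mu>) = (\<integral>x. indicator (coset l 0) x * G x \<partial>\<mu>)" for l
    unfolding tr by (rule integral_translate) measurable
  then show "(\<integral>\<xi>. indicator (coset 0 0) \<xi> * periodization G \<xi> \<partial>\<mu>) = (\<integral>\<xi>. G \<xi> \<partial>\<mu>)"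
    using has_sum_unique[OF I(3)] lat_integral_has_sum(2)[OF G] by simp
  show "AE \<xi> in \<mu>. (\<lambda>l. cmod (G (l + \<xi>))) summable_on lat"
  proof (rule AE_lat_periodic)
    show "AE \<xi> in \<mu>. \<xi> \<in> coset 0 0 \<longrightarrow> (\<lambda>l. cmod (G (l + \<xi>))) summable_on lat"
      using I(1)
    proof (rule eventually_mono)
      fix \<xi> assume "(\<lambda>l. cmod (f l \<xi>)) summable_on lat"
      then show "\<xi> \<in> coset 0 0 \<longrightarrow> (\<lambda>l. cmod (G (l + \<xi>))) summable_on lat"
        by (cases "\<xi> \<in> coset 0 0") (simp_all add: f_def)
    qed
  qed (simp add: summable_lat_shift[of _ "\<lambda>x. cmod (G x)"])
qed

lemma periodization_chi: "l \<in> lat \<Longrightarrow> periodization (\<lambda>\<xi>. G \<xi> * chi (l * \<xi>)) \<xi> = periodization G \<xi> * chi (l * \<xi>)"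
proof -
  assume l: "l \<in> lat"
  have "periodization (\<lambda>\<xi>. G \<xi> * chi (l * \<xi>)) \<xi> = (\<Sum>\<^sub>\<infinity>k\<in>lat. G (k + \<xi>) * chi (l * \<xi>))"
    unfolding periodization_def by (rule infsum_cong) (simp add: distrib_left chi_add chi_lat[OF l])
  then show ?thesis by (simp only: periodization_def infsum_cmult_left')
qed

lemma integrable_mult_chi': "integrable \<mu> F \<Longrightarrow> integrable \<mu> (\<lambda>x. F x * chi (y * x))"
  using integrable_mult_chi[of F "- y"] by (simp add: chi_minus)

text \<open>The Fourier coefficients of the periodization are the values of the transform on the lattice.\<close>
lemma periodization_coeff:
  assumes "integrable \<mu> G" "l \<in> lat"
  shows "(\<integral>\<xi>. (indicator (coset 0 0) \<xi> * periodization G \<xi>) * chi (l * \<xi>) \<partial>\<mu>) = (\<integral>\<xi>. G \<xi> * chi (l * \<xi>) \<partial>\<mu>)"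
  using periodization_integral(3)[OF integrable_mult_chi'[OF assms(1)], of l] periodization_chi[OF assms(2), of G]
  by (simp add: mult.assoc)

text \<open>The character \<open>chi (l * \<xi>)\<close> is periodic, so the integral over the field is the \<open>l\<close>-th Fourier coefficient of the
  periodization on the ring of integers, and there an integrable function is determined by its coefficients.\<close>
theorem periodization_eq_const_iff:
  assumes G: "integrable \<mu> G"
  shows "(AE \<xi> in \<mu>. (\<lambda>k. G (\<xi> + v k)) sums a) \<longleftrightarrow>
    (\<forall>l\<in>lat. (\<integral>\<xi>. G \<xi> * chi (l * \<xi>) \<partial>\<mu>) = (if l = 0 then a else 0))"
proof -
  have sums_iff: "AE \<xi> in \<mu>. (\<lambda>k. G (\<xi> + v k)) sums a \<longleftrightarrow> periodization G \<xi> = a"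
    using periodization_integral(1)[OF G]
  proof (rule eventually_mono)
    fix \<xi> assume s: "(\<lambda>l. cmod (G (l + \<xi>))) summable_on lat"
    then have "(\<lambda>l. G (l + \<xi>)) summable_on lat" by (rule abs_summable_summable)
    then have "((\<lambda>l. G (l + \<xi>)) has_sum periodization G \<xi>) lat" by (simp add: periodization_def)
    then have "((\<lambda>k. G (v k + \<xi>)) has_sum periodization G \<xi>) UNIV"
      using has_sum_reindex_bij_betw[OF bij_v, of "\<lambda>l. G (l + \<xi>)"] by simp
    then have "(\<lambda>k. G (\<xi> + v k)) sums periodization G \<xi>"
      using has_sum_imp_sums by (simp add: add.commute)
    then show "(\<lambda>k. G (\<xi> + v k)) sums a \<longleftrightarrow> periodization G \<xi> = a"
      by (auto intro: sums_unique2)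
  qed
  have const: "(\<integral>\<xi>. indicator (coset 0 0) \<xi> * chi (l * \<xi>) \<partial>\<mu>) = (if l = 0 then 1 else 0)" if "l \<in> lat" for l
    unfolding integral_chi_coset using lat_in_discD[OF that, of 0] by auto
  show ?thesis
  proof
    assume "AE \<xi> in \<mu>. (\<lambda>k. G (\<xi> + v k)) sums a"
    then have P: "AE \<xi> in \<mu>. periodization G \<xi> = a" using sums_iff by eventually_elim simp
    show "\<forall>l\<in>lat. (\<integral>\<xi>. G \<xi> * chi (l * \<xi>) \<partial>\<mu>) = (if l = 0 then a else 0)"
    proof
      fix l assume l: "l \<in> lat"
      have "(\<integral>\<xi>. G \<xi> * chi (l * \<xi>) \<partial>\<mu>) = (\<integral>\<xi>. (indicator (coset 0 0) \<xi> * periodization G \<xi>) * chi (l * \<xi>) \<partial>\<mu>)"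
        using periodization_coeff[OF G l] by simp
      also have "\<dots> = (\<integral>\<xi>. a * (indicator (coset 0 0) \<xi> * chi (l * \<xi>)) \<partial>\<mu>)"
      proof (rule integral_cong_AE)
        show "(\<lambda>\<xi>. (indicator (coset 0 0) \<xi> * periodization G \<xi>) * chi (l * \<xi>)) \<in> borel_measurable \<mu>"
          using borel_measurable_integrable[OF integrable_mult_chi'[OF periodization_integral(2)[OF G]]] .
        show "(\<lambda>\<xi>. a * (indicator (coset 0 0) \<xi> * chi (l * \<xi>))) \<in> borel_measurable \<mu>" by measurable
        show "AE \<xi> in \<mu>. (indicator (coset 0 0) \<xi> * periodization G \<xi>) * chi (l * \<xi>)
          = a * (indicator (coset 0 0) \<xi> * chi (l * \<xi>))" using P by (rule eventually_mono) simp
      qed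
      finally show "(\<integral>\<xi>. G \<xi> * chi (l * \<xi>) \<partial>\<mu>) = (if l = 0 then a else 0)" using const[OF l] by simp
    qed
  next
    assume coeffs: "\<forall>l\<in>lat. (\<integral>\<xi>. G \<xi> * chi (l * \<xi>) \<partial>\<mu>) = (if l = 0 then a else 0)"
    have ind: "integrable \<mu> (\<lambda>\<xi>. indicator (coset 0 0) \<xi> * a)"
      using L2_integrable_mult[OF indicator_coset_L2 indicator_coset_L2, of 0 0 0 0]
      by (intro Bochner_Integration.integrable_mult_left) (simp add: indicator_def flip: of_bool_conj)
    have "AE \<xi> in \<mu>. \<xi> \<in> coset 0 0 \<longrightarrow> periodization G \<xi> - a = 0"
    proof (rule gabor_total_on_coset)
      show "integrable \<mu> (\<lambda>\<xi>. indicator (coset 0 0) \<xi> * (periodization G \<xi> - a))"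
        unfolding right_diff_distrib by (rule Bochner_Integration.integrable_diff[OF periodization_integral(2)[OF G] ind])
      fix l assume l: "l \<in> lat"
      have eq: "(periodization G \<xi> - a) * cnj (gabor l 0 \<xi>)
        = (indicator (coset 0 0) \<xi> * periodization G \<xi>) * chi (- l * \<xi>) - a * (indicator (coset 0 0) \<xi> * chi (- l * \<xi>))" for \<xi>
        by (simp add: gabor_def chi_minus algebra_simps indicator_def)
      have "(\<integral>\<xi>. (periodization G \<xi> - a) * cnj (gabor l 0 \<xi>) \<partial>\<mu>)
        = (\<integral>\<xi>. (indicator (coset 0 0) \<xi> * periodization G \<xi>) * chi (- l * \<xi>) \<partial>\<mu>)
          - (\<integral>\<xi>. a * (indicator (coset 0 0) \<xi> * chi (- l * \<xi>)) \<partial>\<mu>)"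
        unfolding eq
      proof (rule Bochner_Integration.integral_diff)
        show "integrable \<mu> (\<lambda>\<xi>. (indicator (coset 0 0) \<xi> * periodization G \<xi>) * chi (- l * \<xi>))"
          by (rule integrable_mult_chi'[OF periodization_integral(2)[OF G]])
        show "integrable \<mu> (\<lambda>\<xi>. a * (indicator (coset 0 0) \<xi> * chi (- l * \<xi>)))"
          using integrable_mult_chi'[OF ind, of "- l"] by (simp add: mult_ac)
      qed
      also have "\<dots> = (if - l = 0 then a else 0) - a * (if - l = 0 then 1 else 0)"
        using coeffs[rule_format, OF lat_minus[OF l]] l const[of "- l"] periodization_coeff[OF G, of "- l"] by simp
      finally show "(\<integral>\<xi>. (periodization G \<xi> - a) * cnj (gabor l 0 \<xi>) \<partial>\<mu>) = 0" by simp
    qed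
    then have "AE \<xi> in \<mu>. periodization G \<xi> - a = 0"
      by (rule AE_lat_periodic) (simp add: periodization_shift)
    then show "AE \<xi> in \<mu>. (\<lambda>k. G (\<xi> + v k)) sums a" using sums_iff by eventually_elim simp
  qed
qed

subsection \<open>The wavelet system\<close>

lemma fourier_wavelet:
  assumes f: "f \<in> L2 \<mu>"
  shows "AE \<xi> in \<mu>. fourier chi \<mu> (D j (T k f)) \<xi> = D (- j) (\<lambda>\<zeta>. cnj (chi (v k * \<zeta>)) * fourier chi \<mu> f \<zeta>) \<xi>"
proof -
  have "AE \<xi> in \<mu>. fourier chi \<mu> (T k f) (\<pp> powi j * \<xi>) = cnj (chi (v k * (\<pp> powi j * \<xi>))) * fourier chi \<mu> f (\<pp> powi j * \<xi>)"
    by (rule AE_dilate[OF fourier_translation[OF f]])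
  moreover have "AE \<xi> in \<mu>. fourier chi \<mu> (D j (T k f)) \<xi> = D (- j) (fourier chi \<mu> (T k f)) \<xi>"
    using f by (intro fourier_dilation) simp
  ultimately show ?thesis by eventually_elim (simp add: dilation_def)
qed

lemma modulation_L2: "f \<in> L2 \<mu> \<Longrightarrow> (\<lambda>\<zeta>. cnj (chi (y * \<zeta>)) * f \<zeta>) \<in> L2 \<mu>"
  by (rule L2_bounded_mult[of _ _ _ 1]) simp_all

lemma dilation_dilation: "D i (D j f) = D (i + j) f"
proof
  fix x
  have "real q powr (real_of_int i / 2) * real q powr (real_of_int j / 2) = real q powr (real_of_int (i + j) / 2)"
    by (simp add: add_divide_distrib flip: powr_add)
  moreover have "\<pp> powi (- j) * (\<pp> powi (- i) * x) = \<pp> powi (- (i + j)) * x"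
    by (simp add: mult.assoc[symmetric] power_int_diff power_int_minus field_simps power_int_add)
  ultimately show "D i (D j f) x = D (i + j) f x"
    unfolding dilation_def by (simp only: mult.assoc[symmetric] of_real_mult[symmetric])
qed

lemma dilation_0 [simp]: "D 0 f = f" by (simp add: dilation_def fun_eq_iff)

text \<open>Translation and dilation become modulation and dilation on the Fourier side; the two phases are combined.\<close>
lemma inner_wavelets:
  assumes f: "f \<in> L2 \<mu>" and g: "g \<in> L2 \<mu>"
  shows "L2_inner \<mu> (D (- int m) (T k f)) (T k' g) = of_real (real q powr (real m / 2)) *
    (\<integral>\<xi>. fourier chi \<mu> f (\<pp> powi (- int m) * \<xi>) * cnj (fourier chi \<mu> g \<xi>) *
      chi ((v k' - \<pp> powi (- int m) * v k) * \<xi>) \<partial>\<mu>)"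
proof -
  have "L2_inner \<mu> (D (- int m) (T k f)) (T k' g)
      = L2_inner \<mu> (fourier chi \<mu> (D (- int m) (T k f))) (fourier chi \<mu> (T k' g))"
    using f g by (intro Plancherel[symmetric]) simp_all
  also have "\<dots> = L2_inner \<mu> (D (int m) (\<lambda>\<zeta>. cnj (chi (v k * \<zeta>)) * fourier chi \<mu> f \<zeta>))
      (\<lambda>\<xi>. cnj (chi (v k' * \<xi>)) * fourier chi \<mu> g \<xi>)"
    using fourier_wavelet[OF f, of "- int m" k] fourier_translation[OF g, of k'] f g
    by (intro L2_inner_cong_AE L2_measurable dilation_L2 modulation_L2 fourier_L2 translation_L2) simp_all
  also have "\<dots> = (\<integral>\<xi>. of_real (real q powr (real m / 2)) *
     (fourier chi \<mu> f (\<pp> powi (- int m) * \<xi>) * cnj (fourier chi \<mu> g \<xi>) *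
      chi ((v k' - \<pp> powi (- int m) * v k) * \<xi>)) \<partial>\<mu>)"
    unfolding L2_inner_def
  proof (rule Bochner_Integration.integral_cong[OF refl])
    fix \<xi>
    have "(v k' - \<pp> powi (- int m) * v k) * \<xi> = v k' * \<xi> - v k * (\<pp> powi (- int m) * \<xi>)"
      by (simp add: algebra_simps)
    then have "chi ((v k' - \<pp> powi (- int m) * v k) * \<xi>)
        = chi (v k' * \<xi>) * cnj (chi (v k * (\<pp> powi (- int m) * \<xi>)))"
      by (simp only: chi_diff)
    then show "D (int m) (\<lambda>\<zeta>. cnj (chi (v k * \<zeta>)) * fourier chi \<mu> f \<zeta>) \<xi> * cnj (cnj (chi (v k' * \<xi>)) * fourier chi \<mu> g \<xi>)
      = of_real (real q powr (real m / 2)) *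
       (fourier chi \<mu> f (\<pp> powi (- int m) * \<xi>) * cnj (fourier chi \<mu> g \<xi>) *
        chi ((v k' - \<pp> powi (- int m) * v k) * \<xi>))"
      by (simp only: dilation_def complex_cnj_mult complex_cnj_cnj of_int_of_nat_eq mult_ac)
  qed
  finally show ?thesis by simp
qed

definition wavelet_system_orthonormal :: "nat \<Rightarrow> (nat \<Rightarrow> 'k \<Rightarrow> complex) \<Rightarrow> bool" where
  "wavelet_system_orthonormal n \<eta> \<longleftrightarrow> (\<forall>j k j' k'.
    (\<Sum>i=1..n. L2_inner \<mu> (D j (T k (\<eta> i))) (D j' (T k' (\<eta> i)))) = (if j = j' \<and> k = k' then 1 else 0))"

text \<open>The function whose sum over the lattice translates must be 1 or 0 for the system to be orthonormal.\<close>
definition correlation :: "nat \<Rightarrow> (nat \<Rightarrow> 'k \<Rightarrow> complex) \<Rightarrow> nat \<Rightarrow> 'k \<Rightarrow> complex" where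
  "correlation n \<eta> m \<xi> = (\<Sum>i=1..n. fourier chi \<mu> (\<eta> i) (\<pp> powi (- int m) * \<xi>) * cnj (fourier chi \<mu> (\<eta> i) \<xi>))"

lemma product_dilate_integrable:
  assumes "f \<in> L2 \<mu>" "g \<in> L2 \<mu>"
  shows "integrable \<mu> (\<lambda>\<xi>. f (\<pp> powi j * \<xi>) * cnj (g \<xi>))"
proof -
  let ?s = "complex_of_real (real q powr (real_of_int (- j) / 2))"
  have "integrable \<mu> (\<lambda>\<xi>. inverse ?s * (D (- j) f \<xi> * cnj (g \<xi>)))"
    using assms by (intro Bochner_Integration.integrable_mult_right L2_integrable_mult_cnj dilation_L2)
  moreover have "?s \<noteq> 0" by simp
  then have "inverse ?s * (D (- j) f \<xi> * cnj (g \<xi>)) = f (\<pp> powi j * \<xi>) * cnj (g \<xi>)" for \<xi>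
    unfolding dilation_def minus_minus by simp
  ultimately show ?thesis by (simp only:)
qed

lemma sum_inner_wavelets:
  assumes \<eta>: "\<And>i. i \<in> {1..n} \<Longrightarrow> \<eta> i \<in> L2 \<mu>"
  shows "(\<Sum>i=1..n. L2_inner \<mu> (D (- int m) (T k (\<eta> i))) (T k' (\<eta> i))) =
    of_real (real q powr (real m / 2)) * (\<integral>\<xi>. correlation n \<eta> m \<xi> * chi ((v k' - \<pp> powi (- int m) * v k) * \<xi>) \<partial>\<mu>)"
proof -
  let ?\<phi> = "\<lambda>i. fourier chi \<mu> (\<eta> i)"
  let ?l = "v k' - \<pp> powi (- int m) * v k"
  have int: "integrable \<mu> (\<lambda>\<xi>. ?\<phi> i (\<pp> powi (- int m) * \<xi>) * cnj (?\<phi> i \<xi>) * chi (?l * \<xi>))" if "i \<in> {1..n}" for i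
    using \<eta>[OF that] by (intro integrable_mult_chi' product_dilate_integrable fourier_L2)
  have "(\<integral>\<xi>. correlation n \<eta> m \<xi> * chi (?l * \<xi>) \<partial>\<mu>)
      = (\<Sum>i=1..n. \<integral>\<xi>. ?\<phi> i (\<pp> powi (- int m) * \<xi>) * cnj (?\<phi> i \<xi>) * chi (?l * \<xi>) \<partial>\<mu>)"
    unfolding correlation_def sum_distrib_right by (rule Bochner_Integration.integral_sum[OF int])
  moreover have "(\<Sum>i=1..n. L2_inner \<mu> (D (- int m) (T k (\<eta> i))) (T k' (\<eta> i))) =
      (\<Sum>i=1..n. of_real (real q powr (real m / 2)) *
        (\<integral>\<xi>. ?\<phi> i (\<pp> powi (- int m) * \<xi>) * cnj (?\<phi> i \<xi>) * chi (?l * \<xi>) \<partial>\<mu>))"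
    by (rule sum.cong[OF refl]) (rule inner_wavelets[OF \<eta> \<eta>])
  ultimately show ?thesis by (simp only: sum_distrib_left)
qed

lemma correlation_integrable:
  assumes "\<And>i. i \<in> {1..n} \<Longrightarrow> \<eta> i \<in> L2 \<mu>"
  shows "integrable \<mu> (correlation n \<eta> m)"
  unfolding correlation_def[abs_def] using assms
  by (intro Bochner_Integration.integrable_sum product_dilate_integrable fourier_L2)

text \<open>As dilations are unitary, it suffices to consider the levels \<open>- m\<close> and 0. The phases
  \<open>v k' - \<pp> powi (- int m) * v k\<close> that occur then lie in the lattice and exhaust it, already for \<open>k = 0\<close>. So
  orthonormality prescribes all Fourier coefficients of the periodized correlations.\<close>
theorem orthonormal_iff_correlation:
  assumes \<eta>: "\<And>i. i \<in> {1..n} \<Longrightarrow> \<eta> i \<in> L2 \<mu>"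
  shows "wavelet_system_orthonormal n \<eta> \<longleftrightarrow>
    (\<forall>m. AE \<xi> in \<mu>. (\<lambda>k. correlation n \<eta> m (\<xi> + v k)) sums (if m = 0 then 1 else 0))"
proof -
  let ?C = "\<lambda>m l. \<integral>\<xi>. correlation n \<eta> m \<xi> * chi (l * \<xi>) \<partial>\<mu>"
  have iff: "(\<forall>m. AE \<xi> in \<mu>. (\<lambda>k. correlation n \<eta> m (\<xi> + v k)) sums (if m = 0 then 1 else 0)) \<longleftrightarrow>
    (\<forall>m. \<forall>l\<in>lat. ?C m l = (if l = 0 then if m = 0 then 1 else 0 else 0))"
    by (intro all_cong1 periodization_eq_const_iff correlation_integrable \<eta>)
  have qp: "complex_of_real (real q powr r) \<noteq> 0" for r by simp
  show ?thesis unfolding iff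
  proof
    assume O: "wavelet_system_orthonormal n \<eta>"
    show "\<forall>m. \<forall>l\<in>lat. ?C m l = (if l = 0 then if m = 0 then 1 else 0 else 0)"
    proof (intro allI ballI)
      fix m l assume "l \<in> lat"
      then obtain k' where k': "l = v k'" by (auto simp: lat_def)
      have k'_0: "k' = 0 \<longleftrightarrow> l = 0" using inj_v k' v_0 by (metis injD)
      have "of_real (real q powr (real m / 2)) * ?C m l
          = (\<Sum>i=1..n. L2_inner \<mu> (D (- int m) (T 0 (\<eta> i))) (T k' (\<eta> i)))"
        using sum_inner_wavelets[where m = m and k = 0 and k' = k', OF \<eta>] by (simp add: k')
      also have "\<dots> = (if m = 0 \<and> l = 0 then 1 else 0)"
        using O[unfolded wavelet_system_orthonormal_def, rule_format, of "- int m" 0 0 k'] k'_0 by auto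
      finally have "of_real (real q powr (real m / 2)) * ?C m l = (if m = 0 \<and> l = 0 then 1 else 0)" .
      then show "?C m l = (if l = 0 then if m = 0 then 1 else 0 else 0)"
        using qp[of "real m / 2"] q_pos(1) by (cases "m = 0") (auto split: if_splits)
    qed
  next
    assume C: "\<forall>m. \<forall>l\<in>lat. ?C m l = (if l = 0 then if m = 0 then 1 else 0 else 0)"
    have base: "(\<Sum>i=1..n. L2_inner \<mu> (D (- int m) (T k (\<eta> i))) (T k' (\<eta> i))) = (if m = 0 \<and> k = k' then 1 else 0)" for m k k'
    proof -
      have "v k' - \<pp> powi (- int m) * v k \<in> lat"
        using lat_powi[of "v k" m] by (intro lat_diff) (auto simp: lat_def)
      moreover have "v k' - v k = 0 \<longleftrightarrow> k = k'" using inj_v by (auto dest: injD)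
      moreover have "(\<Sum>i=1..n. L2_inner \<mu> (D (- int m) (T k (\<eta> i))) (T k' (\<eta> i)))
          = of_real (real q powr (real m / 2)) * ?C m (v k' - \<pp> powi (- int m) * v k)"
        by (rule sum_inner_wavelets) (rule \<eta>)
      ultimately show ?thesis using C q_pos(1) by (cases "m = 0") (simp_all del: right_minus_eq)
    qed
    have shift: "L2_inner \<mu> (D j (T k (\<eta> i))) (D j' (T k' (\<eta> i))) = L2_inner \<mu> (D (j - j') (T k (\<eta> i))) (T k' (\<eta> i))"
      if "i \<in> {1..n}" for j j' k k' i
      using dilation_inner[of "D (j - j') (T k (\<eta> i))" "T k' (\<eta> i)" j'] \<eta>[OF that]
      by (simp add: dilation_dilation)
    have le: "(\<Sum>i=1..n. L2_inner \<mu> (D j (T k (\<eta> i))) (D j' (T k' (\<eta> i)))) = (if j = j' \<and> k = k' then 1 else 0)"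
      if "j \<le> j'" for j j' k k'
    proof -
      have "(\<Sum>i=1..n. L2_inner \<mu> (D j (T k (\<eta> i))) (D j' (T k' (\<eta> i))))
        = (\<Sum>i=1..n. L2_inner \<mu> (D (- int (nat (j' - j))) (T k (\<eta> i))) (T k' (\<eta> i)))"
        using that by (intro sum.cong refl) (simp only: shift, simp)
      then show ?thesis using base[of "nat (j' - j)" k k'] that by auto
    qed
    show "wavelet_system_orthonormal n \<eta>"
      unfolding wavelet_system_orthonormal_def
    proof (intro allI)
      fix j k j' k'
      show "(\<Sum>i=1..n. L2_inner \<mu> (D j (T k (\<eta> i))) (D j' (T k' (\<eta> i)))) = (if j = j' \<and> k = k' then 1 else 0)"
      proof (cases "j \<le> j'")
        case False
        have "(\<Sum>i=1..n. L2_inner \<mu> (D j (T k (\<eta> i))) (D j' (T k' (\<eta> i))))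
          = cnj (\<Sum>i=1..n. L2_inner \<mu> (D j' (T k' (\<eta> i))) (D j (T k (\<eta> i))))"
          unfolding cnj_sum by (intro sum.cong refl L2_inner_commute)
        then show ?thesis using le[of j' j k' k] False by (simp del: cnj_sum)
      qed (rule le)
    qed
  qed
qed

end

section \<open>The quadratic form of the wavelet system\<close>

lemma has_sum_finite_sum:
  fixes f :: "'i \<Rightarrow> 'a \<Rightarrow> 'b::{topological_comm_monoid_add}"
  assumes "finite F" "\<And>i. i \<in> F \<Longrightarrow> (f i has_sum s i) A"
  shows "((\<lambda>x. \<Sum>i\<in>F. f i x) has_sum (\<Sum>i\<in>F. s i)) A"
  using assms by (induction F rule: finite_induct) (auto intro!: has_sum_add)

context local_field_setup
begin

subsection \<open>Parseval for functions supported in several cosets\<close>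

lemma cnj_indicator [simp]: "cnj (indicator A x) = indicator A x"
  by (simp add: indicator_def)

lemma sum_indicator_lat_cosets:
  "(\<Sum>l\<in>lat \<inter> disc (int R). indicator (coset l 0) x) = (indicator (disc (int R)) x :: complex)"
proof (cases "x \<in> disc (int R)")
  case True
  obtain l where l: "l \<in> lat" "x - l \<in> disc 0" using lat_cover by blast
  have "x - l \<in> disc (int R)" using l(2) disc_mono[of 0 "int R"] by auto
  then have "l \<in> disc (int R)" using disc_diff[OF True, of "x - l"] by simp
  then have lS: "l \<in> lat \<inter> disc (int R)" using l(1) by simp
  have xl: "x \<in> coset l 0" using l(2) by (simp add: coset_def)
  have "(\<Sum>m\<in>lat \<inter> disc (int R). indicator (coset m 0) x) = (\<Sum>m\<in>{l}. indicator (coset m 0) x :: complex)"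
  proof (rule sum.mono_neutral_right[OF finite_lat_disc])
    show "\<forall>i\<in>lat \<inter> disc (int R) - {l}. indicator (coset i 0) x = (0 :: complex)"
      using lat_coset_eq[OF l(1) _ xl] by (auto simp: indicator_def)
  qed (use lS in auto)
  then show ?thesis using True xl by simp
next
  case False
  have "x \<notin> coset l 0" if "l \<in> disc (int R)" for l
  proof
    assume "x \<in> coset l 0"
    then have "x - l \<in> disc (int R)" using disc_mono[of 0 "int R"] by (auto simp: coset_def)
    then have "x - l + l \<in> disc (int R)" using that by (rule disc_add)
    then show False using False by simp
  qed
  then show ?thesis using False by simp
qed

lemma comp_translate_L2: "f \<in> L2 \<mu> \<Longrightarrow> (\<lambda>x. f (a + x)) \<in> L2 \<mu>"
proof (rule L2_I)
  assume f: "f \<in> L2 \<mu>"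
  show "(\<lambda>x. f (a + x)) \<in> borel_measurable \<mu>" using f by (intro measurable_comp_translate L2_measurable)
  show "integrable \<mu> (\<lambda>x. (cmod (f (a + x)))\<^sup>2)" using integrable_translate[OF L2_integrable_square[OF f]] .
qed

lemma comp_dilate_L2: "f \<in> L2 \<mu> \<Longrightarrow> (\<lambda>x. f (\<pp> powi j * x)) \<in> L2 \<mu>"
proof (rule L2_I)
  assume f: "f \<in> L2 \<mu>"
  show "(\<lambda>x. f (\<pp> powi j * x)) \<in> borel_measurable \<mu>" using f by (intro measurable_comp_dilate L2_measurable)
  show "integrable \<mu> (\<lambda>x. (cmod (f (\<pp> powi j * x)))\<^sup>2)" using integrable_dilate[OF L2_integrable_square[OF f]] .
qed

lemma inner_gabor_translate:
  assumes H: "H \<in> L2 \<mu>" and "l \<in> lat" "m \<in> lat"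
  shows "L2_inner \<mu> H (gabor l k) = L2_inner \<mu> (\<lambda>x. H (m + x)) (gabor l (k - m))"
proof -
  have "L2_inner \<mu> H (gabor l k) = (\<integral>x. H (m + x) * cnj (gabor l k (m + x)) \<partial>\<mu>)"
    unfolding L2_inner_def using H
    by (intro integral_translate[symmetric] borel_measurable_integrable L2_integrable_mult_cnj gabor_L2)
  then show ?thesis unfolding L2_inner_def gabor_translate[OF assms(2,3)] .
qed

text \<open>Cutting off to one coset selects the elements of the Gabor basis that belong to it.\<close>
lemma coset_Parseval_bilinear:
  assumes G: "G \<in> L2 \<mu>" and H: "H \<in> L2 \<mu>" and k: "k \<in> lat"
  shows "((\<lambda>l. L2_inner \<mu> G (gabor (- l) k) * cnj (L2_inner \<mu> H (gabor (- l) k)))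
    has_sum (\<integral>x. indicator (coset k 0) x * (G x * cnj (H x)) \<partial>\<mu>)) lat"
proof -
  let ?G = "\<lambda>x. indicator (coset k 0) x * G x"
  have G': "?G \<in> L2 \<mu>" using G by (rule L2_times_indicator)
  have in_G: "L2_inner \<mu> ?G (gabor l k') = (if k' = k then L2_inner \<mu> G (gabor l k) else 0)" if "k' \<in> lat" for l k'
  proof (cases "k' = k")
    case True
    have "(\<lambda>x. ?G x * cnj (gabor l k x)) = (\<lambda>x. G x * cnj (gabor l k x))"
      by (auto simp: gabor_def indicator_def fun_eq_iff)
    then show ?thesis using True by (simp only: L2_inner_def simp_thms if_True)
  next
    case False
    then have "(\<lambda>x. ?G x * cnj (gabor l k' x)) = (\<lambda>x. 0)"
      using lat_coset_eq[OF k that] by (auto simp: gabor_def indicator_def fun_eq_iff)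
    then show ?thesis using False by (simp only: L2_inner_def integral_zero simp_thms if_False)
  qed
  have "((\<lambda>(l, k'). L2_inner \<mu> ?G (gabor l k') * cnj (L2_inner \<mu> H (gabor l k'))) has_sum L2_inner \<mu> ?G H) (lat \<times> lat)"
    by (rule gabor_Parseval_bilinear[OF G' H])
  moreover have "((\<lambda>(l, k'). L2_inner \<mu> ?G (gabor l k') * cnj (L2_inner \<mu> H (gabor l k'))) has_sum L2_inner \<mu> ?G H) (lat \<times> lat)
    \<longleftrightarrow> ((\<lambda>(l, k'). L2_inner \<mu> G (gabor l k') * cnj (L2_inner \<mu> H (gabor l k'))) has_sum L2_inner \<mu> ?G H) (lat \<times> {k})"
    using k by (intro has_sum_cong_neutral) (auto simp: in_G split: if_splits)
  ultimately have "((\<lambda>(l, k'). L2_inner \<mu> G (gabor l k') * cnj (L2_inner \<mu> H (gabor l k'))) has_sum L2_inner \<mu> ?G H) (lat \<times> {k})"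
    by simp
  moreover have "bij_betw (\<lambda>l. (- l, k)) lat (lat \<times> {k})"
    by (rule bij_betw_byWitness[where f' = "\<lambda>x. - fst x"]) auto
  ultimately have "((\<lambda>l. L2_inner \<mu> G (gabor (- l) k) * cnj (L2_inner \<mu> H (gabor (- l) k))) has_sum L2_inner \<mu> ?G H) lat"
    using has_sum_reindex_bij_betw[of "\<lambda>l. (- l, k)" lat "lat \<times> {k}"
      "\<lambda>(l, k'). L2_inner \<mu> G (gabor l k') * cnj (L2_inner \<mu> H (gabor l k'))"] by simp
  then show ?thesis by (simp add: L2_inner_def mult.assoc)
qed

text \<open>The values of the transform on the lattice are the Fourier coefficients of the periodization;
  for functions supported in a disc the periodization is a finite sum, and Parseval's identity for it
  reads as follows.\<close>
lemma lattice_Parseval: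
  assumes G: "G \<in> L2 \<mu>" and H: "H \<in> L2 \<mu>"
    and suppG: "\<And>x. x \<notin> disc (int R) \<Longrightarrow> G x = 0" and suppH: "\<And>x. x \<notin> disc (int R) \<Longrightarrow> H x = 0"
  shows "((\<lambda>l. (\<integral>x. G x * chi (l * x) \<partial>\<mu>) * cnj (\<integral>x. H x * chi (l * x) \<partial>\<mu>))
    has_sum (\<Sum>m\<in>lat \<inter> disc (int R). \<integral>x. G x * cnj (H (m + x)) \<partial>\<mu>)) lat"
proof -
  let ?S = "lat \<inter> disc (int R)"
  have fin: "finite ?S" by (rule finite_lat_disc)
  have coeff: "(\<integral>x. F x * chi (l * x) \<partial>\<mu>) = (\<Sum>k\<in>?S. L2_inner \<mu> F (gabor (- l) k))"
    if F: "F \<in> L2 \<mu>" and supp: "\<And>x. x \<notin> disc (int R) \<Longrightarrow> F x = 0" for F l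
  proof -
    have "F x * chi (l * x) = (\<Sum>k\<in>?S. F x * cnj (gabor (- l) k x))" for x
    proof -
      have "(\<Sum>k\<in>?S. F x * cnj (gabor (- l) k x)) = F x * ((\<Sum>k\<in>?S. indicator (coset k 0) x) * chi (l * x))"
        by (simp add: gabor_def chi_minus sum_distrib_left sum_distrib_right)
      then show ?thesis unfolding sum_indicator_lat_cosets using supp[of x] by (cases "x \<in> disc (int R)") simp_all
    qed
    then have "(\<integral>x. F x * chi (l * x) \<partial>\<mu>) = (\<integral>x. (\<Sum>k\<in>?S. F x * cnj (gabor (- l) k x)) \<partial>\<mu>)" by simp
    also have "\<dots> = (\<Sum>k\<in>?S. L2_inner \<mu> F (gabor (- l) k))"
      unfolding L2_inner_def using F by (intro Bochner_Integration.integral_sum L2_integrable_mult_cnj gabor_L2)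
    finally show ?thesis .
  qed
  have pair: "((\<lambda>l. L2_inner \<mu> G (gabor (- l) k) * cnj (L2_inner \<mu> H (gabor (- l) k')))
      has_sum (\<integral>x. indicator (coset k 0) x * (G x * cnj (H (k' - k + x))) \<partial>\<mu>)) lat"
    if "k \<in> ?S" "k' \<in> ?S" for k k'
  proof -
    have kl: "k \<in> lat" "k' - k \<in> lat" using that by auto
    have "((\<lambda>l. L2_inner \<mu> G (gabor (- l) k) * cnj (L2_inner \<mu> (\<lambda>x. H (k' - k + x)) (gabor (- l) k)))
      has_sum (\<integral>x. indicator (coset k 0) x * (G x * cnj (H (k' - k + x))) \<partial>\<mu>)) lat"
      by (rule coset_Parseval_bilinear[OF G comp_translate_L2[OF H] kl(1)])
    moreover have "L2_inner \<mu> H (gabor (- l) k') = L2_inner \<mu> (\<lambda>x. H (k' - k + x)) (gabor (- l) k)" if "l \<in> lat" for l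
      using inner_gabor_translate[OF H lat_minus[OF that] kl(2), of k'] by simp
    ultimately show ?thesis by (subst has_sum_cong) simp_all
  qed
  have "((\<lambda>l. \<Sum>k\<in>?S. \<Sum>k'\<in>?S. L2_inner \<mu> G (gabor (- l) k) * cnj (L2_inner \<mu> H (gabor (- l) k')))
      has_sum (\<Sum>k\<in>?S. \<Sum>k'\<in>?S. \<integral>x. indicator (coset k 0) x * (G x * cnj (H (k' - k + x))) \<partial>\<mu>)) lat"
    by (intro has_sum_finite_sum fin pair)
  moreover have "(\<Sum>k\<in>?S. \<Sum>k'\<in>?S. L2_inner \<mu> G (gabor (- l) k) * cnj (L2_inner \<mu> H (gabor (- l) k')))
    = (\<integral>x. G x * chi (l * x) \<partial>\<mu>) * cnj (\<integral>x. H x * chi (l * x) \<partial>\<mu>)" for l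
  proof -
    have "(\<integral>x. G x * chi (l * x) \<partial>\<mu>) = (\<Sum>k\<in>?S. L2_inner \<mu> G (gabor (- l) k))" by (rule coeff[OF G]) (rule suppG)
    moreover have "(\<integral>x. H x * chi (l * x) \<partial>\<mu>) = (\<Sum>k\<in>?S. L2_inner \<mu> H (gabor (- l) k))" by (rule coeff[OF H]) (rule suppH)
    ultimately show ?thesis by (simp only: cnj_sum sum_product)
  qed
  moreover have "(\<Sum>k\<in>?S. \<Sum>k'\<in>?S. \<integral>x. indicator (coset k 0) x * (G x * cnj (H (k' - k + x))) \<partial>\<mu>)
    = (\<Sum>m\<in>?S. \<integral>x. G x * cnj (H (m + x)) \<partial>\<mu>)"
  proof -
    have int: "integrable \<mu> (\<lambda>x. indicator (coset k 0) x * (G x * cnj (H (m + x))))" for k m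
      using L2_integrable_mult_cnj[OF L2_times_indicator[OF G] comp_translate_L2[OF H]] by (simp add: mult.assoc)
    have "(\<Sum>k'\<in>?S. \<integral>x. indicator (coset k 0) x * (G x * cnj (H (k' - k + x))) \<partial>\<mu>)
      = (\<Sum>m\<in>?S. \<integral>x. indicator (coset k 0) x * (G x * cnj (H (m + x))) \<partial>\<mu>)" if "k \<in> ?S" for k
      using that by (intro sum.reindex_bij_witness[of _ "\<lambda>m. m + k" "\<lambda>k'. k' - k"]) (auto intro: disc_diff)
    then have "(\<Sum>k\<in>?S. \<Sum>k'\<in>?S. \<integral>x. indicator (coset k 0) x * (G x * cnj (H (k' - k + x))) \<partial>\<mu>)
      = (\<Sum>k\<in>?S. \<Sum>m\<in>?S. \<integral>x. indicator (coset k 0) x * (G x * cnj (H (m + x))) \<partial>\<mu>)" by (rule sum.cong[OF refl])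
    also have "\<dots> = (\<Sum>m\<in>?S. \<Sum>k\<in>?S. \<integral>x. indicator (coset k 0) x * (G x * cnj (H (m + x))) \<partial>\<mu>)" by (rule sum.swap)
    also have "\<dots> = (\<Sum>m\<in>?S. \<integral>x. G x * cnj (H (m + x)) \<partial>\<mu>)"
    proof (rule sum.cong[OF refl])
      fix m
      have "(\<Sum>k\<in>?S. \<integral>x. indicator (coset k 0) x * (G x * cnj (H (m + x))) \<partial>\<mu>)
        = (\<integral>x. (\<Sum>k\<in>?S. indicator (coset k 0) x) * (G x * cnj (H (m + x))) \<partial>\<mu>)"
        unfolding sum_distrib_right by (rule Bochner_Integration.integral_sum[OF int, symmetric])
      also have "\<dots> = (\<integral>x. G x * cnj (H (m + x)) \<partial>\<mu>)"
        unfolding sum_indicator_lat_cosets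
      proof (rule Bochner_Integration.integral_cong[OF refl])
        fix x
        show "indicator (disc (int R)) x * (G x * cnj (H (m + x))) = G x * cnj (H (m + x))"
          using suppG[of x] by (cases "x \<in> disc (int R)") simp_all
      qed
      finally show "(\<Sum>k\<in>?S. \<integral>x. indicator (coset k 0) x * (G x * cnj (H (m + x))) \<partial>\<mu>)
        = (\<integral>x. G x * cnj (H (m + x)) \<partial>\<mu>)" .
    qed
    finally show ?thesis .
  qed
  ultimately show ?thesis by simp
qed

lemma disc_nat: "x \<in> disc N \<Longrightarrow> x \<in> disc (int (nat N))"
  using disc_mono[of N "int (nat N)"] by (meson nat_le_iff order_refl subsetD)

subsection \<open>Tame test functions\<close>

definition annulus :: "int \<Rightarrow> 'k set" where
  "annulus M = disc M - disc (- M - 1)"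

text \<open>Bounded functions supported away from 0 and infinity serve as test functions. The number of dilates of the support
  that meet a point is bounded, which is the source of all convergence below.\<close>
definition tame :: "int \<Rightarrow> real \<Rightarrow> ('k \<Rightarrow> complex) \<Rightarrow> bool" where
  "tame M B f \<longleftrightarrow> f \<in> borel_measurable \<mu> \<and> (\<forall>x. cmod (f x) \<le> B) \<and> (\<forall>x. x \<notin> annulus M \<longrightarrow> f x = 0)"

lemma annulus_sets [measurable, simp]: "annulus M \<in> sets borel" by (simp add: annulus_def)

lemma annulus_subset_disc: "annulus M \<subseteq> disc M" by (auto simp: annulus_def)

lemma emeasure_annulus_finite: "emeasure \<mu> (annulus M) < \<infinity>"
  using emeasure_mono[OF annulus_subset_disc, of M \<mu>] by (simp add: emeasure_disc le_less_trans)

lemma integrable_indicator_annulus: "integrable \<mu> (indicat_real (annulus M))"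
  using emeasure_annulus_finite by (simp add: integrable_indicator_iff)

lemma tame_bound_nonneg: "tame M B f \<Longrightarrow> B \<ge> 0"
  using order_trans[OF norm_ge_zero, of "f 0" B] by (auto simp: tame_def)

lemma tame_le: "tame M B f \<Longrightarrow> cmod (f x) \<le> B * indicat_real (annulus M) x"
  by (cases "x \<in> annulus M") (auto simp: tame_def)

lemma tame_L2: "tame M B f \<Longrightarrow> f \<in> L2 \<mu>"
proof (rule L2_dominated)
  assume f: "tame M B f"
  show "integrable \<mu> (\<lambda>x. B\<^sup>2 * indicat_real (annulus M) x)"
    by (intro Bochner_Integration.integrable_mult_right integrable_indicator_annulus)
  show "f \<in> borel_measurable \<mu>" using f by (simp add: tame_def)
  have le: "(cmod (f x))\<^sup>2 \<le> (B * indicat_real (annulus M) x)\<^sup>2" for x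
    using tame_le[OF f] by (intro power_mono) auto
  have eq: "(B * indicat_real (annulus M) x)\<^sup>2 = B\<^sup>2 * indicat_real (annulus M) x" for x
    by (simp add: indicator_def)
  show "AE x in \<mu>. (cmod (f x))\<^sup>2 \<le> B\<^sup>2 * indicat_real (annulus M) x"
    by (rule AE_I2) (rule le[unfolded eq])
qed

text \<open>Tame functions are dense: cut a function off to an annulus and to its small values.\<close>
lemma tame_dense:
  assumes f: "f \<in> L2 \<mu>" and r: "r > 0"
  shows "\<exists>g. (\<exists>M B. tame M B g) \<and> L2_norm \<mu> (\<lambda>x. f x - g x) < r"
proof -
  define g where "g m x = (if x \<in> annulus (int m) \<and> cmod (f x) \<le> real m then f x else 0)" for m :: nat and x
  have [measurable]: "f \<in> borel_measurable borel" using L2_measurable[OF f] by simp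
  have gm [measurable]: "g m \<in> borel_measurable borel" for m unfolding g_def by measurable
  have tame: "tame (int m) (real m) (g m)" for m by (auto simp: tame_def g_def)
  define f' where "f' x = (if x = 0 then 0 else f x)" for x
  have f': "AE x in \<mu>. f x = f' x" using AE_nonzero by (rule eventually_mono) (simp add: f'_def)
  have [measurable]: "f' \<in> borel_measurable borel" unfolding f'_def by measurable
  have f'2: "f' \<in> L2 \<mu>" using L2_cong_AE[OF f _ f'] by simp
  have "(\<lambda>m. L2_norm \<mu> (\<lambda>x. f' x - g m x)) \<longlonglongrightarrow> 0"
  proof (rule L2_norm_tendsto_0_dominated)
    fix x
    show "(\<lambda>m. f' x - g m x) \<longlonglongrightarrow> 0"
    proof (cases "x = 0")
      case True
      have "0 \<notin> annulus N" for N by (simp add: annulus_def)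
      then show ?thesis using True by (simp add: f'_def g_def)
    next
      case False
      then obtain N where N: "x \<notin> disc N" by (rule not_in_small_disc)
      obtain n :: nat where n: "x \<in> disc (int n)" using ex_disc by blast
      obtain k :: nat where k: "cmod (f x) \<le> real k" using real_arch_simple by blast
      have z: "f' x - g m x = 0" if "m \<ge> max (nat (- N)) (max n k)" for m
      proof -
        have "x \<in> disc (int m)" using n disc_mono[of "int n" "int m"] that by auto
        moreover have "- int m - 1 \<le> N" using that by linarith
        then have "x \<notin> disc (- int m - 1)" using N disc_mono by blast
        moreover have "cmod (f x) \<le> real m" using k that by (meson max.bounded_iff of_nat_le_iff order_trans)
        ultimately show ?thesis using False by (simp add: g_def f'_def annulus_def)
      qed
      show ?thesis by (rule tendsto_eventually, rule eventually_sequentiallyI) (rule z)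
    qed
  next
    show "cmod (f' x - g m x) \<le> cmod (f' x)" for m x by (auto simp: g_def f'_def annulus_def)
    show "(\<lambda>x. f' x - g m x) \<in> borel_measurable \<mu>" for m by measurable
    show "f' \<in> L2 \<mu>" by (rule f'2)
  qed
  then have "eventually (\<lambda>m. L2_norm \<mu> (\<lambda>x. f' x - g m x) < r) sequentially" using r by (rule order_tendstoD)
  then obtain m where m: "L2_norm \<mu> (\<lambda>x. f' x - g m x) < r" by (auto simp: eventually_at_top_linorder)
  moreover have "L2_norm \<mu> (\<lambda>x. f x - g m x) = L2_norm \<mu> (\<lambda>x. f' x - g m x)"
    using f' by (intro L2_norm_cong_AE) (auto elim: eventually_mono)
  ultimately have "L2_norm \<mu> (\<lambda>x. f x - g m x) < r" by simp
  moreover have "\<exists>M B. tame M B (g m)" using tame[of m] by (intro exI)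
  ultimately show ?thesis by (intro exI[of _ "g m"] conjI)
qed

subsection \<open>The frame coefficients on the Fourier side\<close>

text \<open>If \<open>\<phi>\<close> is the transform of \<open>\<eta>\<close>, then this is the transform of \<open>D j (T k \<eta>)\<close> up to a null set.\<close>
definition wave :: "('k \<Rightarrow> complex) \<Rightarrow> int \<Rightarrow> nat \<Rightarrow> 'k \<Rightarrow> complex" where
  "wave \<phi> j k = D (- j) (\<lambda>\<zeta>. cnj (chi (v k * \<zeta>)) * \<phi> \<zeta>)"

text \<open>The inner products of \<open>f\<close> with all waves of level \<open>j\<close> are the values on the lattice of the transform of a
  dilate of this product. The correlations of these products therefore govern the sums of inner products.\<close>
definition windowed :: "('k \<Rightarrow> complex) \<Rightarrow> int \<Rightarrow> ('k \<Rightarrow> complex) \<Rightarrow> 'k \<Rightarrow> complex" where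
  "windowed \<phi> j f x = f x * cnj (\<phi> (\<pp> powi j * x))"

definition wave_corr :: "('k \<Rightarrow> complex) \<Rightarrow> ('k \<Rightarrow> complex) \<Rightarrow> ('k \<Rightarrow> complex) \<Rightarrow> int \<Rightarrow> 'k \<Rightarrow> complex" where
  "wave_corr \<phi> f g j l = (\<integral>x. windowed \<phi> j f x * cnj (windowed \<phi> j g (l + x)) \<partial>\<mu>)"

lemma wave_L2 [simp]: "\<phi> \<in> L2 \<mu> \<Longrightarrow> wave \<phi> j k \<in> L2 \<mu>"
  unfolding wave_def by (intro dilation_L2 modulation_L2)

lemma windowed_L2: "tame M B f \<Longrightarrow> \<phi> \<in> L2 \<mu> \<Longrightarrow> windowed \<phi> j f \<in> L2 \<mu>"
  unfolding windowed_def[abs_def]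
  by (rule L2_bounded_mult[OF L2_cnj[OF comp_dilate_L2]]) (auto simp: tame_def)

lemma wave_coeff:
  assumes \<phi>: "\<phi> \<in> L2 \<mu>" and f: "f \<in> L2 \<mu>"
  shows "L2_inner \<mu> f (wave \<phi> j k) = (\<integral>x. D j (windowed \<phi> j f) x * chi (v k * x) \<partial>\<mu>)"
proof -
  let ?m = "\<lambda>\<zeta>. cnj (chi (v k * \<zeta>)) * \<phi> \<zeta>"
  have "L2_inner \<mu> f (wave \<phi> j k) = L2_inner \<mu> (D j f) (D j (wave \<phi> j k))"
    using \<phi> f by (intro dilation_inner[symmetric] L2_measurable) simp_all
  also have "D j (wave \<phi> j k) = ?m" by (simp add: wave_def dilation_dilation)
  also have "L2_inner \<mu> (D j f) ?m = (\<integral>x. D j (windowed \<phi> j f) x * chi (v k * x) \<partial>\<mu>)"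
    unfolding L2_inner_def
  proof (rule Bochner_Integration.integral_cong[OF refl])
    fix x
    have arg: "\<pp> powi j * (\<pp> powi (- j) * x) = x" by (simp add: power_int_minus)
    show "D j f x * cnj (?m x) = D j (windowed \<phi> j f) x * chi (v k * x)"
      unfolding dilation_def windowed_def arg by (simp only: complex_cnj_mult complex_cnj_cnj mult_ac)
  qed
  finally show ?thesis .
qed

lemma windowed_supp: "tame M B f \<Longrightarrow> x \<notin> disc M \<Longrightarrow> windowed \<phi> j f x = 0"
  using annulus_subset_disc[of M] by (auto simp: tame_def windowed_def)

lemma dilation_corr:
  assumes "f \<in> L2 \<mu>" "g \<in> L2 \<mu>"
  shows "(\<integral>x. D j f x * cnj (D j g (m + x)) \<partial>\<mu>) = (\<integral>x. f x * cnj (g (\<pp> powi (- j) * m + x)) \<partial>\<mu>)"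
proof -
  let ?g = "\<lambda>x. g (\<pp> powi (- j) * m + x)"
  have "D j g (m + x) = D j ?g x" for x by (simp add: dilation_def distrib_left)
  then have "(\<integral>x. D j f x * cnj (D j g (m + x)) \<partial>\<mu>) = L2_inner \<mu> (D j f) (D j ?g)" by (simp add: L2_inner_def)
  also have "\<dots> = L2_inner \<mu> f ?g" using assms by (intro dilation_inner L2_measurable comp_translate_L2)
  finally show ?thesis by (simp only: L2_inner_def)
qed

lemma wave_corr_zero:
  assumes f: "tame M B f" and g: "tame M B g" and l: "l \<notin> disc M"
  shows "wave_corr \<phi> f g j l = 0"
proof -
  have zero: "windowed \<phi> j f x * cnj (windowed \<phi> j g (l + x)) = 0" for x
  proof (cases "x \<in> disc M")
    case True
    then have "l + x \<notin> disc M" using l by simp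
    then show ?thesis using windowed_supp[OF g] by simp
  qed (simp add: windowed_supp[OF f])
  show ?thesis unfolding wave_corr_def zero by simp
qed

text \<open>The lattice Parseval identity at a single level. After undoing the dilation the lattice points \<open>m\<close> appear as
  shifts by \<open>\<pp> powi (- j) * m\<close>.\<close>
lemma level_Parseval:
  assumes \<phi>: "\<phi> \<in> L2 \<mu>" and f: "tame M B f" and g: "tame M B g"
  shows "((\<lambda>k. L2_inner \<mu> f (wave \<phi> j k) * cnj (L2_inner \<mu> g (wave \<phi> j k)))
    has_sum (\<Sum>m\<in>lat \<inter> disc (int (nat (M - j))). wave_corr \<phi> f g j (\<pp> powi (- j) * m))) UNIV"
proof -
  let ?R = "nat (M - j)"
  have supp: "D j (windowed \<phi> j h) x = 0" if h: "tame M B h" and x: "x \<notin> disc (int ?R)" for h x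
  proof -
    have "x \<notin> disc (M - j)" using x disc_nat by blast
    then have "\<pp> powi (- j) * x \<notin> disc M" unfolding pp_powi_mult_disc by simp
    then show ?thesis using windowed_supp[OF h] by (simp add: dilation_def)
  qed
  have "((\<lambda>l. (\<integral>x. D j (windowed \<phi> j f) x * chi (l * x) \<partial>\<mu>) * cnj (\<integral>x. D j (windowed \<phi> j g) x * chi (l * x) \<partial>\<mu>))
    has_sum (\<Sum>m\<in>lat \<inter> disc (int ?R). \<integral>x. D j (windowed \<phi> j f) x * cnj (D j (windowed \<phi> j g) (m + x)) \<partial>\<mu>)) lat"
    by (rule lattice_Parseval[OF dilation_L2[OF windowed_L2[OF f \<phi>]] dilation_L2[OF windowed_L2[OF g \<phi>]] supp[OF f] supp[OF g]])
  then have "((\<lambda>k. (\<integral>x. D j (windowed \<phi> j f) x * chi (v k * x) \<partial>\<mu>) * cnj (\<integral>x. D j (windowed \<phi> j g) x * chi (v k * x) \<partial>\<mu>))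
    has_sum (\<Sum>m\<in>lat \<inter> disc (int ?R). \<integral>x. D j (windowed \<phi> j f) x * cnj (D j (windowed \<phi> j g) (m + x)) \<partial>\<mu>)) UNIV"
    using has_sum_reindex_bij_betw[OF bij_v, of "\<lambda>l. (\<integral>x. D j (windowed \<phi> j f) x * chi (l * x) \<partial>\<mu>) * cnj (\<integral>x. D j (windowed \<phi> j g) x * chi (l * x) \<partial>\<mu>)"]
    by simp
  then show ?thesis
    unfolding dilation_corr[OF windowed_L2[OF f \<phi>] windowed_L2[OF g \<phi>]] wave_corr_def[symmetric]
      wave_coeff[OF \<phi> tame_L2[OF f]] wave_coeff[OF \<phi> tame_L2[OF g]] .
qed

lemma level_Parseval_lat:
  assumes \<phi>: "\<phi> \<in> L2 \<mu>" and f: "tame M B f" and g: "tame M B g"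
  shows "((\<lambda>m. wave_corr \<phi> f g j (\<pp> powi (- j) * m)) has_sum
    (\<Sum>m\<in>lat \<inter> disc (int (nat (M - j))). wave_corr \<phi> f g j (\<pp> powi (- j) * m))) lat"
proof (rule has_sum_finite_neutralI[OF finite_lat_disc])
  fix m assume "m \<in> lat - lat \<inter> disc (int (nat (M - j)))"
  then have "m \<notin> disc (M - j)" using disc_nat by blast
  then have "\<pp> powi (- j) * m \<notin> disc M" unfolding pp_powi_mult_disc by simp
  then show "wave_corr \<phi> f g j (\<pp> powi (- j) * m) = 0" by (rule wave_corr_zero[OF f g])
qed auto

subsection \<open>Absolute convergence\<close>

text \<open>The term of level \<open>j\<close> in the sum of the first condition, integrated over an annulus.\<close>
definition level_mass :: "('k \<Rightarrow> complex) \<Rightarrow> int \<Rightarrow> int \<Rightarrow> real" where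
  "level_mass \<phi> M j = (\<integral>x. indicator (annulus M) x * (cmod (\<phi> (\<pp> powi j * x)))\<^sup>2 \<partial>\<mu>)"

text \<open>A majorant for the correlations at level \<open>j\<close> of all test functions on an annulus with values in the unit disc.\<close>
definition corr_bound :: "('k \<Rightarrow> complex) \<Rightarrow> int \<Rightarrow> int \<Rightarrow> 'k \<Rightarrow> real" where
  "corr_bound \<phi> M j l = (\<integral>x. indicator (annulus M) x * indicator (annulus M) (l + x) *
     (cmod (\<phi> (\<pp> powi j * x)) * cmod (\<phi> (\<pp> powi j * (l + x)))) \<partial>\<mu>)"

lemma integrable_indicator_mult_real:
  fixes h :: "'k \<Rightarrow> real"
  shows "integrable \<mu> h \<Longrightarrow> A \<in> sets borel \<Longrightarrow> integrable \<mu> (\<lambda>x. indicator A x * h x)"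
  using integrable_mult_indicator[of A \<mu> h] by simp

lemma level_mass_integrable: "\<phi> \<in> L2 \<mu> \<Longrightarrow> integrable \<mu> (\<lambda>x. indicator (annulus M) x * (cmod (\<phi> (\<pp> powi j * x)))\<^sup>2)"
  by (intro integrable_indicator_mult_real L2_integrable_square comp_dilate_L2) simp_all

lemma level_mass_nonneg: "level_mass \<phi> M j \<ge> 0"
  unfolding level_mass_def by (intro integral_nonneg_AE) simp

lemma corr_product_integrable:
  "\<phi> \<in> L2 \<mu> \<Longrightarrow> integrable \<mu> (\<lambda>x. cmod (\<phi> (\<pp> powi j * x)) * cmod (\<phi> (\<pp> powi j * (l + x))))"
  using integrable_norm[OF L2_integrable_mult[OF comp_dilate_L2[of \<phi> j] comp_translate_L2[OF comp_dilate_L2[of \<phi> j], of l]]]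
  by (simp add: norm_mult)

lemma corr_bound_integrable:
  "\<phi> \<in> L2 \<mu> \<Longrightarrow> integrable \<mu> (\<lambda>x. indicator (annulus M) x * indicator (annulus M) (l + x) *
     (cmod (\<phi> (\<pp> powi j * x)) * cmod (\<phi> (\<pp> powi j * (l + x)))))"
proof (rule Bochner_Integration.integrable_bound[OF corr_product_integrable])
  assume \<phi>: "\<phi> \<in> L2 \<mu>"
  show "\<phi> \<in> L2 \<mu>" by (rule \<phi>)
  have [measurable]: "\<phi> \<in> borel_measurable borel" using L2_measurable[OF \<phi>] by simp
  have [measurable]: "(\<lambda>x. \<pp> powi j * (l + x)) \<in> borel_measurable borel"
    using measurable_compose[OF measurable_translate measurable_dilate] .
  have "(\<lambda>x. indicator (annulus M) (l + x) :: real) \<in> borel_measurable borel"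
    using measurable_compose[OF measurable_translate borel_measurable_indicator[OF annulus_sets]] .
  then show "(\<lambda>x. indicator (annulus M) x * indicator (annulus M) (l + x) *
     (cmod (\<phi> (\<pp> powi j * x)) * cmod (\<phi> (\<pp> powi j * (l + x))))) \<in> borel_measurable \<mu>" by measurable
qed (auto simp: indicator_def)

lemma corr_bound_nonneg: "corr_bound \<phi> M j l \<ge> 0"
  unfolding corr_bound_def by (intro integral_nonneg_AE) simp

text \<open>The inequality between the geometric and the arithmetic mean; both of the resulting integrals are at most the level
  mass by translation invariance.\<close>
lemma corr_bound_le:
  assumes \<phi>: "\<phi> \<in> L2 \<mu>" shows "corr_bound \<phi> M j l \<le> level_mass \<phi> M j"
proof -
  define h where "h = (\<lambda>x. indicator (annulus M) x * (cmod (\<phi> (\<pp> powi j * x)))\<^sup>2)"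
  have h: "integrable \<mu> h" unfolding h_def using \<phi> by (rule level_mass_integrable)
  have "corr_bound \<phi> M j l \<le> (\<integral>x. (h x + h (l + x)) / 2 \<partial>\<mu>)"
    unfolding corr_bound_def
  proof (rule integral_mono[OF corr_bound_integrable[OF \<phi>]])
    show "integrable \<mu> (\<lambda>x. (h x + h (l + x)) / 2)"
      using h integrable_translate[OF h] by simp
    fix x
    show "indicator (annulus M) x * indicator (annulus M) (l + x) *
     (cmod (\<phi> (\<pp> powi j * x)) * cmod (\<phi> (\<pp> powi j * (l + x)))) \<le> (h x + h (l + x)) / 2"
      using sum_squares_bound[of "cmod (\<phi> (\<pp> powi j * x))" "cmod (\<phi> (\<pp> powi j * (l + x)))"]
      by (auto simp: h_def indicator_def)
  qed
  also have "\<dots> = ((\<integral>x. h x \<partial>\<mu>) + (\<integral>x. h (l + x) \<partial>\<mu>)) / 2"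
    using h integrable_translate[OF h, of l] by simp
  also have "\<dots> = level_mass \<phi> M j"
    unfolding integral_translate[OF borel_measurable_integrable[OF h]] by (simp add: level_mass_def h_def)
  finally show ?thesis .
qed

lemma corr_bound_zero: "l \<notin> disc M \<Longrightarrow> corr_bound \<phi> M j l = 0"
proof -
  assume l: "l \<notin> disc M"
  have "x \<notin> annulus M \<or> l + x \<notin> annulus M" for x
    using l annulus_subset_disc[of M] by (metis disc_add_iff subsetD)
  then have "indicator (annulus M) x * indicator (annulus M) (l + x) = (0::real)" for x
    by (metis indicator_simps(2) mult_zero_left mult_zero_right)
  then show ?thesis by (simp only: corr_bound_def mult_zero_left integral_zero)
qed

text \<open>A nonzero point lies in a given annulus after at most \<open>2 M + 1\<close> dilations.\<close>
lemma sum_indicator_dilated_annulus: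
  assumes "finite F"
  shows "(\<Sum>j\<in>F. indicator (annulus M) (\<pp> powi (- j) * x)) \<le> real (nat (2 * M + 1))"
proof (cases "x = 0")
  case True
  have "0 \<notin> annulus M" by (simp add: annulus_def)
  then show ?thesis using True by simp
next
  case False
  then obtain r where r: "absval x = real q powi r" by (rule absval_cases)
  have mem: "\<pp> powi (- j) * x \<in> annulus M \<longleftrightarrow> j \<in> {- M - r..M - r}" for j
    unfolding annulus_def Diff_iff pp_powi_mult_disc by (auto simp: disc_def r powi_le_iff)
  have "(\<Sum>j\<in>F. indicator (annulus M) (\<pp> powi (- j) * x)) = (\<Sum>j\<in>F. indicat_real {- M - r..M - r} j)"
    by (intro sum.cong refl) (simp only: mem indicator_def)
  also have "\<dots> = real (card (F \<inter> {- M - r..M - r}))" using assms by (simp add: indicator_def sum_of_bool_eq Int_def)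
  also have "\<dots> \<le> real (card {- M - r..M - r})" by (intro of_nat_mono card_mono) auto
  finally show ?thesis by (simp add: algebra_simps)
qed

lemma sum_level_mass_le:
  assumes \<phi>: "\<phi> \<in> L2 \<mu>" and F: "finite F"
  shows "(\<Sum>j\<in>F. real q powi (- j) * level_mass \<phi> M j) \<le> real (nat (2 * M + 1)) * (L2_norm \<mu> \<phi>)\<^sup>2"
proof -
  have [measurable]: "\<phi> \<in> borel_measurable borel" using L2_measurable[OF \<phi>] by simp
  define h where "h j x = indicator (annulus M) (\<pp> powi (- j) * x) * (cmod (\<phi> x))\<^sup>2" for j x
  have meas [measurable]: "(\<lambda>x. indicator (annulus M) (\<pp> powi i * x) :: real) \<in> borel_measurable borel" for i
    using measurable_compose[OF measurable_dilate borel_measurable_indicator[OF annulus_sets]] .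
  have h: "integrable \<mu> (h j)" for j
    unfolding h_def by (rule Bochner_Integration.integrable_bound[OF L2_integrable_square[OF \<phi>]]) (auto simp: indicator_def)
  have eq: "real q powi (- j) * level_mass \<phi> M j = (\<integral>x. h j x \<partial>\<mu>)" for j
  proof -
    have arg: "\<pp> powi j * (\<pp> powi (- j) * x) = x" for x by (simp add: power_int_minus)
    have m: "(\<lambda>x. indicator (annulus M) x * (cmod (\<phi> (\<pp> powi j * x)))\<^sup>2) \<in> borel_measurable \<mu>" by measurable
    have "(\<integral>x. h j x \<partial>\<mu>) = real q powi (- j) *\<^sub>R level_mass \<phi> M j"
      unfolding level_mass_def integral_dilate[OF m, symmetric] h_def arg ..
    then show ?thesis by simp
  qed
  have "(\<Sum>j\<in>F. real q powi (- j) * level_mass \<phi> M j) = (\<integral>x. (\<Sum>j\<in>F. h j x) \<partial>\<mu>)"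
    unfolding eq by (rule Bochner_Integration.integral_sum[OF h, symmetric])
  also have "\<dots> \<le> (\<integral>x. real (nat (2 * M + 1)) * (cmod (\<phi> x))\<^sup>2 \<partial>\<mu>)"
  proof (rule integral_mono)
    fix x
    show "(\<Sum>j\<in>F. h j x) \<le> real (nat (2 * M + 1)) * (cmod (\<phi> x))\<^sup>2"
      unfolding h_def sum_distrib_right[symmetric]
      by (intro mult_right_mono sum_indicator_dilated_annulus F) simp
  qed (use h \<phi> in auto)
  also have "\<dots> = real (nat (2 * M + 1)) * (L2_norm \<mu> \<phi>)\<^sup>2" by (simp add: L2_norm_square)
  finally show ?thesis .
qed

lemma summable_level_mass_low:
  assumes \<phi>: "\<phi> \<in> L2 \<mu>"
  shows "(\<lambda>j. real q powi (- j) * level_mass \<phi> M j) summable_on UNIV"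
  using sum_level_mass_le[OF \<phi>] level_mass_nonneg[of \<phi> M]
  by (intro nonneg_bdd_above_summable_on bdd_aboveI[of _ "real (nat (2 * M + 1)) * (L2_norm \<mu> \<phi>)\<^sup>2"])
    (auto intro!: mult_nonneg_nonneg)

text \<open>At level \<open>j \<le> M\<close> there are \<open>q powi (M - j)\<close> lattice points to be considered, and this number is
  compensated by the Jacobian of the dilation; at a level \<open>j > M\<close> only the point 0 matters.\<close>
lemma corr_bound_summable:
  assumes \<phi>: "\<phi> \<in> L2 \<mu>" and high: "(\<lambda>j. level_mass \<phi> M j) summable_on {j. j > M}"
  shows "(\<lambda>(j, m). corr_bound \<phi> M j (\<pp> powi (- j) * m)) summable_on (UNIV \<times> lat)"
proof -
  define N where "N j = real (card (lat \<inter> disc (int (nat (M - j)))))" for j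
  have "(\<lambda>j. N j * level_mass \<phi> M j) summable_on ({j. j \<le> M} \<union> {j. j > M})"
  proof (rule summable_on_Un_disjoint)
    have "(\<lambda>j. real q powi M * (real q powi (- j) * level_mass \<phi> M j)) summable_on {j. j \<le> M}"
      by (intro summable_on_cmult_right summable_on_subset[OF summable_level_mass_low[OF \<phi>]]) simp
    moreover have "N j * level_mass \<phi> M j = real q powi M * (real q powi (- j) * level_mass \<phi> M j)" if "j \<le> M" for j
    proof -
      have "N j = real q powi (M - j)" unfolding N_def card_lat_disc using that by (simp add: power_int_def)
      then show ?thesis by (simp add: power_int_diff power_int_minus divide_inverse)
    qed
    ultimately show "(\<lambda>j. N j * level_mass \<phi> M j) summable_on {j. j \<le> M}"
      by (subst summable_on_cong) auto
    have N1: "level_mass \<phi> M j = N j * level_mass \<phi> M j" if "j \<in> {j. j > M}" for j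
    proof -
      have "N j = 1" using card_lat_disc[of 0] that by (simp add: N_def)
      then show ?thesis by simp
    qed
    show "(\<lambda>j. N j * level_mass \<phi> M j) summable_on {j. j > M}"
      by (rule summable_on_cong[THEN iffD1, OF N1 high])
  qed auto
  also have "{j. j \<le> M} \<union> {j. j > M} = UNIV" by auto
  finally have sN: "(\<lambda>j. N j * level_mass \<phi> M j) summable_on UNIV" .
  have bound: "(\<Sum>x\<in>F. (\<lambda>(j, m). corr_bound \<phi> M j (\<pp> powi (- j) * m)) x) \<le> (\<Sum>\<^sub>\<infinity>j. N j * level_mass \<phi> M j)"
    if F: "finite F" "F \<subseteq> UNIV \<times> lat" for F
  proof -
    define J where "J = fst ` F"
    have J: "finite J" using F by (simp add: J_def)
    define E where "E = (SIGMA j:J. lat \<inter> disc (int (nat (M - j))))"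
    have fin_E: "finite (F \<union> E)" using F J finite_lat_disc by (auto simp: E_def)
    have zero: "corr_bound \<phi> M j (\<pp> powi (- j) * m) = 0" if "(j, m) \<in> F - E" for j m
    proof -
      have "j \<in> J" using that by (force simp: J_def)
      then have "m \<notin> disc (int (nat (M - j)))" using that F by (auto simp: E_def)
      then have "m \<notin> disc (M - j)" using disc_nat by blast
      then have "\<pp> powi (- j) * m \<notin> disc M" unfolding pp_powi_mult_disc by simp
      then show ?thesis by (rule corr_bound_zero)
    qed
    have "(\<Sum>x\<in>F. (\<lambda>(j, m). corr_bound \<phi> M j (\<pp> powi (- j) * m)) x)
        \<le> (\<Sum>x\<in>F \<union> E. (\<lambda>(j, m). corr_bound \<phi> M j (\<pp> powi (- j) * m)) x)"
      using fin_E corr_bound_nonneg by (intro sum_mono2) auto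
    also have "\<dots> = (\<Sum>x\<in>E. (\<lambda>(j, m). corr_bound \<phi> M j (\<pp> powi (- j) * m)) x)"
      using fin_E zero by (intro sum.mono_neutral_right) auto
    also have "\<dots> = (\<Sum>j\<in>J. \<Sum>m\<in>lat \<inter> disc (int (nat (M - j))). corr_bound \<phi> M j (\<pp> powi (- j) * m))"
      unfolding E_def using J finite_lat_disc by (subst sum.Sigma) auto
    also have "\<dots> \<le> (\<Sum>j\<in>J. \<Sum>m\<in>lat \<inter> disc (int (nat (M - j))). level_mass \<phi> M j)"
      by (intro sum_mono corr_bound_le \<phi>)
    also have "\<dots> = (\<Sum>j\<in>J. N j * level_mass \<phi> M j)" by (simp add: N_def)
    also have "\<dots> \<le> (\<Sum>\<^sub>\<infinity>j. N j * level_mass \<phi> M j)"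
      using sN J level_mass_nonneg by (intro finite_sum_le_infsum) (auto simp: N_def intro!: mult_nonneg_nonneg)
    finally show ?thesis .
  qed
  show ?thesis
  proof (rule nonneg_bdd_above_summable_on)
    show "0 \<le> (\<lambda>(j, m). corr_bound \<phi> M j (\<pp> powi (- j) * m)) x" for x
      by (simp add: corr_bound_nonneg split: prod.split)
    show "bdd_above (sum (\<lambda>(j, m). corr_bound \<phi> M j (\<pp> powi (- j) * m)) ` {F. F \<subseteq> UNIV \<times> lat \<and> finite F})"
    proof (rule bdd_aboveI2)
      fix F :: "(int \<times> 'k) set" assume "F \<in> {F. F \<subseteq> UNIV \<times> lat \<and> finite F}"
      then show "sum (\<lambda>(j, m). corr_bound \<phi> M j (\<pp> powi (- j) * m)) F \<le> (\<Sum>\<^sub>\<infinity>j. N j * level_mass \<phi> M j)"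
        by (intro bound) simp_all
    qed
  qed
qed

lemma wave_corr_integrable:
  assumes "\<phi> \<in> L2 \<mu>" "tame M B f" "tame M B g"
  shows "integrable \<mu> (\<lambda>x. windowed \<phi> j f x * cnj (windowed \<phi> j g (l + x)))"
  using assms by (intro L2_integrable_mult_cnj comp_translate_L2 windowed_L2)

lemma norm_wave_corr_integrand_le:
  assumes f: "tame M B f" and g: "tame M B g"
  shows "cmod (windowed \<phi> j f x * cnj (windowed \<phi> j g (l + x))) \<le>
    B\<^sup>2 * (indicator (annulus M) x * indicator (annulus M) (l + x) * (cmod (\<phi> (\<pp> powi j * x)) * cmod (\<phi> (\<pp> powi j * (l + x)))))"
proof -
  have "cmod (windowed \<phi> j f x * cnj (windowed \<phi> j g (l + x)))
      = (cmod (f x) * cmod (g (l + x))) * (cmod (\<phi> (\<pp> powi j * x)) * cmod (\<phi> (\<pp> powi j * (l + x))))"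
    by (simp add: windowed_def norm_mult mult_ac)
  also have "\<dots> \<le> ((B * indicator (annulus M) x) * (B * indicator (annulus M) (l + x))) *
      (cmod (\<phi> (\<pp> powi j * x)) * cmod (\<phi> (\<pp> powi j * (l + x))))"
    using tame_le[OF f, of x] tame_le[OF g, of "l + x"] tame_bound_nonneg[OF f]
    by (intro mult_right_mono mult_mono) auto
  finally show ?thesis by (simp add: power2_eq_square mult_ac)
qed

lemma integral_norm_wave_corr_le:
  assumes \<phi>: "\<phi> \<in> L2 \<mu>" and f: "tame M B f" and g: "tame M B g"
  shows "(\<integral>x. cmod (windowed \<phi> j f x * cnj (windowed \<phi> j g (l + x))) \<partial>\<mu>) \<le> B\<^sup>2 * corr_bound \<phi> M j l"
proof -
  have "(\<integral>x. cmod (windowed \<phi> j f x * cnj (windowed \<phi> j g (l + x))) \<partial>\<mu>) \<le>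
    (\<integral>x. B\<^sup>2 * (indicator (annulus M) x * indicator (annulus M) (l + x) * (cmod (\<phi> (\<pp> powi j * x)) * cmod (\<phi> (\<pp> powi j * (l + x))))) \<partial>\<mu>)"
    using wave_corr_integrable[OF \<phi> f g] corr_bound_integrable[OF \<phi>] norm_wave_corr_integrand_le[OF f g]
    by (intro integral_mono integrable_norm Bochner_Integration.integrable_mult_right)
  also have "\<dots> = B\<^sup>2 * corr_bound \<phi> M j l" by (simp only: corr_bound_def integral_mult_right_zero)
  finally show ?thesis .
qed

end

text \<open>If the sums of a summable family over a sequence of sets do not depend on the set, and these
  sets eventually exclude every index outside \<open>S0\<close>, then the sum over \<open>S0\<close> is the same.\<close>
lemma has_sum_shrink:
  fixes Z :: "'i \<Rightarrow> complex"
  assumes s: "(\<lambda>x. cmod (Z x)) summable_on S"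
    and c: "\<And>n::nat. ((\<lambda>x. if x \<in> D n then Z x else 0) has_sum c) S"
    and S0: "((\<lambda>x. if x \<in> S0 then Z x else 0) has_sum c') S" "\<And>n. S0 \<subseteq> D n"
    and D: "\<And>x. x \<in> S \<Longrightarrow> x \<notin> S0 \<Longrightarrow> \<exists>n0. \<forall>n\<ge>n0. x \<notin> D n"
  shows "c = c'"
proof -
  have le: "cmod (c - c') \<le> \<epsilon>" if \<epsilon>: "\<epsilon> > 0" for \<epsilon>
  proof -
    obtain F where F: "finite F" "F \<subseteq> S" "dist (sum (\<lambda>x. cmod (Z x)) F) (\<Sum>\<^sub>\<infinity>x\<in>S. cmod (Z x)) \<le> \<epsilon>"
      using has_sum_finite_approximation[OF has_sum_infsum[OF s] \<epsilon>] by blast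
    have "\<forall>x. \<exists>n0. x \<in> F - S0 \<longrightarrow> (\<forall>n\<ge>n0. x \<notin> D n)" using D F(2) by blast
    then obtain n0 where n0: "\<And>x n. x \<in> F - S0 \<Longrightarrow> n \<ge> n0 x \<Longrightarrow> x \<notin> D n" by metis
    define n where "n = Max (insert 0 (n0 ` F))"
    have n: "x \<notin> D n" if "x \<in> F - S0" for x
    proof (rule n0[OF that])
      show "n0 x \<le> n" unfolding n_def using F(1) that by (intro Max_ge) auto
    qed
    define W where "W x = (if x \<in> D n then Z x else 0) - (if x \<in> S0 then Z x else 0)" for x
    have W: "(W has_sum (c - c')) S" unfolding W_def
      using has_sum_add[OF c[of n] has_sum_uminusI[OF S0(1)]] by simp
    have W_le: "cmod (W x) \<le> cmod (Z x)" for x using S0(2)[of n] by (auto simp: W_def)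
    have W_F: "W x = 0" if "x \<in> F" for x
      using n[of x] that S0(2)[of n] by (auto simp: W_def)
    have sW: "(\<lambda>x. cmod (W x)) summable_on S"
      using s by (rule summable_on_comparison_test) (auto simp: W_le)
    have sD: "(\<lambda>x. cmod (Z x)) summable_on (S - F)"
      using s by (rule summable_on_subset_banach) auto
    have split: "infsum (\<lambda>x. cmod (Z x)) S = sum (\<lambda>x. cmod (Z x)) F + infsum (\<lambda>x. cmod (Z x)) (S - F)"
      using infsum_Un_disjoint[of "\<lambda>x. cmod (Z x)" F "S - F"] F(1,2) sD by (simp add: Un_absorb1)
    have "cmod (c - c') \<le> (\<Sum>\<^sub>\<infinity>x\<in>S. cmod (W x))"
      by (rule norm_has_sum_bound[OF has_sum_infsum[OF sW] W])
    also have "\<dots> = (\<Sum>\<^sub>\<infinity>x\<in>S - F. cmod (W x))"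
      using W_F by (intro infsum_cong_neutral) auto
    also have "\<dots> \<le> (\<Sum>\<^sub>\<infinity>x\<in>S - F. cmod (Z x))"
      by (rule infsum_mono[OF summable_on_subset_banach[OF sW Diff_subset] sD W_le])
    also have "\<dots> \<le> \<epsilon>" using F(3) split by (simp add: dist_real_def)
    finally show ?thesis .
  qed
  have "cmod (c - c') \<le> 0" by (rule field_le_epsilon) (simp add: le)
  then show ?thesis by simp
qed

context local_field_setup
begin

subsection \<open>Regrouping by the shift\<close>

text \<open>The pairs of a level \<open>j\<close> and a lattice point \<open>m\<close> are regrouped according to the shift \<open>l = \<pp> powi (- j) * m\<close>;
  these are the levels at which the shift \<open>l\<close> occurs.\<close>
definition levels :: "'k \<Rightarrow> int set" where
  "levels l = {j. \<pp> powi j * l \<in> lat}"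

definition shifts :: "'k set" where
  "shifts = {l. \<exists>j. \<pp> powi j * l \<in> lat}"

lemma pp_powi_cancel [simp]: "\<pp> powi j * (\<pp> powi (- j) * x) = x" "\<pp> powi (- j) * (\<pp> powi j * x) = x"
  by (simp_all add: power_int_minus)

lemma lat_subset_shifts: "l \<in> lat \<Longrightarrow> l \<in> shifts"
  unfolding shifts_def by (auto intro!: exI[of _ 0])

lemma levels_0: "levels 0 = UNIV" by (simp add: levels_def)

lemma countable_levels: "countable (levels l)" by simp

lemma bij_shifts: "bij_betw (\<lambda>(l, j). (j, \<pp> powi j * l)) (Sigma shifts levels) (UNIV \<times> lat)"
proof (rule bij_betw_byWitness[where f' = "\<lambda>(j, m). (\<pp> powi (- j) * m, j)"])
  have "\<pp> powi (- j) * m \<in> shifts" if "m \<in> lat" for j m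
    unfolding shifts_def using that by (auto intro!: exI[of _ j])
  then show "(\<lambda>(j, m). (\<pp> powi (- j) * m, j)) ` (UNIV \<times> lat) \<subseteq> Sigma shifts levels"
    by (auto simp: levels_def)
qed (auto simp: levels_def)

lemma corr_bound_summable_shifts:
  assumes "\<phi> \<in> L2 \<mu>" "(\<lambda>j. level_mass \<phi> M j) summable_on {j. j > M}"
  shows "(\<lambda>(l, j). corr_bound \<phi> M j l) summable_on (Sigma shifts levels)"
proof -
  have "(\<lambda>x. (\<lambda>(j, m). corr_bound \<phi> M j (\<pp> powi (- j) * m)) ((\<lambda>(l, j). (j, \<pp> powi j * l)) x)) summable_on (Sigma shifts levels)"
    unfolding summable_on_reindex_bij_betw[OF bij_shifts] by (rule corr_bound_summable[OF assms])
  then show ?thesis by (simp add: case_prod_unfold)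
qed

lemma norm_wave_corr_le:
  assumes "\<phi> \<in> L2 \<mu>" "tame M B f" "tame M B g"
  shows "cmod (wave_corr \<phi> f g j l) \<le> B\<^sup>2 * corr_bound \<phi> M j l"
  unfolding wave_corr_def
  by (rule order_trans[OF integral_norm_bound integral_norm_wave_corr_le[OF assms]])

text \<open>Sum the identities for the single levels. The family of correlations is absolutely summable, so the levels and
  shifts may be taken in any order.\<close>
theorem quadratic_form_expansion:
  assumes \<phi>: "\<phi> \<in> L2 \<mu>" and f: "tame M B f" and g: "tame M B g"
    and high: "(\<lambda>j. level_mass \<phi> M j) summable_on {j. j > M}"
  obtains S where
    "((\<lambda>(j, k). L2_inner \<mu> f (wave \<phi> j k) * cnj (L2_inner \<mu> g (wave \<phi> j k))) has_sum S) UNIV"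
    "((\<lambda>(l, j). wave_corr \<phi> f g j l) has_sum S) (Sigma shifts levels)"
proof -
  let ?C = "\<lambda>h j k. L2_inner \<mu> h (wave \<phi> j k)"
  define s where "s f g j = (\<Sum>m\<in>lat \<inter> disc (int (nat (M - j))). wave_corr \<phi> f g j (\<pp> powi (- j) * m))" for f g j
  have V: "\<exists>S. ((\<lambda>(l, j). wave_corr \<phi> f g j l) has_sum S) (Sigma shifts levels) \<and> (s f g has_sum S) UNIV"
    if f: "tame M B f" and g: "tame M B g" for f g
  proof -
    have sa: "(\<lambda>x. B\<^sup>2 * (\<lambda>(l, j). corr_bound \<phi> M j l) x) summable_on (Sigma shifts levels)"
      by (intro summable_on_cmult_right corr_bound_summable_shifts[OF \<phi> high])
    have "(\<lambda>x. cmod ((\<lambda>(l, j). wave_corr \<phi> f g j l) x)) summable_on (Sigma shifts levels)"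
      using sa by (rule summable_on_comparison_test) (auto intro: norm_wave_corr_le[OF \<phi> f g])
    then have "(\<lambda>(l, j). wave_corr \<phi> f g j l) summable_on (Sigma shifts levels)" by (rule abs_summable_summable)
    then obtain S where S: "((\<lambda>(l, j). wave_corr \<phi> f g j l) has_sum S) (Sigma shifts levels)"
      unfolding summable_on_def by blast
    have "(\<lambda>x. (\<lambda>(j, m). wave_corr \<phi> f g j (\<pp> powi (- j) * m)) ((\<lambda>(l, j). (j, \<pp> powi j * l)) x))
        = (\<lambda>(l, j). wave_corr \<phi> f g j l)" by (simp add: case_prod_unfold)
    then have "((\<lambda>(j, m). wave_corr \<phi> f g j (\<pp> powi (- j) * m)) has_sum S) (UNIV \<times> lat)"
      using S has_sum_reindex_bij_betw[OF bij_shifts, of "\<lambda>(j, m). wave_corr \<phi> f g j (\<pp> powi (- j) * m)" S] by simp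
    then have "(s f g has_sum S) UNIV"
    proof (rule has_sum_SigmaD)
      fix j
      show "((\<lambda>m. (\<lambda>(j, m). wave_corr \<phi> f g j (\<pp> powi (- j) * m)) (j, m)) has_sum s f g j) lat"
        using level_Parseval_lat[OF \<phi> f g, of j] by (simp add: s_def)
    qed
    then show ?thesis using S by blast
  qed
  have sq: "(\<lambda>(j, k). (cmod (?C h j k))\<^sup>2) summable_on (UNIV \<times> UNIV)" if h: "tame M B h" for h
  proof (rule summable_on_SigmaI)
    fix j :: int
    have "((\<lambda>k. ?C h j k * cnj (?C h j k)) has_sum s h h j) UNIV"
      unfolding s_def by (rule level_Parseval[OF \<phi> h h])
    then have "((\<lambda>k. Re (?C h j k * cnj (?C h j k))) has_sum Re (s h h j)) UNIV" by (rule has_sum_Re)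
    moreover have "Re (?C h j k * cnj (?C h j k)) = (cmod (?C h j k))\<^sup>2" for k
      by (simp add: complex_norm_square[symmetric] del: of_real_power)
    ultimately show "((\<lambda>k. (\<lambda>(j, k). (cmod (?C h j k))\<^sup>2) (j, k)) has_sum Re (s h h j)) UNIV" by simp
  next
    obtain S where "(s h h has_sum S) UNIV" using V[OF h h] by blast
    then show "(\<lambda>j. Re (s h h j)) summable_on UNIV" using has_sum_Re has_sum_imp_summable by blast
  qed auto
  have sC: "(\<lambda>(j, k). ?C f j k * cnj (?C g j k)) summable_on (UNIV \<times> UNIV)"
  proof (rule abs_summable_summable)
    have "(\<lambda>x. (\<lambda>(j, k). (cmod (?C f j k))\<^sup>2) x + (\<lambda>(j, k). (cmod (?C g j k))\<^sup>2) x) summable_on (UNIV \<times> UNIV)"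
      by (rule summable_on_add[OF sq[OF f] sq[OF g]])
    then show "(\<lambda>x. cmod ((\<lambda>(j, k). ?C f j k * cnj (?C g j k)) x)) summable_on (UNIV \<times> UNIV)"
      by (rule summable_on_comparison_test) (auto simp: norm_mult cmod_mult_le)
  qed
  obtain S where S: "((\<lambda>(l, j). wave_corr \<phi> f g j l) has_sum S) (Sigma shifts levels)" "(s f g has_sum S) UNIV"
    using V[OF f g] by blast
  have "((\<lambda>(j, k). ?C f j k * cnj (?C g j k)) has_sum S) (UNIV \<times> UNIV)"
  proof (rule has_sum_SigmaI[OF _ S(2) sC])
    fix j :: int
    show "((\<lambda>k. (\<lambda>(j, k). ?C f j k * cnj (?C g j k)) (j, k)) has_sum s f g j) UNIV"
      using level_Parseval[OF \<phi> f g, of j] by (simp add: s_def)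
  qed
  then show ?thesis using that S(1) by simp
qed

text \<open>A nonzero shift is a dilate of a lattice point whose last digit is nonzero, in exactly one way.\<close>
lemma levels_eq:
  assumes "\<pp> powi i * l = v s" "\<not> q dvd s"
  shows "levels l = {..i}"
proof -
  have "j \<le> i" if "\<pp> powi j * l \<in> lat" for j
  proof (rule ccontr)
    assume "\<not> j \<le> i"
    then have "\<pp> powi (i + 1) * l \<in> lat" using lat_powi_le[OF that] by simp
    moreover have "\<pp> powi (i + 1) * l = \<pp> * v s"
      using assms(1)[symmetric] by (simp add: power_int_add)
    ultimately show False using assms(2) not_q_dvd_iff by simp
  qed
  moreover have "\<pp> powi j * l \<in> lat" if "j \<le> i" for j
    using lat_powi_le[OF _ that, of l] assms(1) by (simp add: lat_def)
  ultimately show ?thesis by (auto simp: levels_def)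
qed

lemma shift_cases:
  assumes "l \<in> shifts" "l \<noteq> 0"
  obtains i s where "\<pp> powi i * l = v s" "\<not> q dvd s" "levels l = {..i}"
proof -
  obtain j0 where j0: "\<pp> powi j0 * l \<in> lat" using assms(1) by (auto simp: shifts_def)
  obtain r where r: "absval l = real q powi r" using assms(2) by (rule absval_cases)
  have bound: "j \<le> r" if "\<pp> powi j * l \<in> lat" for j
  proof (rule ccontr)
    assume "\<not> j \<le> r"
    then have "\<pp> powi j * l \<in> disc 0" unfolding pp_powi_mult_disc by (simp add: disc_def r powi_le_iff)
    then have "\<pp> powi j * l = 0" using lat_in_discD[OF that] by simp
    then show False using assms(2) by simp
  qed
  define A where "A = {j. j0 \<le> j \<and> \<pp> powi j * l \<in> lat}"
  have "A \<subseteq> {j0..r}" using bound by (auto simp: A_def)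
  then have A: "finite A" by (rule finite_subset) simp
  have ne: "A \<noteq> {}" using j0 by (auto simp: A_def)
  define i where "i = Max A"
  have i: "i \<in> A" unfolding i_def using A ne by (rule Max_in)
  have "i + 1 \<notin> A"
  proof
    assume "i + 1 \<in> A"
    then have "i + 1 \<le> i" unfolding i_def using A by (intro Max_ge)
    then show False by simp
  qed
  then have not: "\<pp> powi (i + 1) * l \<notin> lat" using i by (auto simp: A_def)
  obtain s where s: "\<pp> powi i * l = v s" using i by (auto simp: A_def lat_def)
  have "\<pp> powi (i + 1) * l = \<pp> * v s" unfolding s[symmetric] by (simp add: power_int_add)
  then have "\<not> q dvd s" using not not_q_dvd_iff by simp
  then show ?thesis using that s levels_eq by blast
qed

text \<open>For \<open>l = 0\<close> this is the sum in the first condition, and for any other shift it is, up to a dilation and complex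
  conjugation, a sum from the second condition.\<close>
definition shift_sum :: "('k \<Rightarrow> complex) \<Rightarrow> 'k \<Rightarrow> 'k \<Rightarrow> complex" where
  "shift_sum \<phi> l x = (\<Sum>\<^sub>\<infinity>j\<in>levels l. cnj (\<phi> (\<pp> powi j * x)) * \<phi> (\<pp> powi j * (l + x)))"

lemma windowed_product:
  "windowed \<phi> j f x * cnj (windowed \<phi> j g (l + x))
    = (f x * cnj (g (l + x))) * (cnj (\<phi> (\<pp> powi j * x)) * \<phi> (\<pp> powi j * (l + x)))"
  by (simp add: windowed_def mult_ac)

lemma shift_sum_integral:
  assumes \<phi>: "\<phi> \<in> L2 \<mu>" and f: "tame M B f" and g: "tame M B g"
    and high: "(\<lambda>j. level_mass \<phi> M j) summable_on {j. j > M}" and l: "l \<in> shifts"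
  shows "AE x in \<mu>. f x * cnj (g (l + x)) \<noteq> 0 \<longrightarrow>
      (\<lambda>j. cmod (cnj (\<phi> (\<pp> powi j * x)) * \<phi> (\<pp> powi j * (l + x)))) summable_on levels l"
    and "integrable \<mu> (\<lambda>x. (f x * cnj (g (l + x))) * shift_sum \<phi> l x)"
    and "((\<lambda>j. wave_corr \<phi> f g j l) has_sum (\<integral>x. (f x * cnj (g (l + x))) * shift_sum \<phi> l x \<partial>\<mu>)) (levels l)"
proof -
  have "(\<lambda>j. corr_bound \<phi> M j l) summable_on levels l"
    using corr_bound_summable_shifts[OF \<phi> high] l by (rule summable_on_SigmaD1[where f = "\<lambda>l j. corr_bound \<phi> M j l"])
  then have "(\<lambda>j. B\<^sup>2 * corr_bound \<phi> M j l) summable_on levels l" by (intro summable_on_cmult_right) simp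
  then have s: "(\<lambda>j. \<integral>x. cmod (windowed \<phi> j f x * cnj (windowed \<phi> j g (l + x))) \<partial>\<mu>) summable_on levels l"
    by (rule summable_on_comparison_test) (auto intro: integral_norm_wave_corr_le[OF \<phi> f g])
  note I = has_sum_integral[OF countable_levels wave_corr_integrable[OF \<phi> f g] s, unfolded windowed_product infsum_cmult_right']
  show "AE x in \<mu>. f x * cnj (g (l + x)) \<noteq> 0 \<longrightarrow>
      (\<lambda>j. cmod (cnj (\<phi> (\<pp> powi j * x)) * \<phi> (\<pp> powi j * (l + x)))) summable_on levels l"
    using I(1)
  proof (rule eventually_mono)
    fix x assume "(\<lambda>j. cmod ((f x * cnj (g (l + x))) * (cnj (\<phi> (\<pp> powi j * x)) * \<phi> (\<pp> powi j * (l + x))))) summable_on levels l"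
    then have "(\<lambda>j. cmod (f x * cnj (g (l + x))) * cmod (cnj (\<phi> (\<pp> powi j * x)) * \<phi> (\<pp> powi j * (l + x)))) summable_on levels l"
      unfolding norm_mult[of "f x * cnj (g (l + x))"] .
    then show "f x * cnj (g (l + x)) \<noteq> 0 \<longrightarrow>
      (\<lambda>j. cmod (cnj (\<phi> (\<pp> powi j * x)) * \<phi> (\<pp> powi j * (l + x)))) summable_on levels l"
      unfolding summable_on_cmult_right' by (auto simp: summable_on_cmult_right')
  qed
  show "integrable \<mu> (\<lambda>x. (f x * cnj (g (l + x))) * shift_sum \<phi> l x)"
    unfolding shift_sum_def by (rule I(2))
  show "((\<lambda>j. wave_corr \<phi> f g j l) has_sum (\<integral>x. (f x * cnj (g (l + x))) * shift_sum \<phi> l x \<partial>\<mu>)) (levels l)"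
    unfolding shift_sum_def wave_corr_def windowed_product by (rule I(3))
qed

subsection \<open>Sufficiency\<close>

text \<open>In the expansion of the quadratic form of a tame function all shifts except 0 contribute nothing, and the shift 0
  contributes the square of the norm. Tame functions are dense.\<close>
theorem Parseval_if_shift_sums:
  assumes \<phi>: "\<phi> \<in> L2 \<mu>"
    and diag: "AE x in \<mu>. ((\<lambda>j. (cmod (\<phi> (\<pp> powi j * x)))\<^sup>2) has_sum 1) UNIV"
    and off: "\<And>s. \<not> q dvd s \<Longrightarrow> AE x in \<mu>.
      (\<lambda>j::nat. \<phi> (\<pp> powi (- int j) * x) * cnj (\<phi> (\<pp> powi (- int j) * (x + v s)))) sums 0"
    and f: "f \<in> L2 \<mu>"
  shows "((\<lambda>(j, k). (cmod (L2_inner \<mu> f (wave \<phi> j k)))\<^sup>2) has_sum (L2_norm \<mu> f)\<^sup>2) UNIV"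
proof -
  have high: "(\<lambda>j. level_mass \<phi> M j) summable_on A" for M A
  proof (rule nonneg_bdd_above_summable_on)
    show "bdd_above (sum (\<lambda>j. level_mass \<phi> M j) ` {F. F \<subseteq> A \<and> finite F})"
    proof (rule bdd_aboveI2)
      fix F assume "F \<in> {F. F \<subseteq> A \<and> finite F}"
      then have F: "finite F" by simp
      have "sum (\<lambda>j. level_mass \<phi> M j) F = (\<integral>x. (\<Sum>j\<in>F. indicator (annulus M) x * (cmod (\<phi> (\<pp> powi j * x)))\<^sup>2) \<partial>\<mu>)"
        unfolding level_mass_def by (rule Bochner_Integration.integral_sum[OF level_mass_integrable[OF \<phi>], symmetric])
      also have "\<dots> \<le> (\<integral>x. indicator (annulus M) x \<partial>\<mu>)"
      proof (rule integral_mono_AE)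
        show "AE x in \<mu>. (\<Sum>j\<in>F. indicator (annulus M) x * (cmod (\<phi> (\<pp> powi j * x)))\<^sup>2) \<le> indicator (annulus M) x"
          using diag
        proof (rule eventually_mono)
          fix x assume "((\<lambda>j. (cmod (\<phi> (\<pp> powi j * x)))\<^sup>2) has_sum 1) UNIV"
          then have "(\<Sum>j\<in>F. (cmod (\<phi> (\<pp> powi j * x)))\<^sup>2) \<le> 1"
            using F by (intro finite_sum_le_has_sum) auto
          then show "(\<Sum>j\<in>F. indicator (annulus M) x * (cmod (\<phi> (\<pp> powi j * x)))\<^sup>2) \<le> indicator (annulus M) x"
            unfolding sum_distrib_left[symmetric] by (intro mult_left_le) auto
        qed
        show "integrable \<mu> (\<lambda>x. \<Sum>j\<in>F. indicator (annulus M) x * (cmod (\<phi> (\<pp> powi j * x)))\<^sup>2)"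
          by (intro Bochner_Integration.integrable_sum level_mass_integrable[OF \<phi>])
      qed (rule integrable_indicator_annulus)
      finally show "sum (\<lambda>j. level_mass \<phi> M j) F \<le> (\<integral>x. indicator (annulus M) x \<partial>\<mu>)" .
    qed
  qed (rule level_mass_nonneg)
  have tame_case: "((\<lambda>(j, k). (cmod (L2_inner \<mu> f (wave \<phi> j k)))\<^sup>2) has_sum (L2_norm \<mu> f)\<^sup>2) UNIV"
    if f: "tame M B f" for f M B
  proof -
    obtain S where S:
      "((\<lambda>(j, k). L2_inner \<mu> f (wave \<phi> j k) * cnj (L2_inner \<mu> f (wave \<phi> j k))) has_sum S) UNIV"
      "((\<lambda>(l, j). wave_corr \<phi> f f j l) has_sum S) (Sigma shifts levels)"
      using quadratic_form_expansion[OF \<phi> f f high] .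
    define I where "I l = (\<integral>x. (f x * cnj (f (l + x))) * shift_sum \<phi> l x \<partial>\<mu>)" for l
    have "(I has_sum S) shifts"
    proof (rule has_sum_SigmaD[OF S(2)])
      fix l assume "l \<in> shifts"
      then show "((\<lambda>j. (\<lambda>(l, j). wave_corr \<phi> f f j l) (l, j)) has_sum I l) (levels l)"
        using shift_sum_integral(3)[OF \<phi> f f high] by (simp add: I_def)
    qed
    moreover have I0: "I 0 = of_real ((L2_norm \<mu> f)\<^sup>2)"
    proof -
      have fm: "f \<in> borel_measurable \<mu>" using f by (simp add: tame_def)
      have "I 0 = (\<integral>x. f x * cnj (f x) \<partial>\<mu>)"
        unfolding I_def
      proof (rule integral_cong_AE)
        show "(\<lambda>x. (f x * cnj (f (0 + x))) * shift_sum \<phi> 0 x) \<in> borel_measurable \<mu>"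
          using shift_sum_integral(2)[OF \<phi> f f high lat_subset_shifts[OF lat_0]] by (rule borel_measurable_integrable)
        show "(\<lambda>x. f x * cnj (f x)) \<in> borel_measurable \<mu>" using fm by measurable
        show "AE x in \<mu>. (f x * cnj (f (0 + x))) * shift_sum \<phi> 0 x = f x * cnj (f x)"
          using diag
        proof (rule eventually_mono)
          fix x assume "((\<lambda>j. (cmod (\<phi> (\<pp> powi j * x)))\<^sup>2) has_sum 1) UNIV"
          then have "((\<lambda>j. complex_of_real ((cmod (\<phi> (\<pp> powi j * x)))\<^sup>2)) has_sum of_real 1) UNIV" by (rule has_sum_of_real)
          then have "shift_sum \<phi> 0 x = 1"
            unfolding shift_sum_def levels_0 complex_norm_square by (intro infsumI) (simp add: mult.commute)
          then show "(f x * cnj (f (0 + x))) * shift_sum \<phi> 0 x = f x * cnj (f x)" by simp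
        qed
      qed
      then show ?thesis using L2_inner_self[of \<mu> f] by (simp add: L2_inner_def)
    qed
    moreover have "I l = 0" if l: "l \<in> shifts" "l \<noteq> 0" for l
    proof -
      obtain i s where iv: "\<pp> powi i * l = v s" "\<not> q dvd s" "levels l = {..i}" using l by (rule shift_cases)
      have "AE x in \<mu>. (f x * cnj (f (l + x))) * shift_sum \<phi> l x = 0"
        using shift_sum_integral(1)[OF \<phi> f f high l(1)] AE_dilate[OF off[OF iv(2)], of i]
      proof eventually_elim
        case (elim x)
        show ?case
        proof (cases "f x * cnj (f (l + x)) = 0")
          case False
          define t where "t j = cnj (\<phi> (\<pp> powi j * x)) * \<phi> (\<pp> powi j * (l + x))" for j
          have "(\<lambda>j. cmod (t j)) summable_on levels l" using elim(1) False by (simp add: t_def)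
          then have "t summable_on levels l" by (rule abs_summable_summable)
          then have T: "(t has_sum shift_sum \<phi> l x) (levels l)" by (simp add: shift_sum_def t_def[abs_def])
          have bij: "bij_betw (\<lambda>r::nat. i - int r) UNIV (levels l)"
            unfolding iv(3) by (rule bij_betw_byWitness[where f' = "\<lambda>j. nat (i - j)"]) auto
          have "((\<lambda>r. t (i - int r)) has_sum shift_sum \<phi> l x) UNIV"
            using T unfolding has_sum_reindex_bij_betw[OF bij] .
          then have sums: "(\<lambda>r. t (i - int r)) sums shift_sum \<phi> l x" by (rule has_sum_imp_sums)
          have "(\<lambda>r. cnj (\<phi> (\<pp> powi (- int r) * (\<pp> powi i * x)) *
              cnj (\<phi> (\<pp> powi (- int r) * (\<pp> powi i * x + v s))))) sums cnj 0"
            using elim(2) unfolding sums_cnj .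
          moreover have "cnj (\<phi> (\<pp> powi (- int r) * (\<pp> powi i * x)) *
              cnj (\<phi> (\<pp> powi (- int r) * (\<pp> powi i * x + v s)))) = t (i - int r)" for r
          proof -
            have pw: "\<pp> powi (- int r) * (\<pp> powi i * y) = \<pp> powi (i - int r) * y" for y
              by (simp only: mult.assoc[symmetric] power_int_add[symmetric] pp_nonzero simp_thms) (simp add: add.commute)
            have "\<pp> powi i * x + v s = \<pp> powi i * (l + x)" by (simp add: iv(1)[symmetric] algebra_simps)
            then show ?thesis by (simp only: pw t_def complex_cnj_mult complex_cnj_cnj)
          qed
          ultimately have "(\<lambda>r. t (i - int r)) sums 0" by simp
          then have "shift_sum \<phi> l x = 0" using sums sums_unique2 by blast
          then show ?thesis by simp
        qed simp
      qed
      then show ?thesis unfolding I_def by (intro integral_eq_zero_AE)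
    qed
    then have "(I has_sum I 0) shifts"
      using lat_subset_shifts[OF lat_0] by (intro has_sum_finite_neutralI[of "{0}"]) auto
    ultimately have "S = of_real ((L2_norm \<mu> f)\<^sup>2)" using has_sum_unique by metis
    then have "((\<lambda>x. Re ((\<lambda>(j, k). L2_inner \<mu> f (wave \<phi> j k) * cnj (L2_inner \<mu> f (wave \<phi> j k))) x))
        has_sum Re (of_real ((L2_norm \<mu> f)\<^sup>2))) UNIV"
      using S(1) by (intro has_sum_Re) simp
    moreover have "Re ((\<lambda>(j, k). L2_inner \<mu> f (wave \<phi> j k) * cnj (L2_inner \<mu> f (wave \<phi> j k))) x)
        = (\<lambda>(j, k). (cmod (L2_inner \<mu> f (wave \<phi> j k)))\<^sup>2) x" for x
      by (simp add: case_prod_beta complex_norm_square[symmetric] del: of_real_power)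
    ultimately show ?thesis by simp
  qed
  have "((\<lambda>a. (cmod (L2_inner \<mu> f (wave \<phi> (fst a) (snd a))))\<^sup>2) has_sum (L2_norm \<mu> f)\<^sup>2) UNIV"
  proof (rule L2_Parseval_dense[of UNIV _ _ "{g. \<exists>M B. tame M B g}"])
    show "\<And>f r. f \<in> L2 \<mu> \<Longrightarrow> r > 0 \<Longrightarrow> \<exists>g\<in>{g. \<exists>M B. tame M B g}. L2_norm \<mu> (\<lambda>x. f x - g x) < r"
      using tame_dense by simp
    show "((\<lambda>a. (cmod (L2_inner \<mu> h (wave \<phi> (fst a) (snd a))))\<^sup>2) has_sum (L2_norm \<mu> h)\<^sup>2) UNIV"
      if "h \<in> {g. \<exists>M B. tame M B g}" for h
      using that tame_case[of _ _ h] by (auto simp: case_prod_unfold)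
  qed (use \<phi> f tame_L2 in auto)
  then show ?thesis by (simp add: case_prod_unfold)
qed


subsection \<open>Necessity\<close>

lemma tame_indicator: "A \<in> sets borel \<Longrightarrow> A \<subseteq> annulus M \<Longrightarrow> tame M 1 (indicator A)"
  by (auto simp: tame_def indicator_def)

text \<open>At a level above \<open>M\<close> the shift by a nonzero lattice point moves the annulus away from itself. So the level
  mass is the sum of the squared coefficients, at this level, of the indicator function of the annulus.\<close>
lemma level_mass_summable_if_Parseval:
  assumes \<phi>: "\<phi> \<in> L2 \<mu>"
    and P: "\<forall>f\<in>L2 \<mu>. ((\<lambda>(j, k). (cmod (L2_inner \<mu> f (wave \<phi> j k)))\<^sup>2) has_sum (L2_norm \<mu> f)\<^sup>2) UNIV"
  shows "(\<lambda>j. level_mass \<phi> M j) summable_on {j. j > M}"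
proof -
  define f :: "'k \<Rightarrow> complex" where "f = indicator (annulus M)"
  have f: "tame M 1 f" unfolding f_def by (rule tame_indicator) auto
  let ?c = "\<lambda>j k. (cmod (L2_inner \<mu> f (wave \<phi> j k)))\<^sup>2"
  have sum: "(\<lambda>(j, k). ?c j k) summable_on (UNIV \<times> UNIV)"
    using has_sum_imp_summable[OF P[rule_format, OF tame_L2[OF f]]] by simp
  have "?c j summable_on UNIV" for j using sum by (rule summable_on_SigmaD1) simp
  then have s: "(\<lambda>j. \<Sum>\<^sub>\<infinity>k. ?c j k) summable_on UNIV"
    using summable_on_SigmaD[of "\<lambda>(j, k). ?c j k" UNIV "\<lambda>_. UNIV"] sum by simp
  have "level_mass \<phi> M j = (\<Sum>\<^sub>\<infinity>k. ?c j k)" if "j > M" for j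
  proof -
    have "lat \<inter> disc (int (nat (M - j))) = {0}" using that lat_disc_trivial[of 0] by simp
    then have "((\<lambda>k. L2_inner \<mu> f (wave \<phi> j k) * cnj (L2_inner \<mu> f (wave \<phi> j k))) has_sum wave_corr \<phi> f f j 0) UNIV"
      using level_Parseval[OF \<phi> f f, of j] by simp
    then have "((\<lambda>k. Re (L2_inner \<mu> f (wave \<phi> j k) * cnj (L2_inner \<mu> f (wave \<phi> j k)))) has_sum Re (wave_corr \<phi> f f j 0)) UNIV"
      by (rule has_sum_Re)
    moreover have "Re (z * cnj z) = (cmod z)\<^sup>2" for z by (simp add: complex_norm_square[symmetric] del: of_real_power)
    ultimately have "(?c j has_sum Re (wave_corr \<phi> f f j 0)) UNIV" by simp
    moreover have "wave_corr \<phi> f f j 0 = of_real (level_mass \<phi> M j)"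
    proof -
      have "windowed \<phi> j f x * cnj (windowed \<phi> j f (0 + x)) = of_real (indicator (annulus M) x * (cmod (\<phi> (\<pp> powi j * x)))\<^sup>2)" for x
        unfolding windowed_product f_def
        by (cases "x \<in> annulus M") (simp_all add: complex_norm_square mult.commute del: of_real_power)
      then show ?thesis unfolding wave_corr_def level_mass_def by (simp only: integral_complex_of_real)
    qed
    ultimately show ?thesis by (simp add: infsumI)
  qed
  then show ?thesis using summable_on_subset_banach[OF s, of "{j. j > M}"] by (subst summable_on_cong) auto
qed

lemma coset_in_annulus:
  assumes "0 \<notin> coset a N"
  shows "\<exists>M0. \<forall>M\<ge>M0. coset a N \<subseteq> annulus M"
proof -
  have a: "a \<notin> disc N" using assms by (simp add: coset_def)
  obtain n :: nat where n: "a \<in> disc (int n)" using ex_disc by blast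
  have "coset a N \<subseteq> annulus M" if M: "M \<ge> max (int n) (max N (- N))" for M
  proof
    fix x assume "x \<in> coset a N"
    then have x: "x - a \<in> disc N" by (simp add: coset_def)
    have "x - a \<in> disc M" "a \<in> disc M" using x n M disc_mono[of N M] disc_mono[of "int n" M] by auto
    then have "x - a + a \<in> disc M" by (rule disc_add)
    moreover have "x \<notin> disc (- M - 1)"
    proof
      assume "x \<in> disc (- M - 1)"
      then have "x \<in> disc N" using M disc_mono[of "- M - 1" N] by auto
      then have "x - (x - a) \<in> disc N" using x by (rule disc_diff)
      then show False using a by simp
    qed
    ultimately show "x \<in> annulus M" by (simp add: annulus_def)
  qed
  then show ?thesis by blast
qed

text \<open>The shift by \<open>l\<close> moves the first coset onto the second one or to a set disjoint from it.\<close>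
lemma indicator_pair:
  "(indicator (coset b N) x :: complex) * cnj (indicator (coset (b + l0) N) (l + x))
    = (if l - l0 \<in> disc N then indicator (coset b N) x else 0)"
proof (cases "x \<in> coset b N")
  case True
  then have "x - b \<in> disc N" by (simp add: coset_def)
  then have "(l - l0) + (x - b) \<in> disc N \<longleftrightarrow> l - l0 \<in> disc N" by (rule disc_add_iff)
  moreover have "(l - l0) + (x - b) = (l + x) - (b + l0)" by simp
  ultimately have "l + x \<in> coset (b + l0) N \<longleftrightarrow> l - l0 \<in> disc N" by (simp only: coset_def mem_Collect_eq)
  then show ?thesis using True by (simp add: indicator_def)
qed simp

lemma wave_corr_indicator:
  "wave_corr \<phi> (indicator (coset b N)) (indicator (coset (b + l0) N)) j l
    = (if l - l0 \<in> disc N then \<integral>x. indicator (coset b N) x * (cnj (\<phi> (\<pp> powi j * x)) * \<phi> (\<pp> powi j * (l + x))) \<partial>\<mu> else 0)"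
  unfolding wave_corr_def windowed_product indicator_pair by simp

lemma integral_indicator_coset_complex: "(\<integral>x. (indicator (coset a N) x :: complex) \<partial>\<mu>) = of_real (real q powi N)"
  using integral_chi_coset[of a N 0] by simp

text \<open>Test the polarized identity on the pairs of indicator functions of a small coset and its translate by
  \<open>l0\<close>, and sum over the small cosets in a given one. Only shifts close to \<open>l0\<close> contribute, and as the
  small cosets shrink the contribution of \<open>l0\<close> alone remains.\<close>
lemma integral_shift_sum:
  assumes \<phi>: "\<phi> \<in> L2 \<mu>"
    and P: "\<forall>f\<in>L2 \<mu>. ((\<lambda>(j, k). (cmod (L2_inner \<mu> f (wave \<phi> j k)))\<^sup>2) has_sum (L2_norm \<mu> f)\<^sup>2) UNIV"
    and l0: "l0 \<in> lat" and N0: "N0 \<le> 0" and a: "0 \<notin> coset a N0" "0 \<notin> coset (a + l0) N0"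
  shows "AE x in \<mu>. x \<in> coset a N0 \<longrightarrow>
      (\<lambda>j. cmod (cnj (\<phi> (\<pp> powi j * x)) * \<phi> (\<pp> powi j * (l0 + x)))) summable_on levels l0"
    and "integrable \<mu> (\<lambda>x. indicator (coset a N0) x * shift_sum \<phi> l0 x)"
    and "(\<integral>x. indicator (coset a N0) x * shift_sum \<phi> l0 x \<partial>\<mu>) = (if l0 = 0 then of_real (real q powi N0) else 0)"
proof -
  obtain M1 M2 where "\<forall>M\<ge>M1. coset a N0 \<subseteq> annulus M" "\<forall>M\<ge>M2. coset (a + l0) N0 \<subseteq> annulus M"
    using coset_in_annulus[OF a(1)] coset_in_annulus[OF a(2)] by blast
  then have M: "coset a N0 \<subseteq> annulus (max M1 M2)" "coset (a + l0) N0 \<subseteq> annulus (max M1 M2)" by simp_all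
  define M where "M = max M1 M2"
  note M = M[folded M_def]
  have high: "(\<lambda>j. level_mass \<phi> M j) summable_on {j. j > M}" by (rule level_mass_summable_if_Parseval[OF \<phi> P])
  have tame: "tame M 1 (indicator (coset b N))" "tame M 1 (indicator (coset (b + l0) N))"
    if N: "N \<le> N0" "b \<in> coset a N0" for b N
  proof -
    have "coset b N \<subseteq> coset a N0" using coset_mono[OF N(1), of b] coset_eqI[OF N(2)] by simp
    then show "tame M 1 (indicator (coset b N))" using M(1) by (intro tame_indicator) auto
    have "b + l0 \<in> coset (a + l0) N0" using N(2) by (simp add: coset_def)
    then have "coset (b + l0) N \<subseteq> coset (a + l0) N0" using coset_mono[OF N(1), of "b + l0"] coset_eqI by simp
    then show "tame M 1 (indicator (coset (b + l0) N))" using M(2) by (intro tame_indicator) auto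
  qed
  note t0 = tame[OF order_refl coset_self]
  have l0s: "l0 \<in> shifts" using l0 by (rule lat_subset_shifts)
  have pair0: "(indicator (coset a N0) x :: complex) * cnj (indicator (coset (a + l0) N0) (l0 + x)) = indicator (coset a N0) x" for x
    unfolding indicator_pair by simp
  note I = shift_sum_integral[OF \<phi> t0 high l0s, unfolded pair0]
  show "AE x in \<mu>. x \<in> coset a N0 \<longrightarrow>
      (\<lambda>j. cmod (cnj (\<phi> (\<pp> powi j * x)) * \<phi> (\<pp> powi j * (l0 + x)))) summable_on levels l0"
    using I(1) by (rule eventually_mono) (simp add: indicator_def)
  show "integrable \<mu> (\<lambda>x. indicator (coset a N0) x * shift_sum \<phi> l0 x)" by (rule I(2))
  define c :: complex where "c = (if l0 = 0 then of_real (real q powi N0) else 0)"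
  define X where "X j l A = (\<integral>x. indicator A x * (cnj (\<phi> (\<pp> powi j * x)) * \<phi> (\<pp> powi j * (l + x))) \<partial>\<mu>)" for j l A
  define Z where "Z = (\<lambda>(l, j). wave_corr \<phi> (indicator (coset a N0)) (indicator (coset (a + l0) N0)) j l)"
  define S where "S = Sigma shifts levels"
  have Z: "Z (l, j) = (if l - l0 \<in> disc N0 then X j l (coset a N0) else 0)" for l j
    by (simp add: Z_def wave_corr_indicator X_def)
  have "c = (\<integral>x. indicator (coset a N0) x * shift_sum \<phi> l0 x \<partial>\<mu>)"
  proof (rule has_sum_shrink[of Z S "\<lambda>n. {x. fst x - l0 \<in> disc (N0 - int n)}" _ "{x. fst x = l0}"])
    have "(\<lambda>x. 1\<^sup>2 * (\<lambda>(l, j). corr_bound \<phi> M j l) x) summable_on S"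
      unfolding S_def by (intro summable_on_cmult_right corr_bound_summable_shifts[OF \<phi> high])
    then show "(\<lambda>x. cmod (Z x)) summable_on S"
      by (rule summable_on_comparison_test) (auto simp: Z_def intro: norm_wave_corr_le[OF \<phi> t0, simplified])
    show "{x. fst x = l0} \<subseteq> {x. fst x - l0 \<in> disc (N0 - int n)}" for n by auto
    show "\<exists>n0. \<forall>n\<ge>n0. x \<notin> {x. fst x - l0 \<in> disc (N0 - int n)}" if "x \<notin> {x. fst x = l0}" for x
    proof -
      have "fst x - l0 \<noteq> 0" using that by simp
      then obtain N1 where N1: "fst x - l0 \<notin> disc N1" by (rule not_in_small_disc)
      have "fst x - l0 \<notin> disc (N0 - int n)" if "n \<ge> nat (N0 - N1)" for n
      proof -
        have "N0 - int n \<le> N1" using that by linarith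
        then show ?thesis using N1 disc_mono by blast
      qed
      then show ?thesis by auto
    qed
    show "((\<lambda>x. if x \<in> {x. fst x = l0} then Z x else 0) has_sum (\<integral>x. indicator (coset a N0) x * shift_sum \<phi> l0 x \<partial>\<mu>)) S"
    proof -
      have bij: "bij_betw (\<lambda>j. (l0, j)) (levels l0) ({l0} \<times> levels l0)"
        by (rule bij_betw_byWitness[where f' = snd]) auto
      have "((\<lambda>j. Z (l0, j)) has_sum (\<integral>x. indicator (coset a N0) x * shift_sum \<phi> l0 x \<partial>\<mu>)) (levels l0)"
        using I(3) by (simp add: Z_def)
      then have "(Z has_sum (\<integral>x. indicator (coset a N0) x * shift_sum \<phi> l0 x \<partial>\<mu>)) ({l0} \<times> levels l0)"
        unfolding has_sum_reindex_bij_betw[OF bij] .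
      then show ?thesis
        by (rule has_sum_cong_neutral[THEN iffD1, rotated 3]) (use l0s in \<open>auto simp: S_def\<close>)
    qed
    show "((\<lambda>x. if x \<in> {x. fst x - l0 \<in> disc (N0 - int n)} then Z x else 0) has_sum c) S" for n
    proof -
      define N where "N = N0 - int n"
      have NN: "N \<le> N0" "N \<le> 0" "N0 - N = int n" using N0 by (simp_all add: N_def)
      define A where "A = lat \<inter> disc (N0 - N)"
      define b where "b m = a + \<pp> powi (- N) * m" for m
      have fin: "finite A" unfolding A_def by (rule finite_lat_disc)
      have part: "coset a N0 = (\<Union>m\<in>A. coset (b m) N)"
        unfolding A_def b_def by (rule coset_partition[OF NN(1)])
      have disj: "disjoint_family_on (\<lambda>m. coset (b m) N) A"
        using coset_partition_disjoint[of a N] by (auto simp: disjoint_family_on_def A_def b_def)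
      have b_in: "b m \<in> coset a N0" if "m \<in> A" for m using part that coset_self by blast
      have each: "((\<lambda>(l, j). wave_corr \<phi> (indicator (coset (b m) N)) (indicator (coset (b m + l0) N)) j l)
          has_sum (if l0 = 0 then of_real (real q powi N) else 0)) S" if m: "m \<in> A" for m
      proof -
        note tm = tame[OF NN(1) b_in[OF m]]
        obtain T where T: "((\<lambda>(j, k). L2_inner \<mu> (indicator (coset (b m) N)) (wave \<phi> j k) * cnj (L2_inner \<mu> (indicator (coset (b m + l0) N)) (wave \<phi> j k))) has_sum T) UNIV"
          "((\<lambda>(l, j). wave_corr \<phi> (indicator (coset (b m) N)) (indicator (coset (b m + l0) N)) j l) has_sum T) (Sigma shifts levels)"
          by (rule quadratic_form_expansion[OF \<phi> tm high])
        have "((\<lambda>x. L2_inner \<mu> (indicator (coset (b m) N)) (wave \<phi> (fst x) (snd x)) *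
              cnj (L2_inner \<mu> (indicator (coset (b m + l0) N)) (wave \<phi> (fst x) (snd x))))
            has_sum L2_inner \<mu> (indicator (coset (b m) N)) (indicator (coset (b m + l0) N))) UNIV"
        proof (rule L2_Parseval_bilinear)
          show "((\<lambda>x. (cmod (L2_inner \<mu> f (wave \<phi> (fst x) (snd x))))\<^sup>2) has_sum (L2_norm \<mu> f)\<^sup>2) UNIV" if "f \<in> L2 \<mu>" for f
            using P[rule_format, OF that] by (simp add: case_prod_unfold)
        qed (use \<phi> tame_L2[OF tm(1)] tame_L2[OF tm(2)] in auto)
        then have "T = L2_inner \<mu> (indicator (coset (b m) N)) (indicator (coset (b m + l0) N))"
          using T(1) by (simp add: case_prod_unfold has_sum_unique)
        also have "\<dots> = (if l0 = 0 then of_real (real q powi N) else 0)"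
        proof -
          have "(indicator (coset (b m) N) x :: complex) * cnj (indicator (coset (b m + l0) N) x)
            = (if l0 \<in> disc N then indicator (coset (b m) N) x else 0)" for x
            using indicator_pair[of "b m" N x l0 0] by simp
          \<comment> \<open>The radius is at most 1, so a nonzero lattice point moves the coset to a disjoint one.\<close>
          moreover have "l0 \<in> disc N \<longleftrightarrow> l0 = 0" using lat_in_discD[OF l0 _ NN(2)] by auto
          ultimately show ?thesis unfolding L2_inner_def by (simp add: integral_indicator_coset_complex)
        qed
        finally show ?thesis using T(2) by (simp add: S_def)
      qed
      have "((\<lambda>x. \<Sum>m\<in>A. (\<lambda>(l, j). wave_corr \<phi> (indicator (coset (b m) N)) (indicator (coset (b m + l0) N)) j l) x)
          has_sum (\<Sum>m\<in>A. if l0 = 0 then of_real (real q powi N) else 0)) S"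
        by (intro has_sum_finite_sum fin each)
      moreover have "(\<Sum>m\<in>A. if l0 = 0 then of_real (real q powi N) else 0) = c"
      proof -
        have "card A = q ^ n" unfolding A_def NN(3) by (rule card_lat_disc)
        moreover have "real (q ^ n) * real q powi N = real q powi N0"
          using power_int_add[of "real q" "int n" N] by (simp add: N_def)
        then have "complex_of_real (real (q ^ n)) * of_real (real q powi N) = of_real (real q powi N0)"
          by (simp only: of_real_mult[symmetric])
        ultimately show ?thesis by (simp add: c_def)
      qed
      moreover have "(\<Sum>m\<in>A. (\<lambda>(l, j). wave_corr \<phi> (indicator (coset (b m) N)) (indicator (coset (b m + l0) N)) j l) x)
          = (if x \<in> {x. fst x - l0 \<in> disc (N0 - int n)} then Z x else 0)" for x
      proof -
        obtain l j where x: "x = (l, j)" by (cases x)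
        show ?thesis
        proof (cases "l - l0 \<in> disc N")
          case True
          have int: "integrable \<mu> (\<lambda>y. indicator (coset (b m) N) y * (cnj (\<phi> (\<pp> powi j * y)) * \<phi> (\<pp> powi j * (l + y))))" for m
            using L2_integrable_mult[OF L2_times_indicator[OF L2_cnj[OF comp_dilate_L2[OF \<phi>]]] comp_translate_L2[OF comp_dilate_L2[OF \<phi>]]]
            by (simp add: mult.assoc)
          have "(\<Sum>m\<in>A. X j l (coset (b m) N))
            = (\<integral>y. (\<Sum>m\<in>A. indicator (coset (b m) N) y) * (cnj (\<phi> (\<pp> powi j * y)) * \<phi> (\<pp> powi j * (l + y))) \<partial>\<mu>)"
            unfolding X_def sum_distrib_right by (rule Bochner_Integration.integral_sum[OF int, symmetric])
          also have "\<dots> = X j l (coset a N0)"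
            unfolding X_def part indicator_UN_disjoint[OF fin disj] ..
          finally have "(\<Sum>m\<in>A. X j l (coset (b m) N)) = Z (l, j)"
            using True disc_mono[OF NN(1)] by (auto simp: Z)
          then show ?thesis using True by (simp add: x wave_corr_indicator X_def N_def)
        next
          case False
          then show ?thesis by (simp add: x wave_corr_indicator N_def)
        qed
      qed
      ultimately show ?thesis by simp
    qed
  qed
  then show "(\<integral>x. indicator (coset a N0) x * shift_sum \<phi> l0 x \<partial>\<mu>) = (if l0 = 0 then of_real (real q powi N0) else 0)"
    by (simp add: c_def)
qed

text \<open>Except for 0 and \<open>- l\<close>, every point lies in one of countably many small cosets that avoid these two points.\<close>
lemma AE_small_cosets:
  assumes "\<And>a N. N \<le> 0 \<Longrightarrow> 0 \<notin> coset a N \<Longrightarrow> 0 \<notin> coset (a + l) N \<Longrightarrow> AE x in \<mu>. x \<in> coset a N \<longrightarrow> Q x"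
  shows "AE x in \<mu>. Q x"
proof -
  define I where "I = {(n::nat, k). k \<in> lat \<and> 0 \<notin> coset (\<pp> powi int n * k) (- int n) \<and> 0 \<notin> coset (\<pp> powi int n * k + l) (- int n)}"
  have "I \<subseteq> UNIV \<times> lat" by (auto simp: I_def)
  then have cI: "countable I" by (rule countable_subset) (simp add: countable_lat)
  have "AE x in \<mu>. \<forall>y\<in>I. x \<in> coset (\<pp> powi int (fst y) * snd y) (- int (fst y)) \<longrightarrow> Q x"
    unfolding AE_ball_countable[OF cI] using assms by (auto simp: I_def)
  moreover have "AE x in \<mu>. l + x \<noteq> 0" by (rule AE_translate[OF AE_nonzero])
  ultimately show ?thesis using AE_nonzero
  proof eventually_elim
    case (elim x)
    obtain N1 where N1: "x \<notin> disc N1" using elim(3) by (rule not_in_small_disc)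
    obtain N2 where N2: "l + x \<notin> disc N2" using elim(2) by (rule not_in_small_disc)
    define n where "n = max (nat (- N1)) (nat (- N2))"
    have "- int n \<le> N1" "- int n \<le> N2" by (simp_all add: n_def)
    then have x: "x \<notin> disc (- int n)" "l + x \<notin> disc (- int n)" using N1 N2 disc_mono[of "- int n" N1] disc_mono[of "- int n" N2] by auto
    obtain k where k: "k \<in> lat" "\<pp> powi (- int n) * x - k \<in> disc 0" using lat_cover by blast
    let ?a = "\<pp> powi int n * k"
    have xa: "x \<in> coset ?a (- int n)" using k(2) coset_dilate[of "- int n" x k 0] by (simp add: coset_def)
    have a1: "coset ?a (- int n) = coset x (- int n)" using coset_eqI[OF xa] by simp
    have "l + x \<in> coset (?a + l) (- int n)" using xa by (simp add: coset_def algebra_simps)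
    then have a2: "coset (?a + l) (- int n) = coset (l + x) (- int n)" using coset_eqI by simp
    have "0 \<notin> coset y (- int n)" if "y \<notin> disc (- int n)" for y
      using that by (simp only: coset_def mem_Collect_eq diff_0 disc_minus not_False_eq_True)
    then have "(n, k) \<in> I" using x k(1) unfolding I_def mem_Collect_eq case_prod_conv a1 a2 by blast
    then show "Q x" using elim(1) xa by force
  qed
qed

lemma shift_sum_const:
  assumes \<phi>: "\<phi> \<in> L2 \<mu>"
    and P: "\<forall>f\<in>L2 \<mu>. ((\<lambda>(j, k). (cmod (L2_inner \<mu> f (wave \<phi> j k)))\<^sup>2) has_sum (L2_norm \<mu> f)\<^sup>2) UNIV"
    and l0: "l0 \<in> lat"
  shows "AE x in \<mu>. ((\<lambda>j. cnj (\<phi> (\<pp> powi j * x)) * \<phi> (\<pp> powi j * (l0 + x))) has_sum (if l0 = 0 then 1 else 0)) (levels l0)"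
proof (rule AE_small_cosets)
  let ?d = "if l0 = 0 then 1 else 0 :: complex"
  fix a N assume a: "N \<le> 0" "0 \<notin> coset a N" "0 \<notin> coset (a + l0) N"
  note I = integral_shift_sum[OF \<phi> P l0]
  have sc: "indicator A x *\<^sub>R z = indicator A x * z" for A and x :: 'k and z :: complex by (simp add: indicator_def)
  have ind: "integrable \<mu> (\<lambda>x. indicator (coset b N) x * ?d)" for b N
    using L2_integrable_mult[OF indicator_coset_L2 indicator_coset_L2, of b N b N]
    by (intro Bochner_Integration.integrable_mult_left) (simp add: indicator_def flip: of_bool_conj)
  have "AE x in \<mu>. x \<in> coset a N \<longrightarrow> shift_sum \<phi> l0 x - ?d = 0"
  proof (rule AE_zero_on_coset)
    show "set_integrable \<mu> (coset a N) (\<lambda>x. shift_sum \<phi> l0 x - ?d)"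
      unfolding set_integrable_def sc right_diff_distrib
      by (rule Bochner_Integration.integrable_diff[OF I(2)[OF a] ind])
    fix b M assume sub: "coset b M \<subseteq> coset a N"
    have "M \<le> N" using sub by (rule coset_subset_imp_le)
    then have M: "M \<le> 0" using a(1) by simp
    have ba: "b \<in> coset a N" using sub by auto
    have b1: "0 \<notin> coset b M" using sub a(2) by auto
    have "coset (b + l0) M \<subseteq> coset (a + l0) N"
    proof -
      have "b + l0 \<in> coset (a + l0) N" using ba by (simp add: coset_def)
      then show ?thesis using coset_mono[OF \<open>M \<le> N\<close>, of "b + l0"] coset_eqI by simp
    qed
    then have b2: "0 \<notin> coset (b + l0) M" using a(3) by auto
    note b = I(2,3)[OF M b1 b2]
    have "(LINT x:coset b M|\<mu>. shift_sum \<phi> l0 x - ?d)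
      = (\<integral>x. indicator (coset b M) x * shift_sum \<phi> l0 x \<partial>\<mu>) - (\<integral>x. indicator (coset b M) x * ?d \<partial>\<mu>)"
      unfolding set_lebesgue_integral_def sc right_diff_distrib by (rule Bochner_Integration.integral_diff[OF b(1) ind])
    also have "\<dots> = 0" unfolding b(2) by (simp add: integral_indicator_coset_complex)
    finally show "(LINT x:coset b M|\<mu>. shift_sum \<phi> l0 x - ?d) = 0" .
  qed
  then show "AE x in \<mu>. x \<in> coset a N \<longrightarrow>
      ((\<lambda>j. cnj (\<phi> (\<pp> powi j * x)) * \<phi> (\<pp> powi j * (l0 + x))) has_sum ?d) (levels l0)"
    using I(1)[OF a]
  proof eventually_elim
    case (elim x)
    show ?case
    proof
      assume x: "x \<in> coset a N"
      have "(\<lambda>j. cnj (\<phi> (\<pp> powi j * x)) * \<phi> (\<pp> powi j * (l0 + x))) summable_on levels l0"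
        by (rule abs_summable_summable) (use elim(2) x in simp)
      then have "((\<lambda>j. cnj (\<phi> (\<pp> powi j * x)) * \<phi> (\<pp> powi j * (l0 + x))) has_sum shift_sum \<phi> l0 x) (levels l0)"
        unfolding shift_sum_def by (rule has_sum_infsum)
      then show "((\<lambda>j. cnj (\<phi> (\<pp> powi j * x)) * \<phi> (\<pp> powi j * (l0 + x))) has_sum ?d) (levels l0)"
        using elim(1) x by simp
    qed
  qed
qed

theorem shift_sums_if_Parseval:
  assumes \<phi>: "\<phi> \<in> L2 \<mu>"
    and P: "\<forall>f\<in>L2 \<mu>. ((\<lambda>(j, k). (cmod (L2_inner \<mu> f (wave \<phi> j k)))\<^sup>2) has_sum (L2_norm \<mu> f)\<^sup>2) UNIV"
  shows "AE x in \<mu>. ((\<lambda>j. (cmod (\<phi> (\<pp> powi j * x)))\<^sup>2) has_sum 1) UNIV"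
    and "\<not> q dvd s \<Longrightarrow> AE x in \<mu>.
      (\<lambda>j::nat. \<phi> (\<pp> powi (- int j) * x) * cnj (\<phi> (\<pp> powi (- int j) * (x + v s)))) sums 0"
proof -
  show "AE x in \<mu>. ((\<lambda>j. (cmod (\<phi> (\<pp> powi j * x)))\<^sup>2) has_sum 1) UNIV"
    using shift_sum_const[OF \<phi> P lat_0]
  proof (rule eventually_mono)
    fix x assume "((\<lambda>j. cnj (\<phi> (\<pp> powi j * x)) * \<phi> (\<pp> powi j * (0 + x))) has_sum (if (0::'k) = 0 then 1 else 0)) (levels 0)"
    then have "((\<lambda>j. Re (cnj (\<phi> (\<pp> powi j * x)) * \<phi> (\<pp> powi j * x))) has_sum Re 1) UNIV"
      unfolding levels_0 by (intro has_sum_Re) simp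
    moreover have "Re (cnj z * z) = (cmod z)\<^sup>2" for z
      by (simp add: mult.commute complex_norm_square[symmetric] del: of_real_power)
    ultimately show "((\<lambda>j. (cmod (\<phi> (\<pp> powi j * x)))\<^sup>2) has_sum 1) UNIV" by simp
  qed
  assume s: "\<not> q dvd s"
  then have "v s \<noteq> 0" using inj_v v_0 by (metis dvd_0_right injD)
  have vs: "v s \<in> lat" by (simp add: lat_def)
  have lev: "levels (v s) = {..0}" by (rule levels_eq[OF _ s]) simp
  have bij: "bij_betw (\<lambda>r::nat. - int r) UNIV (levels (v s))"
    unfolding lev by (rule bij_betw_byWitness[where f' = "\<lambda>j. nat (- j)"]) auto
  show "AE x in \<mu>. (\<lambda>j::nat. \<phi> (\<pp> powi (- int j) * x) * cnj (\<phi> (\<pp> powi (- int j) * (x + v s)))) sums 0"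
    using shift_sum_const[OF \<phi> P vs]
  proof (rule eventually_mono)
    fix x assume "((\<lambda>j. cnj (\<phi> (\<pp> powi j * x)) * \<phi> (\<pp> powi j * (v s + x))) has_sum (if v s = 0 then 1 else 0)) (levels (v s))"
    then have "((\<lambda>j. cnj (\<phi> (\<pp> powi j * x)) * \<phi> (\<pp> powi j * (v s + x))) has_sum 0) (levels (v s))"
      using \<open>v s \<noteq> 0\<close> by simp
    then have "((\<lambda>r. cnj (\<phi> (\<pp> powi (- int r) * x)) * \<phi> (\<pp> powi (- int r) * (v s + x))) has_sum 0) UNIV"
      unfolding has_sum_reindex_bij_betw[OF bij, symmetric] .
    then have "(\<lambda>r. cnj (\<phi> (\<pp> powi (- int r) * x)) * \<phi> (\<pp> powi (- int r) * (v s + x))) sums cnj 0"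
      using has_sum_imp_sums by simp
    then have "(\<lambda>r. cnj (\<phi> (\<pp> powi (- int r) * x) * cnj (\<phi> (\<pp> powi (- int r) * (x + v s))))) sums cnj 0"
      by (simp only: complex_cnj_mult complex_cnj_cnj add.commute)
    then show "(\<lambda>j::nat. \<phi> (\<pp> powi (- int j) * x) * cnj (\<phi> (\<pp> powi (- int j) * (x + v s)))) sums 0"
      unfolding sums_cnj .
  qed
qed

end

section \<open>Super-wavelets\<close>

lemma L2_norm_sum_square_le:
  assumes f: "\<And>i. i \<in> I \<Longrightarrow> f i \<in> L2 M"
  shows "(L2_norm M (\<lambda>x. \<Sum>i\<in>I. f i x))\<^sup>2 \<le> real (card I) * (\<Sum>i\<in>I. (L2_norm M (f i))\<^sup>2)"
proof -
  have int: "integrable M (\<lambda>x. (cmod (f i x))\<^sup>2)" if "i \<in> I" for i using f[OF that] by simp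
  have "(L2_norm M (\<lambda>x. \<Sum>i\<in>I. f i x))\<^sup>2 = (\<integral>x. (cmod (\<Sum>i\<in>I. f i x))\<^sup>2 \<partial>M)" by (rule L2_norm_square)
  also have "\<dots> \<le> (\<integral>x. real (card I) * (\<Sum>i\<in>I. (cmod (f i x))\<^sup>2) \<partial>M)"
  proof (rule integral_mono)
    show "integrable M (\<lambda>x. (cmod (\<Sum>i\<in>I. f i x))\<^sup>2)"
      by (rule L2_integrable_square[OF L2_sum]) (rule f)
    show "integrable M (\<lambda>x. real (card I) * (\<Sum>i\<in>I. (cmod (f i x))\<^sup>2))"
      by (intro Bochner_Integration.integrable_mult_right Bochner_Integration.integrable_sum int)
    fix x
    have "(cmod (\<Sum>i\<in>I. f i x))\<^sup>2 \<le> (\<Sum>i\<in>I. cmod (f i x))\<^sup>2" by (intro power_mono norm_sum) simp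
    also have "\<dots> \<le> (\<Sum>i\<in>I. (cmod (f i x))\<^sup>2) * card I" by (rule sum_squared_le_sum_of_squares)
    finally show "(cmod (\<Sum>i\<in>I. f i x))\<^sup>2 \<le> real (card I) * (\<Sum>i\<in>I. (cmod (f i x))\<^sup>2)" by (simp add: mult.commute)
  qed
  also have "\<dots> = real (card I) * (\<Sum>i\<in>I. (L2_norm M (f i))\<^sup>2)"
  proof -
    have "(\<integral>x. (\<Sum>i\<in>I. (cmod (f i x))\<^sup>2) \<partial>M) = (\<Sum>i\<in>I. \<integral>x. (cmod (f i x))\<^sup>2 \<partial>M)"
      by (rule Bochner_Integration.integral_sum[OF int])
    then show ?thesis by (simp only: integral_mult_right_zero L2_norm_square)
  qed
  finally show ?thesis .
qed

text \<open>An orthonormal system in a direct sum whose components are Parseval frames is complete: for a vector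
  concentrated in one component Bessel's inequality is an equality.\<close>
lemma orthonormal_Parseval_components_complete:
  fixes E :: "'b \<Rightarrow> nat \<Rightarrow> 'a \<Rightarrow> complex"
  assumes E: "\<And>a i. i \<in> {1..n} \<Longrightarrow> E a i \<in> L2 M"
    and orth: "\<And>a b. (\<Sum>i=1..n. L2_inner M (E a i) (E b i)) = (if a = b then 1 else 0)"
    and P: "\<And>i f. i \<in> {1..n} \<Longrightarrow> f \<in> L2 M \<Longrightarrow>
      ((\<lambda>a. (cmod (L2_inner M f (E a i)))\<^sup>2) has_sum (L2_norm M f)\<^sup>2) UNIV"
    and F: "\<And>i. i \<in> {1..n} \<Longrightarrow> F i \<in> L2 M" and r: "r > 0"
  shows "\<exists>A z. finite A \<and> L2_sum_norm M n (\<lambda>i x. F i x - (\<Sum>a\<in>A. z a * E a i x)) < r"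
proof -
  define b where "b i a = L2_inner M (F i) (E a i)" for i a
  \<comment> \<open>One factor \<open>n\<close> comes from estimating the square of a sum of \<open>n\<close> errors by the sum of their squares, the other
    from adding up the errors of the \<open>n\<close> components; the summand 1 makes the final inequality strict.\<close>
  define e where "e = r\<^sup>2 / (real n * real n + 1)"
  have e: "e > 0" using r by (simp add: e_def add_nonneg_pos)
  have "\<exists>B. finite B \<and> (\<forall>A. finite A \<longrightarrow> B \<subseteq> A \<longrightarrow> (L2_norm M (F i))\<^sup>2 - (\<Sum>a\<in>A. (cmod (b i a))\<^sup>2) \<le> e)" if i: "i \<in> {1..n}" for i
  proof -
    obtain B where B: "finite B" "dist (\<Sum>a\<in>B. (cmod (b i a))\<^sup>2) ((L2_norm M (F i))\<^sup>2) \<le> e"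
      using has_sum_finite_approximation[OF P[OF i F[OF i]] e] unfolding b_def by blast
    have "(L2_norm M (F i))\<^sup>2 - (\<Sum>a\<in>A. (cmod (b i a))\<^sup>2) \<le> e" if "finite A" "B \<subseteq> A" for A
    proof -
      have "(\<Sum>a\<in>B. (cmod (b i a))\<^sup>2) \<le> (\<Sum>a\<in>A. (cmod (b i a))\<^sup>2)" using that by (intro sum_mono2) auto
      then show ?thesis using B(2) by (simp add: dist_real_def)
    qed
    then show ?thesis using B(1) by blast
  qed
  then have "\<forall>i. \<exists>B. i \<in> {1..n} \<longrightarrow> finite B \<and> (\<forall>A. finite A \<longrightarrow> B \<subseteq> A \<longrightarrow> (L2_norm M (F i))\<^sup>2 - (\<Sum>a\<in>A. (cmod (b i a))\<^sup>2) \<le> e)"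
    by blast
  then obtain B where B: "\<And>i. i \<in> {1..n} \<Longrightarrow> finite (B i)"
    "\<And>i A. i \<in> {1..n} \<Longrightarrow> finite A \<Longrightarrow> B i \<subseteq> A \<Longrightarrow> (L2_norm M (F i))\<^sup>2 - (\<Sum>a\<in>A. (cmod (b i a))\<^sup>2) \<le> e"
    by metis
  define A where "A = (\<Union>i\<in>{1..n}. B i)"
  have A: "finite A" unfolding A_def using B(1) by auto
  have err: "(L2_norm M (F i))\<^sup>2 - (\<Sum>a\<in>A. (cmod (b i a))\<^sup>2) \<le> e" if "i \<in> {1..n}" for i
    using that A by (intro B(2)) (auto simp: A_def)
  define z where "z a = (\<Sum>i=1..n. b i a)" for a
  define s where "s i l x = (\<Sum>a\<in>A. b i a * E a l x)" for i l x
  define G where "G i l x = (if i = l then F i x else 0) - s i l x" for i l x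
  have s: "s i l \<in> L2 M" if "l \<in> {1..n}" for i l
    unfolding s_def[abs_def] using E[OF that] by (intro L2_sum L2_cmult)
  have Fl: "(\<lambda>x. if i = l then F i x else 0) \<in> L2 M" if "i \<in> {1..n}" for i l
    using F[OF that] by (cases "i = l") auto
  have G: "G i l \<in> L2 M" if "i \<in> {1..n}" "l \<in> {1..n}" for i l
    unfolding G_def[abs_def] using that by (intro L2_diff Fl s)
  have G_norm: "(\<Sum>l=1..n. (L2_norm M (G i l))\<^sup>2) \<le> e" if i: "i \<in> {1..n}" for i
  proof -
    have one: "(L2_norm M (G i l))\<^sup>2 = (if i = l then (L2_norm M (F i))\<^sup>2 - 2 * (\<Sum>a\<in>A. (cmod (b i a))\<^sup>2) else 0) + Re (L2_inner M (s i l) (s i l))"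
      if l: "l \<in> {1..n}" for l
    proof -
      have sq: "(L2_norm M (s i l))\<^sup>2 = Re (L2_inner M (s i l) (s i l))" by (simp add: L2_inner_self)
      have "L2_inner M (F i) (s i i) = (\<Sum>a\<in>A. cnj (b i a) * b i a)"
        unfolding s_def[abs_def] using E[OF i] F[OF i]
        by (simp add: L2_inner_sum_right L2_cmult L2_inner_cmult_right b_def)
      also have "\<dots> = of_real (\<Sum>a\<in>A. (cmod (b i a))\<^sup>2)"
        by (simp only: complex_norm_square of_real_sum mult.commute)
      finally have in_Fs: "Re (L2_inner M (F i) (s i i)) = (\<Sum>a\<in>A. (cmod (b i a))\<^sup>2)" by simp
      have "(L2_norm M (G i l))\<^sup>2 = (L2_norm M (\<lambda>x. if i = l then F i x else 0))\<^sup>2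
          - 2 * Re (L2_inner M (\<lambda>x. if i = l then F i x else 0) (s i l)) + (L2_norm M (s i l))\<^sup>2"
        unfolding G_def[abs_def] by (rule L2_norm_diff_square[OF Fl[OF i] s[OF l]])
      then show ?thesis unfolding sq using in_Fs by (cases "i = l") (simp_all add: L2_inner_def)
    qed
    have "(\<Sum>l=1..n. L2_inner M (s i l) (s i l)) = (\<Sum>a\<in>A. \<Sum>a'\<in>A. b i a * (cnj (b i a') * (\<Sum>l=1..n. L2_inner M (E a l) (E a' l))))"
    proof -
      have "L2_inner M (s i l) (s i l) = (\<Sum>a\<in>A. \<Sum>a'\<in>A. b i a * (cnj (b i a') * L2_inner M (E a l) (E a' l)))" if l: "l \<in> {1..n}" for l
        unfolding s_def[abs_def] using E[OF l]
        by (simp add: L2_inner_sum_left L2_inner_sum_right L2_sum L2_cmult L2_inner_cmult_left L2_inner_cmult_right sum_distrib_left)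
      then have "(\<Sum>l=1..n. L2_inner M (s i l) (s i l)) = (\<Sum>l=1..n. \<Sum>a\<in>A. \<Sum>a'\<in>A. b i a * (cnj (b i a') * L2_inner M (E a l) (E a' l)))"
        by (rule sum.cong[OF refl])
      also have "\<dots> = (\<Sum>a\<in>A. \<Sum>l=1..n. \<Sum>a'\<in>A. b i a * (cnj (b i a') * L2_inner M (E a l) (E a' l)))" by (rule sum.swap)
      also have "\<dots> = (\<Sum>a\<in>A. \<Sum>a'\<in>A. \<Sum>l=1..n. b i a * (cnj (b i a') * L2_inner M (E a l) (E a' l)))"
        by (rule sum.cong[OF refl]) (rule sum.swap)
      finally show ?thesis by (simp only: sum_distrib_left)
    qed
    also have "\<dots> = (\<Sum>a\<in>A. \<Sum>a'\<in>A. if a = a' then b i a * cnj (b i a) else 0)"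
      unfolding orth by (intro sum.cong refl) auto
    also have "\<dots> = (\<Sum>a\<in>A. b i a * cnj (b i a))" using A by simp
    also have "\<dots> = of_real (\<Sum>a\<in>A. (cmod (b i a))\<^sup>2)" by (simp only: complex_norm_square of_real_sum)
    finally have ss: "(\<Sum>l=1..n. Re (L2_inner M (s i l) (s i l))) = (\<Sum>a\<in>A. (cmod (b i a))\<^sup>2)"
      by (simp only: Re_sum[symmetric] Re_complex_of_real)
    have "(\<Sum>l=1..n. (L2_norm M (G i l))\<^sup>2) = (\<Sum>l=1..n. (if i = l then (L2_norm M (F i))\<^sup>2 - 2 * (\<Sum>a\<in>A. (cmod (b i a))\<^sup>2) else 0) + Re (L2_inner M (s i l) (s i l)))"
      by (rule sum.cong[OF refl one])
    also have "\<dots> = (L2_norm M (F i))\<^sup>2 - (\<Sum>a\<in>A. (cmod (b i a))\<^sup>2)"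
      unfolding sum.distrib ss using i by simp
    finally show ?thesis using err[OF i] by simp
  qed
  have decomp: "F l x - (\<Sum>a\<in>A. z a * E a l x) = (\<Sum>i=1..n. G i l x)" if "l \<in> {1..n}" for l x
  proof -
    have "(\<Sum>i=1..n. G i l x) = (\<Sum>i=1..n. if i = l then F i x else 0) - (\<Sum>i=1..n. s i l x)"
      unfolding G_def by (rule sum_subtractf)
    also have "(\<Sum>i=1..n. if i = l then F i x else 0) = F l x" using that by simp
    also have "(\<Sum>i=1..n. s i l x) = (\<Sum>a\<in>A. z a * E a l x)"
      unfolding s_def z_def sum_distrib_right by (rule sum.swap)
    finally show ?thesis by simp
  qed
  have "(\<Sum>l=1..n. (L2_norm M (\<lambda>x. F l x - (\<Sum>a\<in>A. z a * E a l x)))\<^sup>2) = (\<Sum>l=1..n. (L2_norm M (\<lambda>x. \<Sum>i=1..n. G i l x))\<^sup>2)"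
    by (rule sum.cong[OF refl]) (simp only: decomp)
  also have "\<dots> \<le> (\<Sum>l=1..n. real (card {1..n}) * (\<Sum>i=1..n. (L2_norm M (G i l))\<^sup>2))"
    by (intro sum_mono L2_norm_sum_square_le G)
  also have "\<dots> = real n * (\<Sum>i=1..n. \<Sum>l=1..n. (L2_norm M (G i l))\<^sup>2)"
    unfolding sum_distrib_left[symmetric] by (subst sum.swap) simp
  also have "\<dots> \<le> real n * (\<Sum>i=1..n. e)" by (intro mult_left_mono sum_mono G_norm) simp_all
  also have "\<dots> = real n * real n * e" by simp
  also have "\<dots> < r\<^sup>2"
  proof -
    have "real n * real n * e < (real n * real n + 1) * e" using e by simp
    also have "\<dots> = r\<^sup>2" unfolding e_def by (simp add: add_nonneg_pos less_imp_neq[symmetric])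
    finally show ?thesis .
  qed
  finally have "L2_sum_norm M n (\<lambda>i x. F i x - (\<Sum>a\<in>A. z a * E a i x)) < sqrt (r\<^sup>2)"
    unfolding L2_sum_norm_def by (rule real_sqrt_less_mono)
  then show ?thesis using A r by auto
qed

context local_field_setup
begin

text \<open>The Fourier transform is unitary, so the frame identity may be tested on the Fourier side.\<close>
lemma Parseval_iff_fourier:
  assumes \<eta>: "\<eta> \<in> L2 \<mu>"
  shows "parseval_frame_wavelet q \<pp> v \<mu> \<eta> \<longleftrightarrow>
    (\<forall>f\<in>L2 \<mu>. ((\<lambda>(j, k). (cmod (L2_inner \<mu> f (wave (fourier chi \<mu> \<eta>) j k)))\<^sup>2) has_sum (L2_norm \<mu> f)\<^sup>2) UNIV)"
proof -
  let ?\<phi> = "fourier chi \<mu> \<eta>"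
  have coeff: "L2_inner \<mu> f (D j (T k \<eta>)) = L2_inner \<mu> g (wave ?\<phi> j k)"
    if f: "f \<in> L2 \<mu>" and g: "g \<in> L2 \<mu>" "AE \<xi> in \<mu>. fourier chi \<mu> f \<xi> = g \<xi>" for f g j k
  proof -
    have "L2_inner \<mu> f (D j (T k \<eta>)) = L2_inner \<mu> (fourier chi \<mu> f) (fourier chi \<mu> (D j (T k \<eta>)))"
      using f \<eta> by (intro Plancherel[symmetric]) simp_all
    also have "\<dots> = L2_inner \<mu> g (wave ?\<phi> j k)"
      using f g fourier_wavelet[OF \<eta>, of j k] \<eta>
      by (intro L2_inner_cong_AE L2_measurable) (simp_all add: wave_def[symmetric])
    finally show ?thesis .
  qed
  have norm: "L2_norm \<mu> g = L2_norm \<mu> f" if f: "f \<in> L2 \<mu>" and g: "g \<in> L2 \<mu>" "AE \<xi> in \<mu>. fourier chi \<mu> f \<xi> = g \<xi>" for f g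
    using L2_norm_cong_AE[OF _ _ g(2)] L2_norm_fourier[OF f] f g by simp
  show ?thesis
  proof
    assume "parseval_frame_wavelet q \<pp> v \<mu> \<eta>"
    then have P: "\<forall>f\<in>L2 \<mu>. ((\<lambda>(j, k). (cmod (L2_inner \<mu> f (D j (T k \<eta>))))\<^sup>2) has_sum (L2_norm \<mu> f)\<^sup>2) UNIV"
      by (simp add: parseval_frame_wavelet_def)
    show "\<forall>f\<in>L2 \<mu>. ((\<lambda>(j, k). (cmod (L2_inner \<mu> f (wave ?\<phi> j k)))\<^sup>2) has_sum (L2_norm \<mu> f)\<^sup>2) UNIV"
    proof
      fix g assume g: "g \<in> L2 \<mu>"
      then obtain f where f: "f \<in> L2 \<mu>" "AE \<xi> in \<mu>. fourier chi \<mu> f \<xi> = g \<xi>" by (rule fourier_surj)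
      show "((\<lambda>(j, k). (cmod (L2_inner \<mu> g (wave ?\<phi> j k)))\<^sup>2) has_sum (L2_norm \<mu> g)\<^sup>2) UNIV"
        using P[rule_format, OF f(1)] unfolding coeff[OF f(1) g f(2)] norm[OF f(1) g f(2)] .
    qed
  next
    assume Q: "\<forall>f\<in>L2 \<mu>. ((\<lambda>(j, k). (cmod (L2_inner \<mu> f (wave ?\<phi> j k)))\<^sup>2) has_sum (L2_norm \<mu> f)\<^sup>2) UNIV"
    show "parseval_frame_wavelet q \<pp> v \<mu> \<eta>"
      unfolding parseval_frame_wavelet_def
    proof (intro conjI ballI \<eta>)
      fix f assume f: "f \<in> L2 \<mu>"
      have r: "AE \<xi> in \<mu>. fourier chi \<mu> f \<xi> = fourier chi \<mu> f \<xi>" by simp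
      show "((\<lambda>(j, k). (cmod (L2_inner \<mu> f (D j (T k \<eta>))))\<^sup>2) has_sum (L2_norm \<mu> f)\<^sup>2) UNIV"
        using Q[rule_format, OF fourier_L2[OF f]]
        unfolding coeff[OF f fourier_L2[OF f] r] norm[OF f fourier_L2[OF f] r] .
    qed
  qed
qed

theorem Parseval_frame_wavelet_characterization:
  assumes \<eta>: "\<eta> \<in> L2 \<mu>"
  shows "parseval_frame_wavelet q \<pp> v \<mu> \<eta> \<longleftrightarrow>
    (AE \<xi> in \<mu>. ((\<lambda>j::int. (cmod (fourier chi \<mu> \<eta> (\<pp> powi j * \<xi>)))\<^sup>2) has_sum 1) UNIV) \<and>
    (\<forall>s. \<not> q dvd s \<longrightarrow> (AE \<xi> in \<mu>.
       (\<lambda>j::nat. fourier chi \<mu> \<eta> (\<pp> powi (- int j) * \<xi>) *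
          cnj (fourier chi \<mu> \<eta> (\<pp> powi (- int j) * (\<xi> + v s)))) sums 0))"
  unfolding Parseval_iff_fourier[OF \<eta>]
proof (intro iffI conjI allI impI ballI)
  assume P: "\<forall>f\<in>L2 \<mu>. ((\<lambda>(j, k). (cmod (L2_inner \<mu> f (wave (fourier chi \<mu> \<eta>) j k)))\<^sup>2) has_sum (L2_norm \<mu> f)\<^sup>2) UNIV"
  show "AE \<xi> in \<mu>. ((\<lambda>j::int. (cmod (fourier chi \<mu> \<eta> (\<pp> powi j * \<xi>)))\<^sup>2) has_sum 1) UNIV"
    by (rule shift_sums_if_Parseval(1)[OF fourier_L2[OF \<eta>] P])
  show "AE \<xi> in \<mu>. (\<lambda>j::nat. fourier chi \<mu> \<eta> (\<pp> powi (- int j) * \<xi>) *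
          cnj (fourier chi \<mu> \<eta> (\<pp> powi (- int j) * (\<xi> + v s)))) sums 0" if "\<not> q dvd s" for s
    by (rule shift_sums_if_Parseval(2)[OF fourier_L2[OF \<eta>] P that])
next
  fix f assume A: "(AE \<xi> in \<mu>. ((\<lambda>j::int. (cmod (fourier chi \<mu> \<eta> (\<pp> powi j * \<xi>)))\<^sup>2) has_sum 1) UNIV) \<and>
    (\<forall>s. \<not> q dvd s \<longrightarrow> (AE \<xi> in \<mu>.
       (\<lambda>j::nat. fourier chi \<mu> \<eta> (\<pp> powi (- int j) * \<xi>) *
          cnj (fourier chi \<mu> \<eta> (\<pp> powi (- int j) * (\<xi> + v s)))) sums 0))" and f: "f \<in> L2 \<mu>"
  show "((\<lambda>(j, k). (cmod (L2_inner \<mu> f (wave (fourier chi \<mu> \<eta>) j k)))\<^sup>2) has_sum (L2_norm \<mu> f)\<^sup>2) UNIV"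
    using A f by (intro Parseval_if_shift_sums fourier_L2 \<eta>) simp_all
qed

theorem super_wavelet_iff_Parseval_orthonormal:
  assumes \<eta>: "\<And>i. i \<in> {1..n} \<Longrightarrow> \<eta> i \<in> L2 \<mu>"
  shows "super_wavelet q \<pp> v \<mu> n \<eta> \<longleftrightarrow>
    (\<forall>i\<in>{1..n}. parseval_frame_wavelet q \<pp> v \<mu> (\<eta> i)) \<and> wavelet_system_orthonormal n \<eta>"
proof -
  define E where "E = (\<lambda>(j, k) i. D j (T k (\<eta> i)))"
  have inner: "L2_sum_inner \<mu> n (E a) (E b) = (\<Sum>i=1..n. L2_inner \<mu> (D (fst a) (T (snd a) (\<eta> i))) (D (fst b) (T (snd b) (\<eta> i))))" for a b
    by (simp add: L2_sum_inner_def E_def case_prod_unfold)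
  have orth: "(\<forall>a b. L2_sum_inner \<mu> n (E a) (E b) = (if a = b then 1 else 0)) \<longleftrightarrow> wavelet_system_orthonormal n \<eta>"
    unfolding inner wavelet_system_orthonormal_def by (simp add: prod_eq_iff)
  have E_L2: "E a i \<in> L2 \<mu>" if "i \<in> {1..n}" for a i
    using \<eta>[OF that] by (simp add: E_def case_prod_unfold)
  show ?thesis
  proof
    assume "super_wavelet q \<pp> v \<mu> n \<eta>"
    then have S: "\<forall>i\<in>{1..n}. parseval_frame_wavelet q \<pp> v \<mu> (\<eta> i)" "orthonormal_basis \<mu> n UNIV E"
      unfolding super_wavelet_def E_def by blast+
    then have "\<forall>a b. L2_sum_inner \<mu> n (E a) (E b) = (if a = b then 1 else 0)"
      unfolding orthonormal_basis_def by simp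
    then show "(\<forall>i\<in>{1..n}. parseval_frame_wavelet q \<pp> v \<mu> (\<eta> i)) \<and> wavelet_system_orthonormal n \<eta>"
      using S(1) orth by simp
  next
    assume A: "(\<forall>i\<in>{1..n}. parseval_frame_wavelet q \<pp> v \<mu> (\<eta> i)) \<and> wavelet_system_orthonormal n \<eta>"
    then have O: "L2_sum_inner \<mu> n (E a) (E b) = (if a = b then 1 else 0)" for a b using orth by blast
    have P: "((\<lambda>a. (cmod (L2_inner \<mu> f (E a i)))\<^sup>2) has_sum (L2_norm \<mu> f)\<^sup>2) UNIV" if "i \<in> {1..n}" "f \<in> L2 \<mu>" for i f
      using A that by (simp add: parseval_frame_wavelet_def E_def case_prod_unfold)
    have "\<exists>A z. finite A \<and> A \<subseteq> UNIV \<and> L2_sum_norm \<mu> n (\<lambda>i x. F i x - (\<Sum>a\<in>A. z a * E a i x)) < r"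
      if F: "F \<in> L2_sum \<mu> n" and r: "r > 0" for F r
    proof -
      have "F i \<in> L2 \<mu>" if "i \<in> {1..n}" for i using F that by (simp add: L2_sum_def)
      from orthonormal_Parseval_components_complete[OF E_L2 O[unfolded L2_sum_inner_def] P this r]
      show ?thesis by simp
    qed
    then have "orthonormal_basis \<mu> n UNIV E"
      unfolding orthonormal_basis_def using O E_L2 by (simp add: L2_sum_def)
    then show "super_wavelet q \<pp> v \<mu> n \<eta>" using A unfolding super_wavelet_def E_def by blast
  qed
qed

end

theorem theorem4p2:
  fixes p c q n :: nat
    and \<pp> :: "'k::nonarch_field"
    and \<epsilon> :: "nat \<Rightarrow> 'k"
    and chi :: "'k \<Rightarrow> complex"
    and \<mu> :: "'k measure"
    and \<eta> :: "nat \<Rightarrow> 'k \<Rightarrow> complex"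
  assumes "local_field_setup p c q \<pp> \<epsilon> chi \<mu>"
    and "n \<ge> 1"
    and "\<forall>i\<in>{1..n}. \<eta> i \<in> L2 \<mu>"
  shows "super_wavelet q \<pp> (u p c \<pp> \<epsilon>) \<mu> n \<eta> \<longleftrightarrow>
    (\<forall>i\<in>{1..n}. AE \<xi> in \<mu>.
       ((\<lambda>j::int. (cmod (fourier chi \<mu> (\<eta> i) (\<pp> powi j * \<xi>)))\<^sup>2) has_sum 1) UNIV) \<and>
    (\<forall>i\<in>{1..n}. \<forall>s. \<not> q dvd s \<longrightarrow> (AE \<xi> in \<mu>.
       (\<lambda>j::nat. fourier chi \<mu> (\<eta> i) (\<pp> powi (- int j) * \<xi>) *
          cnj (fourier chi \<mu> (\<eta> i) (\<pp> powi (- int j) * (\<xi> + u p c \<pp> \<epsilon> s)))) sums 0)) \<and>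
    (\<forall>j::nat. AE \<xi> in \<mu>.
       (\<lambda>k::nat. \<Sum>i=1..n. fourier chi \<mu> (\<eta> i) (\<pp> powi (- int j) * (\<xi> + u p c \<pp> \<epsilon> k)) *
          cnj (fourier chi \<mu> (\<eta> i) (\<xi> + u p c \<pp> \<epsilon> k))) sums (if j = 0 then 1 else 0))"
proof -
  interpret local_field_setup p c q \<pp> \<epsilon> chi \<mu> by fact
  have \<eta>: "\<eta> i \<in> L2 \<mu>" if "i \<in> {1..n}" for i using assms(3) that by simp
  have "super_wavelet q \<pp> v \<mu> n \<eta> \<longleftrightarrow>
      (\<forall>i\<in>{1..n}. parseval_frame_wavelet q \<pp> v \<mu> (\<eta> i)) \<and> wavelet_system_orthonormal n \<eta>"
    by (rule super_wavelet_iff_Parseval_orthonormal) (rule \<eta>)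
  moreover have "wavelet_system_orthonormal n \<eta> \<longleftrightarrow>
      (\<forall>m. AE \<xi> in \<mu>. (\<lambda>k. correlation n \<eta> m (\<xi> + v k)) sums (if m = 0 then 1 else 0))"
    by (rule orthonormal_iff_correlation) (rule \<eta>)
  moreover note Parseval_frame_wavelet_characterization[OF \<eta>]
  ultimately show ?thesis unfolding correlation_def by (simp add: ball_conj_distrib)
qed

end
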